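(* A Dirichlet series $f\in\mathcal N_u$ (with $\sigma_u(f)\le0$) is invertible in $\mathcal N_u$ if $f=\exp(g)$ for some $g\in\mathcal H^1$.
   Context: For $\theta\in\mathbb R$ put $\mathbb C_\theta=\{s\in\mathbb C:\operatorname{Re}s>\theta\}$. A Dirichlet series is a series $f(s)=\sum_{n\ge1}a_nn^{-s}$; its abscissa of uniform convergence $\sigma_u(f)\in[-\infty,+\infty]$ is the infimum of all $\theta\in\mathbb R$ such that the series converges uniformly on $\mathbb C_\theta$. The Nevanlinna class of Dirichlet series $\mathcal N_u$ consists of all Dirichlet series $f$ with $\sigma_u(f)\le0$ and $\limsup_{\sigma\to0^+}\lim_{T\to\infty}\frac1{2T}\int_{-T}^T\log^+|f(\sigma+it)|\,dt<\infty$, where $\log^+x=\max\{\log x,0\}$; such $f$ are holomorphic on $\mathbb C_0$. $\mathcal N_u$ is a unital algebra under pointwise multiplication, with identity the constant Dirichlet series $1$; $f\in\mathcal N_u$ is invertible if $1/f\in\mathcal N_u$. The Hardy space of Dirichlet series $\mathcal H^1$ is the completion of the space of Dirichlet polynomials $P(s)=\sum_{n=1}^Na_nn^{-s}$ in the norm $\|P\|_{\mathcal H^1}=\lim_{T\to\infty}\frac1{2T}\int_{-T}^T|P(it)|\,dt$; its elements are identified with Dirichlet series (which converge on $\mathbb C_{1/2}$), and $f=\exp(g)$ is understood as an identity of holomorphic functions (on the common half-plane of definition). *)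

theory Defs
  imports "HOL-Analysis.Analysis"
begin

text \<open>A Dirichlet series is represented by its coefficient sequence
  \<open>a :: nat \<Rightarrow> complex\<close>; the value \<open>a 0\<close> is never used.\<close>

definition half_plane :: "real \<Rightarrow> complex set" where
  "half_plane \<theta> = {s. Re s > \<theta>}"

definition dirichlet_psum :: "(nat \<Rightarrow> complex) \<Rightarrow> nat \<Rightarrow> complex \<Rightarrow> complex" where
  "dirichlet_psum a N s = (\<Sum>n=1..N. a n * of_nat n powr (- s))"

text \<open>Meaningful only at points \<open>s\<close> where the series converges.\<close>

definition dirichlet :: "(nat \<Rightarrow> complex) \<Rightarrow> complex \<Rightarrow> complex" where
  "dirichlet a s = (\<Sum>n. a (Suc n) * of_nat (Suc n) powr (- s))"

text \<open>The infimum is taken in the extended reals, so it is \<open>\<infinity>\<close> for the empty set.\<close>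

definition abscissa_uniform :: "(nat \<Rightarrow> complex) \<Rightarrow> ereal" where
  "abscissa_uniform a =
     Inf (ereal ` {\<theta>. uniformly_convergent_on (half_plane \<theta>) (dirichlet_psum a)})"

text \<open>\<open>Lim\<close> is a total function, with an unspecified value when there is no limit. Below
  the limit always exists: for \<open>abscissa_uniform a \<le> 0\<close> and \<open>\<sigma> > 0\<close> the function
  \<open>t \<mapsto> dirichlet a (\<sigma> + \<i>t)\<close> is a uniform limit of trigonometric polynomials, hence so is
  its composition with a continuous real function, and such functions have a mean value;
  the same applies to \<open>t \<mapsto> dirichlet p (\<i>t)\<close> for a Dirichlet polynomial \<open>p\<close>.\<close>

definition mean_value :: "(real \<Rightarrow> real) \<Rightarrow> real" where
  "mean_value h = Lim at_top (\<lambda>T. 1 / (2 * T) * integral {-T..T} h)"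

text \<open>In HOL \<open>ln 0 = 0\<close>, so \<open>log_plus 0 = 0\<close>, as it should be.\<close>

definition log_plus :: "real \<Rightarrow> real" where
  "log_plus x = max (ln x) 0"

definition Nevanlinna_u :: "(nat \<Rightarrow> complex) set" where
  "Nevanlinna_u = {a. abscissa_uniform a \<le> 0 \<and>
     Limsup (at_right 0)
       (\<lambda>\<sigma>. ereal (mean_value (\<lambda>t. log_plus (cmod (dirichlet a (Complex \<sigma> t)))))) < \<infinity>}"

definition invertible_Nevanlinna_u :: "(nat \<Rightarrow> complex) \<Rightarrow> bool" where
  "invertible_Nevanlinna_u a \<longleftrightarrow> a \<in> Nevanlinna_u \<and>
     (\<exists>b\<in>Nevanlinna_u. \<forall>s\<in>half_plane 0.
        dirichlet a s \<noteq> 0 \<and> dirichlet b s = 1 / dirichlet a s)"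

definition dirichlet_polynomial :: "(nat \<Rightarrow> complex) \<Rightarrow> bool" where
  "dirichlet_polynomial p \<longleftrightarrow> finite {n. p n \<noteq> 0}"

definition H1_norm :: "(nat \<Rightarrow> complex) \<Rightarrow> real" where
  "H1_norm p = mean_value (\<lambda>t. cmod (dirichlet p (Complex 0 t)))"

text \<open>The completion of the Dirichlet polynomials, each element of it being identified with
  the Dirichlet series it defines: each coefficient functional satisfies
  \<open>cmod (p n) \<le> H1_norm p\<close> and so extends to the completion, and the class of a Cauchy
  sequence of polynomials corresponds to the series of the limits of its coefficients.\<close>

definition Hardy1 :: "(nat \<Rightarrow> complex) set" where
  "Hardy1 = {b. \<exists>p :: nat \<Rightarrow> nat \<Rightarrow> complex.
     (\<forall>k. dirichlet_polynomial (p k)) \<and>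
     (\<forall>\<epsilon>>0. \<exists>K. \<forall>j\<ge>K. \<forall>k\<ge>K. H1_norm (\<lambda>n. p j n - p k n) < \<epsilon>) \<and>
     (\<forall>n\<ge>1. (\<lambda>k. p k n) \<longlonglongrightarrow> b n)}"

end

theory Submission
  imports Defs "HOL-Complex_Analysis.Complex_Analysis"
begin

text \<open>
  Write \<open>f\<close> and \<open>g\<close> also for the functions that the two series define, and \<open>C(\<theta>)\<close> for the
  half-plane \<open>Re s > \<theta>\<close>. The inverse of \<open>f = exp g\<close> can only be \<open>exp (- g)\<close>, but \<open>g\<close> is
  given far to the right only, and a zero of \<open>f\<close> in \<open>C(0)\<close> would prevent its continuation.
  The substance of the theorem is therefore that \<open>g\<close> itself converges uniformly on every
  \<open>C(\<theta>)\<close> with \<open>\<theta> > 0\<close> (\<open>logarithm_abscissa_uniform_le_0\<close>).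

  Membership of \<open>g\<close> in the Hardy space enters through the boundedness of its coefficients.
  Keep of both series only the terms whose index has all its prime factors at most \<open>d\<close>, and call
  the results \<open>f\<^sub>d\<close> and \<open>g\<^sub>d\<close>. This operation is multiplicative and continuous, so
  \<open>f\<^sub>d = exp g\<^sub>d\<close> far to the right (\<open>dirichlet_limit_exp\<close>, \<open>dirichlet_limit_unique\<close>). With
  bounded coefficients and finitely many primes \<open>g\<^sub>d\<close> converges absolutely on all of \<open>C(0)\<close>, so
  by the identity theorem \<open>f\<^sub>d = exp g\<^sub>d\<close> on \<open>C(0)\<close>. The operation also does not increase the
  supremum over a half-plane (\<open>coeff_on_contraction\<close>), so \<open>Re g\<^sub>d = ln \<bar>f\<^sub>d\<bar>\<close> is bounded above
  on \<open>C(\<epsilon>)\<close> independently of \<open>d\<close>, and the Borel-Caratheodory inequality bounds \<open>\<bar>g\<^sub>d\<bar>\<close> on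
  \<open>C(2 \<epsilon>)\<close> independently of \<open>d\<close>. The \<open>N\<close>-th partial sums of \<open>g\<close> and of \<open>g\<^sub>d\<close> agree for
  \<open>d \<ge> N\<close>, so Bohr's inequality (\<open>bohr_inequality\<close>), which controls partial sums by the
  supremum of the function at the price of a small shift to the right, bounds all partial sums
  of \<open>g\<close> on \<open>C(3 \<epsilon>)\<close>. By partial summation \<open>g\<close> converges uniformly on \<open>C(4 \<epsilon>)\<close>.

  The rest follows quickly. The function \<open>exp (- g)\<close> is on each \<open>C(\<theta>)\<close> a uniform limit of
  Dirichlet polynomials, and by Bohr's inequality such limits are uniformly convergent Dirichlet
  series slightly further to the right; this produces the coefficients of \<open>1 / f\<close>. On a vertical
  line \<open>log\<^sup>+ \<bar>1 / f\<bar> = log\<^sup>+ \<bar>f\<bar> - Re g\<close>, and the mean value of \<open>Re g\<close> is the real part of its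
  first coefficient, so the means of \<open>log\<^sup>+ \<bar>1 / f\<bar>\<close> and of \<open>log\<^sup>+ \<bar>f\<bar>\<close> differ by a constant.

  Bohr's inequality comes from a truncated Perron formula: the partial sums up to \<open>N\<close> of a
  Dirichlet polynomial are at most \<open>C N\<^sup>\<eta>\<close> times its supremum, for every \<open>\<eta> > 0\<close>
  (\<open>bohr_partial_sum_bound\<close>), and partial summation absorbs the factor \<open>N\<^sup>\<eta>\<close>.
\<close>

section \<open>Mean values on the real line\<close>

text \<open>
  Unlike the total function \<open>mean_value\<close>, this records that the limit exists.
\<close>

definition has_mean :: "(real \<Rightarrow> 'a::euclidean_space) \<Rightarrow> 'a \<Rightarrow> bool" where
  "has_mean h m \<longleftrightarrow> ((\<lambda>T. (1 / (2 * T)) *\<^sub>R integral {-T..T} h) \<longlongrightarrow> m) at_top"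

lemma mean_value_eq:
  assumes "has_mean h m"
  shows "mean_value h = m"
  using assms unfolding has_mean_def mean_value_def real_scaleR_def
  by (rule tendsto_Lim[OF trivial_limit_at_top_linorder])

lemma has_mean_unique: "has_mean h m \<Longrightarrow> has_mean h m' \<Longrightarrow> m = m'"
  unfolding has_mean_def using tendsto_unique trivial_limit_at_top_linorder by blast

lemma has_mean_linear:
  assumes "has_mean h m" "continuous_on UNIV h" "bounded_linear L"
  shows "has_mean (\<lambda>t. L (h t)) (L m)"
proof -
  have "integral {-T..T} (\<lambda>t. L (h t)) = L (integral {-T..T} h)" for T :: real
    using integral_linear[of h "{-T..T}" L] assms(2,3) integrable_continuous_interval
      continuous_on_subset[OF assms(2)] by (auto simp: o_def)
  then show ?thesis
    using assms(1) bounded_linear.tendsto[OF assms(3)] bounded_linear.linear[OF assms(3)]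
    unfolding has_mean_def by (force simp: linear_cmul)
qed

lemma has_mean_add:
  assumes "has_mean h m" "has_mean h' m'" "continuous_on UNIV h" "continuous_on UNIV h'"
  shows "has_mean (\<lambda>t. h t + h' t) (m + m')"
proof -
  have "integral {-T..T} (\<lambda>t. h t + h' t) = integral {-T..T} h + integral {-T..T} h'" for T :: real
    using integral_add assms(3,4) integrable_continuous_interval continuous_on_subset
    by (metis top_greatest)
  with tendsto_add[OF assms(1,2)[unfolded has_mean_def]] show ?thesis
    unfolding has_mean_def by (simp add: scaleR_add_right)
qed

lemma has_mean_sum:
  assumes "finite A" "\<And>i. i \<in> A \<Longrightarrow> has_mean (h i) (m i)" "\<And>i. i \<in> A \<Longrightarrow> continuous_on UNIV (h i)"
  shows "has_mean (\<lambda>t. \<Sum>i\<in>A. h i t) (\<Sum>i\<in>A. m i)"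
  using assms
proof (induction A rule: finite_induct)
  case empty
  then show ?case by (simp add: has_mean_def)
next
  case (insert x F)
  then show ?case by (auto intro!: has_mean_add continuous_on_sum)
qed

lemma has_mean_const: "has_mean (\<lambda>t. c) c"
proof -
  have "eventually (\<lambda>T. (1 / (2 * T)) *\<^sub>R integral {-T..T} (\<lambda>t. c) = c) at_top"
    using eventually_gt_at_top[of 0] by eventually_elim simp
  then show ?thesis unfolding has_mean_def by (rule tendsto_eventually)
qed

lemma has_mean_cis:
  assumes "l \<noteq> 0"
  shows "has_mean (\<lambda>t. exp (\<i> * of_real (l * t))) 0"
proof -
  let ?F = "\<lambda>t. exp (\<i> * of_real (l * t)) / (\<i> * of_real l)"
  have int: "integral {-T..T} (\<lambda>t. exp (\<i> * of_real (l * t))) = ?F T - ?F (-T)" if "T > 0" for T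
  proof (rule integral_unique, rule fundamental_theorem_of_calculus)
    show "(?F has_vector_derivative exp (\<i> * of_real (l * x))) (at x within {-T..T})" for x
      using assms unfolding has_real_derivative_iff_has_vector_derivative[symmetric]
      by (auto intro!: derivative_eq_intros has_vector_derivative_real_field simp: field_simps)
  qed (use that in auto)
  have bd: "norm ((1 / (2 * T)) *\<^sub>R integral {-T..T} (\<lambda>t. exp (\<i> * of_real (l * t)))) \<le> (1 / \<bar>l\<bar>) * (1 / T)"
    if "T > 0" for T
  proof -
    have "norm (?F T - ?F (-T)) \<le> norm (?F T) + norm (?F (-T))" by (rule norm_triangle_ineq4)
    also have "\<dots> = 2 / \<bar>l\<bar>" by (simp add: norm_divide norm_mult)
    finally show ?thesis unfolding int[OF that] using that assms by (simp add: field_simps)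
  qed
  have "((\<lambda>T. (1 / \<bar>l\<bar>) * (1 / T)) \<longlongrightarrow> 0) at_top"
    by (intro tendsto_mult_right_zero tendsto_divide_0[OF tendsto_const] filterlim_at_top_imp_at_infinity filterlim_ident)
  then show ?thesis unfolding has_mean_def
    by (rule Lim_null_comparison[rotated])
       (use eventually_gt_at_top[of 0] in eventually_elim, use bd in blast)
qed

lemma mean_integral_bound:
  fixes h :: "real \<Rightarrow> 'a::euclidean_space"
  assumes "continuous_on UNIV h" "\<And>t. norm (h t) \<le> B" "T > 0"
  shows "norm ((1 / (2 * T)) *\<^sub>R integral {-T..T} h) \<le> B"
proof -
  have "norm (integral {-T..T} h) \<le> B * (T - (-T))"
    using assms(2,3) continuous_on_subset[OF assms(1) subset_UNIV] by (intro integral_bound) auto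
  then show ?thesis using assms(3) by (simp add: field_simps)
qed

lemma has_mean_bound:
  assumes "has_mean h m" "continuous_on UNIV h" "\<And>t. norm (h t) \<le> B"
  shows "norm m \<le> B"
proof (rule tendsto_upperbound[OF tendsto_norm[OF assms(1)[unfolded has_mean_def]]])
  show "\<forall>\<^sub>F T in at_top. norm ((1 / (2 * T)) *\<^sub>R integral {-T..T} h) \<le> B"
    using eventually_gt_at_top[of 0] by eventually_elim (intro mean_integral_bound assms)
qed auto

lemma has_mean_norm_le:
  fixes h :: "real \<Rightarrow> 'a::euclidean_space"
  assumes "has_mean h m" "has_mean k l" "continuous_on UNIV h" "continuous_on UNIV k"
    and "\<And>t. norm (h t) \<le> k t"
  shows "norm m \<le> (l::real)"
proof (rule tendsto_le[OF _ assms(2)[unfolded has_mean_def] tendsto_norm[OF assms(1)[unfolded has_mean_def]]])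
  show "\<forall>\<^sub>F T in at_top. norm ((1 / (2 * T)) *\<^sub>R integral {-T..T} h) \<le> (1 / (2 * T)) *\<^sub>R integral {-T..T} k"
    using eventually_gt_at_top[of 0]
  proof eventually_elim
    case (elim T)
    have "norm (integral {-T..T} h) \<le> integral {-T..T} k"
      using assms(5) continuous_on_subset[OF assms(3) subset_UNIV] continuous_on_subset[OF assms(4) subset_UNIV]
      by (intro integral_norm_bound_integral integrable_continuous_interval) auto
    then show ?case using elim by (simp add: field_simps)
  qed
qed auto

lemma mean_integral_diff:
  fixes h :: "real \<Rightarrow> 'a::euclidean_space"
  assumes "continuous_on UNIV h" "continuous_on UNIV k" "\<And>t. norm (h t - k t) \<le> B" "T > 0"
  shows "norm ((1 / (2 * T)) *\<^sub>R integral {-T..T} h - (1 / (2 * T)) *\<^sub>R integral {-T..T} k) \<le> B"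
proof -
  have "integral {-T..T} h - integral {-T..T} k = integral {-T..T} (\<lambda>t. h t - k t)"
    using continuous_on_subset[OF assms(1) subset_UNIV] continuous_on_subset[OF assms(2) subset_UNIV]
    by (intro integral_diff[symmetric] integrable_continuous_interval) auto
  then show ?thesis
    using mean_integral_bound[of "\<lambda>t. h t - k t" B T] assms
    by (simp add: scaleR_diff_right[symmetric] continuous_on_diff)
qed

text \<open>
  Averaging over an interval does not increase the supremum norm, so the averages of \<open>h\<close> stay within
  \<open>e\<close> of those of the approximants.
\<close>

lemma has_mean_uniform_approx:
  fixes h :: "real \<Rightarrow> 'a::euclidean_space"
  assumes "continuous_on UNIV h"
    and "\<And>e. e > 0 \<Longrightarrow> \<exists>k. has_mean k m \<and> continuous_on UNIV k \<and> (\<forall>t. norm (h t - k t) \<le> e)"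
  shows "has_mean h m"
  unfolding has_mean_def tendsto_iff
proof (intro allI impI)
  fix e :: real assume "e > 0"
  then obtain k where k: "has_mean k m" "continuous_on UNIV k" "\<And>t. norm (h t - k t) \<le> e / 2"
    using assms(2)[of "e/2"] by auto
  have "\<forall>\<^sub>F T in at_top. dist ((1 / (2 * T)) *\<^sub>R integral {-T..T} k) m < e / 2"
    using k(1) \<open>e > 0\<close> unfolding has_mean_def by (intro tendstoD) auto
  then show "\<forall>\<^sub>F T in at_top. dist ((1 / (2 * T)) *\<^sub>R integral {-T..T} h) m < e"
    using eventually_gt_at_top[of 0]
  proof eventually_elim
    case (elim T)
    have "dist ((1 / (2 * T)) *\<^sub>R integral {-T..T} h) ((1 / (2 * T)) *\<^sub>R integral {-T..T} k) \<le> e / 2"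
      unfolding dist_norm using mean_integral_diff[OF assms(1) k(2,3) elim(2)] .
    with elim(1) show ?case by metric
  qed
qed

text \<open>
  For the same reason the means of better and better approximants form a Cauchy sequence; its
  limit is the mean of \<open>h\<close>.
\<close>

lemma has_mean_exists_uniform_approx:
  fixes h :: "real \<Rightarrow> 'a::euclidean_space"
  assumes "continuous_on UNIV h"
    and "\<And>e. e > 0 \<Longrightarrow> \<exists>k m. has_mean k m \<and> continuous_on UNIV k \<and> (\<forall>t. norm (h t - k t) \<le> e)"
  shows "\<exists>m. has_mean h m"
proof -
  let ?e = "\<lambda>i::nat. 1 / real (Suc i)"
  have "\<forall>i. \<exists>k m. has_mean k m \<and> continuous_on UNIV k \<and> (\<forall>t. norm (h t - k t) \<le> ?e i)"
    using assms(2) by auto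
  then obtain k m where k: "\<And>i. has_mean (k i) (m i)" "\<And>i. continuous_on UNIV (k i)"
    "\<And>i t. norm (h t - k i t) \<le> ?e i"
    by metis
  have "norm (m i - m j) \<le> ?e i + ?e j" for i j
  proof (rule has_mean_bound[of "\<lambda>t. k i t - k j t"])
    show "has_mean (\<lambda>t. k i t - k j t) (m i - m j)"
      using has_mean_add[OF k(1)[of i] has_mean_linear[OF k(1)[of j] k(2) bounded_linear_minus[OF bounded_linear_ident]]] k(2)
      by (simp add: continuous_on_minus)
    show "norm (k i t - k j t) \<le> ?e i + ?e j" for t
      using k(3)[of t i] k(3)[of t j] norm_triangle_ineq4[of "h t - k j t" "h t - k i t"] by simp
  qed (use k(2) in \<open>auto intro: continuous_on_diff\<close>)
  then have d: "dist (m i) (m j) \<le> ?e i + ?e j" for i j by (simp add: dist_norm)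
  have "Cauchy m"
  proof (rule metric_CauchyI)
    fix e :: real assume "e > 0"
    then obtain N where N: "?e N < e / 2" using nat_approx_posE[of "e/2"] by auto
    have "dist (m i) (m j) < e" if "i \<ge> N" "j \<ge> N" for i j
    proof -
      have "?e i \<le> ?e N" "?e j \<le> ?e N" using that by (auto simp: frac_le)
      with d[of i j] N show ?thesis by linarith
    qed
    then show "\<exists>M. \<forall>i\<ge>M. \<forall>j\<ge>M. dist (m i) (m j) < e" by blast
  qed
  then obtain l where l: "m \<longlonglongrightarrow> l" using Cauchy_convergent_iff convergent_def by blast
  have "has_mean h l"
  proof (rule has_mean_uniform_approx[OF assms(1)])
    fix e :: real assume "e > 0"
    then obtain N where N: "?e N < e / 2" using nat_approx_posE[of "e/2"] by auto
    obtain N' where N': "\<And>i. i \<ge> N' \<Longrightarrow> dist (m i) l < e / 2"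
      using l \<open>e > 0\<close> unfolding lim_sequentially by (metis half_gt_zero)
    define i where "i = max N N'"
    have i: "?e i \<le> ?e N" "dist (m i) l < e/2" using N' by (auto simp: frac_le i_def)
    have "has_mean (\<lambda>t. k i t + (l - m i)) (m i + (l - m i))"
      by (intro has_mean_add k has_mean_const continuous_intros)
    moreover have "norm (h t - (k i t + (l - m i))) \<le> e" for t
      using k(3)[of t i] i N norm_triangle_ineq4[of "h t - k i t" "l - m i"]
      by (simp add: dist_norm norm_minus_commute algebra_simps)
    ultimately show "\<exists>k. has_mean k l \<and> continuous_on UNIV k \<and> (\<forall>t. norm (h t - k t) \<le> e)"
      using k(2)[of i] by (intro exI[of _ "\<lambda>t. k i t + (l - m i)"]) (auto intro!: continuous_intros)
  qed
  then show ?thesis by blast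
qed

inductive trig_poly :: "(real \<Rightarrow> complex) \<Rightarrow> bool" where
  trig_poly_exp: "trig_poly (\<lambda>t. c * exp (\<i> * of_real (l * t)))"
| trig_poly_add: "trig_poly f \<Longrightarrow> trig_poly g \<Longrightarrow> trig_poly (\<lambda>t. f t + g t)"

lemma trig_poly_continuous: "trig_poly f \<Longrightarrow> continuous_on UNIV f"
  by (induction rule: trig_poly.induct) (auto intro!: continuous_intros)

lemma trig_poly_const: "trig_poly (\<lambda>t. c)"
  using trig_poly_exp[of c 0] by simp

lemma trig_poly_sum:
  "finite A \<Longrightarrow> (\<And>i. i \<in> A \<Longrightarrow> trig_poly (h i)) \<Longrightarrow> trig_poly (\<lambda>t. \<Sum>i\<in>A. h i t)"
  by (induction A rule: finite_induct) (auto intro: trig_poly_const trig_poly_add)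

lemma trig_poly_bounded: "trig_poly f \<Longrightarrow> \<exists>B. \<forall>t. norm (f t) \<le> B"
proof (induction rule: trig_poly.induct)
  case (trig_poly_exp c l)
  then show ?case by (auto simp: norm_mult)
next
  case (trig_poly_add f g)
  then show ?case by (metis add_mono norm_triangle_le)
qed

lemma trig_poly_mult: "trig_poly f \<Longrightarrow> trig_poly g \<Longrightarrow> trig_poly (\<lambda>t. f t * g t)"
proof (induction rule: trig_poly.induct)
  case (trig_poly_exp c l)
  then show ?case
  proof (induction rule: trig_poly.induct)
    case (trig_poly_exp c' l')
    have "(\<lambda>t. c * exp (\<i> * of_real (l * t)) * (c' * exp (\<i> * of_real (l' * t)))) =
          (\<lambda>t. (c * c') * exp (\<i> * of_real ((l + l') * t)))"
      by (simp add: fun_eq_iff algebra_simps exp_add)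
    then show ?case by (metis trig_poly.trig_poly_exp)
  next
    case (trig_poly_add f g)
    then show ?case using trig_poly.trig_poly_add by (simp add: algebra_simps)
  qed
next
  case (trig_poly_add f g)
  then show ?case using trig_poly.trig_poly_add by (simp add: algebra_simps)
qed

lemma trig_poly_cnj: "trig_poly f \<Longrightarrow> trig_poly (\<lambda>t. cnj (f t))"
proof (induction rule: trig_poly.induct)
  case (trig_poly_exp c l)
  then show ?case using trig_poly.trig_poly_exp[of "cnj c" "-l"] by (simp add: exp_cnj)
next
  case (trig_poly_add f g)
  then show ?case using trig_poly.trig_poly_add by simp
qed

lemma trig_poly_has_mean: "trig_poly f \<Longrightarrow> \<exists>m. has_mean f m"
proof (induction rule: trig_poly.induct)
  case (trig_poly_exp c l)
  show ?case
  proof (cases "l = 0")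
    case True
    then show ?thesis using has_mean_const[of c] by auto
  next
    case False
    have "has_mean (\<lambda>t. c * exp (\<i> * of_real (l * t))) (c * 0)"
      by (rule has_mean_linear[OF has_mean_cis[OF False]])
         (auto intro!: continuous_intros bounded_linear_mult_right)
    then show ?thesis by blast
  qed
next
  case (trig_poly_add f g)
  then show ?case using has_mean_add trig_poly_continuous by metis
qed

text \<open>
  The trigonometric polynomials form an algebra that is closed under complex conjugation, and a
  real-linear form on \<open>\<complex>\<close> is a complex-linear combination of \<open>z\<close> and \<open>cnj z\<close>.
\<close>

lemma trig_poly_real_polynomial:
  assumes "real_polynomial_function p" "trig_poly f"
  shows "trig_poly (\<lambda>t. of_real (p (f t)))"
  using assms(1)
proof (induction rule: real_polynomial_function.induct)
  case (linear p)
  then have lin: "linear p" by (rule bounded_linear.linear)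
  define u v where "u = p 1" and "v = p \<i>"
  have "p z = Re z * u + Im z * v" for z
  proof -
    have "z = Re z *\<^sub>R 1 + Im z *\<^sub>R \<i>" by (simp add: complex_eq_iff)
    then have "p z = p (Re z *\<^sub>R 1 + Im z *\<^sub>R \<i>)" by simp
    also have "\<dots> = Re z * u + Im z * v"
      unfolding u_def v_def by (simp only: linear_add[OF lin] linear_cmul[OF lin] real_scaleR_def)
    finally show ?thesis .
  qed
  then have eq: "of_real (p z) = ((of_real u - \<i> * of_real v) / 2) * z + ((of_real u + \<i> * of_real v) / 2) * cnj z" for z
    by (simp add: complex_eq_iff field_simps)
  show ?case
    unfolding eq by (intro trig_poly_add trig_poly_mult trig_poly_const trig_poly_cnj assms(2))
next
  case (const c)
  then show ?case by (simp add: trig_poly_const)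
next
  case (add f g)
  then show ?case by (simp add: trig_poly_add)
next
  case (mult f g)
  then show ?case by (simp add: trig_poly_mult)
qed

text \<open>
  The values of \<open>f\<close> stay in a disc, on which Stone-Weierstrass approximates \<open>\<phi>\<close> by polynomials
  in the real and imaginary part; these turn \<open>f\<close> into trigonometric polynomials again.
\<close>

lemma continuous_of_trig_poly_has_mean:
  fixes \<phi> :: "complex \<Rightarrow> real"
  assumes f: "trig_poly f" and \<phi>: "continuous_on UNIV \<phi>"
  shows "\<exists>m. has_mean (\<lambda>t. \<phi> (f t)) m"
proof (rule has_mean_exists_uniform_approx)
  show "continuous_on UNIV (\<lambda>t. \<phi> (f t))"
    by (rule continuous_on_compose2[OF \<phi> trig_poly_continuous[OF f]]) auto
  fix e :: real assume "e > 0"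
  obtain B where B: "\<And>t. norm (f t) \<le> B" using trig_poly_bounded[OF f] by blast
  obtain p where p: "real_polynomial_function p" "\<And>z. z \<in> cball 0 B \<Longrightarrow> \<bar>\<phi> z - p z\<bar> < e"
    using Stone_Weierstrass_real_polynomial_function[of "cball 0 B" \<phi> e] \<phi> \<open>e > 0\<close>
      continuous_on_subset by (metis compact_cball top_greatest)
  have tp: "trig_poly (\<lambda>t. of_real (p (f t)))" by (rule trig_poly_real_polynomial[OF p(1) f])
  then obtain m where "has_mean (\<lambda>t. of_real (p (f t)) :: complex) m"
    using trig_poly_has_mean by blast
  from has_mean_linear[OF this trig_poly_continuous[OF tp] bounded_linear_Re]
  have "has_mean (\<lambda>t. p (f t)) (Re m)" by simp
  moreover have "continuous_on UNIV (\<lambda>t. p (f t))"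
    using continuous_on_Re[OF trig_poly_continuous[OF tp]] by simp
  moreover have "norm (\<phi> (f t) - p (f t)) \<le> e" for t using p(2)[of "f t"] B[of t] by auto
  ultimately show "\<exists>k m. has_mean k m \<and> continuous_on UNIV k \<and> (\<forall>t. norm (\<phi> (f t) - k t) \<le> e)"
    by blast
qed

section \<open>Dirichlet polynomials and their coefficients\<close>

lemma of_nat_powr_eq_exp:
  assumes "n > 0"
  shows "of_nat n powr (z :: complex) = exp (z * of_real (ln (real n)))"
  using assms by (simp add: powr_def Ln_of_nat)

lemma norm_of_nat_powr: "n > 0 \<Longrightarrow> norm (of_nat n powr (z::complex)) = real n powr Re z"
  by (simp add: of_nat_powr_eq_exp powr_def)

lemma of_nat_powr_mult:
  "m > 0 \<Longrightarrow> n > 0 \<Longrightarrow> of_nat (m * n) powr (z::complex) = of_nat m powr z * of_nat n powr z"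
  by (simp add: of_nat_powr_eq_exp ln_mult exp_add[symmetric] distrib_left del: of_nat_mult)
     (simp add: ln_mult distrib_left)

lemma dirichlet_psum_cong:
  "(\<And>n. n \<in> {1..N} \<Longrightarrow> a n = b n) \<Longrightarrow> dirichlet_psum a N s = dirichlet_psum b N s"
  by (auto simp: dirichlet_psum_def intro!: sum.cong)

lemma dirichlet_psum_add: "dirichlet_psum (\<lambda>n. a n + b n) N s = dirichlet_psum a N s + dirichlet_psum b N s"
  by (simp add: dirichlet_psum_def sum.distrib algebra_simps)

lemma dirichlet_psum_diff: "dirichlet_psum (\<lambda>n. a n - b n) N s = dirichlet_psum a N s - dirichlet_psum b N s"
  by (simp add: dirichlet_psum_def sum_subtractf algebra_simps)

lemma dirichlet_psum_shift:
  "dirichlet_psum (\<lambda>n. a n * of_nat n powr (- w)) N s = dirichlet_psum a N (s + w)"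
  unfolding dirichlet_psum_def
  by (intro sum.cong) (auto simp: powr_add[symmetric] algebra_simps)

lemma dirichlet_psum_extend:
  assumes "N \<le> K"
  shows "dirichlet_psum a N s = dirichlet_psum (\<lambda>n. if n \<le> N then a n else 0) K s"
proof -
  have "(\<Sum>n=1..K. (if n \<le> N then a n else 0) * of_nat n powr (- s)) =
        (\<Sum>n=1..N. a n * of_nat n powr (- s))"
    using assms by (intro sum.mono_neutral_cong_right) auto
  then show ?thesis by (simp add: dirichlet_psum_def)
qed

lemma holomorphic_dirichlet_psum: "dirichlet_psum a N holomorphic_on A"
proof -
  have "(\<lambda>s. \<Sum>n=1..N. a n * exp (- s * of_real (ln (real n)))) holomorphic_on A"
    by (intro holomorphic_intros)
  moreover have "dirichlet_psum a N = (\<lambda>s. \<Sum>n=1..N. a n * exp (- s * of_real (ln (real n))))"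
    by (auto simp: dirichlet_psum_def of_nat_powr_eq_exp fun_eq_iff intro!: sum.cong)
  ultimately show ?thesis by simp
qed

lemma dirichlet_psum_bounded:
  assumes "s \<in> half_plane \<theta>"
  shows "norm (dirichlet_psum a N s) \<le> (\<Sum>n=1..N. norm (a n) * real n powr (- \<theta>))"
  unfolding dirichlet_psum_def
proof (rule order_trans[OF norm_sum], rule sum_mono)
  fix n assume n: "n \<in> {1..N}"
  have "real n powr (- Re s) \<le> real n powr (- \<theta>)"
    using n assms by (intro powr_mono) (auto simp: half_plane_def)
  then show "norm (a n * of_nat n powr - s) \<le> norm (a n) * real n powr - \<theta>"
    using n by (simp add: norm_mult norm_of_nat_powr mult_left_mono)
qed

lemma trig_poly_dirichlet_psum: "trig_poly (\<lambda>t. dirichlet_psum a N (Complex \<sigma> t))"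
  unfolding dirichlet_psum_def
proof (rule trig_poly_sum)
  fix n assume n: "n \<in> {1..N}"
  have "(\<lambda>t. a n * of_nat n powr (- Complex \<sigma> t)) =
        (\<lambda>t. (a n * exp (- of_real (\<sigma> * ln n))) * exp (\<i> * of_real (- ln n * t)))"
    using n by (auto simp: of_nat_powr_eq_exp exp_add[symmetric] Complex_eq algebra_simps fun_eq_iff)
  then show "trig_poly (\<lambda>t. a n * of_nat n powr (- Complex \<sigma> t))"
    using trig_poly_exp by metis
qed simp

text \<open>
  Distinct characters \<open>n\<^sup>-\<^sup>i\<^sup>t\<close> have distinct frequencies \<open>ln n\<close>, so they are orthogonal with
  respect to the mean value. This is what makes coefficients accessible as mean values.
\<close>

lemma has_mean_powr_orthogonal:
  assumes "m > 0" "n > 0"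
  shows "has_mean (\<lambda>t. of_nat n powr (- (\<i> * of_real t)) * of_nat m powr (\<i> * of_real t))
           (if n = m then 1 else 0 :: complex)"
proof -
  have eq: "(\<lambda>t. of_nat n powr (- (\<i> * of_real t)) * of_nat m powr (\<i> * of_real t)) =
        (\<lambda>t. exp (\<i> * complex_of_real ((ln m - ln n) * t)))"
    using assms by (auto simp: of_nat_powr_eq_exp exp_add[symmetric] algebra_simps fun_eq_iff)
  show ?thesis
  proof (cases "n = m")
    case True
    then show ?thesis unfolding eq using has_mean_const[of "1::complex"] by simp
  next
    case False
    then have "ln (real m) - ln (real n) \<noteq> 0" using assms by simp
    from has_mean_cis[OF this] show ?thesis unfolding eq using False by simp
  qed
qed

lemma continuous_on_nat_powr [continuous_intros]:
  assumes "n > 0" "continuous_on A f"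
  shows "continuous_on A (\<lambda>t. of_nat n powr (f t :: complex))"
  using assms by (simp add: of_nat_powr_eq_exp) (intro continuous_intros)

lemma dirichlet_psum_vertical:
  "dirichlet_psum a N (s + \<i> * of_real t) =
     (\<Sum>n=1..N. (a n * of_nat n powr (- s)) * of_nat n powr (- (\<i> * of_real t)))"
  unfolding dirichlet_psum_def by (intro sum.cong) (auto simp: powr_add[symmetric])

lemma has_mean_mult_left:
  fixes c :: complex
  assumes "has_mean h m" "continuous_on UNIV h"
  shows "has_mean (\<lambda>t. c * h t) (c * m)"
  by (rule has_mean_linear[OF assms bounded_linear_mult_right])

lemma has_mean_dirichlet_coeff:
  assumes "k > 0"
  shows "has_mean (\<lambda>t. dirichlet_psum a N (s + \<i> * of_real t) * of_nat k powr (\<i> * of_real t))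
           (if k \<le> N then a k * of_nat k powr (- s) else 0)"
proof -
  have "has_mean (\<lambda>t. \<Sum>n=1..N. (a n * of_nat n powr (- s)) *
            (of_nat n powr (- (\<i> * of_real t)) * of_nat k powr (\<i> * of_real t)))
          (\<Sum>n=1..N. (a n * of_nat n powr (- s)) * (if n = k then 1 else 0))"
    using assms
    by (intro has_mean_sum has_mean_mult_left has_mean_powr_orthogonal continuous_intros) auto
  moreover have "(\<Sum>n=1..N. (a n * of_nat n powr (- s)) * (if n = k then 1 else 0)) =
      (if k \<le> N then a k * of_nat k powr (- s) else 0)"
    using assms by (auto simp: if_distrib[of "\<lambda>x. _ * x"] sum.delta cong: if_cong)
  moreover have "dirichlet_psum a N (s + \<i> * of_real t) * of_nat k powr (\<i> * of_real t) =
      (\<Sum>n=1..N. (a n * of_nat n powr (- s)) *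
            (of_nat n powr (- (\<i> * of_real t)) * of_nat k powr (\<i> * of_real t)))" for t
    by (simp add: dirichlet_psum_vertical sum_distrib_right mult.assoc)
  ultimately show ?thesis by (simp only:)
qed

lemma continuous_on_dirichlet_psum_vertical [continuous_intros]:
  "continuous_on A (\<lambda>t. dirichlet_psum a N (s + \<i> * of_real t))"
proof -
  have "continuous_on UNIV (dirichlet_psum a N)"
    by (rule holomorphic_on_imp_continuous_on[OF holomorphic_dirichlet_psum])
  then show ?thesis
    by (rule continuous_on_compose2) (auto intro!: continuous_intros)
qed

text \<open>
  The mean value that gives a coefficient is bounded by the supremum on the vertical line.
\<close>

lemma dirichlet_coeff_bound:
  assumes "\<And>t. norm (dirichlet_psum a N (s + \<i> * of_real t)) \<le> M" "k \<in> {1..N}"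
  shows "norm (a k) * real k powr (- Re s) \<le> M"
proof -
  have "norm (if k \<le> N then a k * of_nat k powr (- s) else 0) \<le> M"
  proof (rule has_mean_bound[OF has_mean_dirichlet_coeff])
    show "norm (dirichlet_psum a N (s + \<i> * of_real t) * of_nat k powr (\<i> * of_real t)) \<le> M" for t
      using assms by (simp add: norm_mult norm_of_nat_powr)
  qed (use assms(2) in \<open>auto intro!: continuous_intros\<close>)
  then show ?thesis using assms(2) by (simp add: norm_mult norm_of_nat_powr)
qed

section \<open>Restriction of Dirichlet polynomials to multiplicative sets of indices\<close>

text \<open>
  For these sets of indices, restricting the coefficients is compatible with the product of
  Dirichlet series, see \<open>coeff_on_conv_coeff\<close>.
\<close>

definition multiplicative_set :: "nat set \<Rightarrow> bool" where
  "multiplicative_set S \<longleftrightarrow> 0 \<notin> S \<and> 1 \<in> S \<and> (\<forall>m>0. \<forall>n>0. m * n \<in> S \<longleftrightarrow> m \<in> S \<and> n \<in> S)"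

definition coeff_on :: "nat set \<Rightarrow> (nat \<Rightarrow> complex) \<Rightarrow> nat \<Rightarrow> complex" where
  "coeff_on S a n = (if n \<in> S then a n else 0)"

lemma dirichlet_psum_coeff_on:
  "dirichlet_psum (coeff_on S a) N s = (\<Sum>n\<in>{1..N} \<inter> S. a n * of_nat n powr (- s))"
  by (simp add: dirichlet_psum_def coeff_on_def if_distrib[of "\<lambda>x. x * _"] sum.inter_restrict cong: if_cong)

text \<open>
  For small \<open>\<delta> > 0\<close> consider the nonnegative kernel \<open>\<bar>Z t\<bar>\<^sup>2\<close>, where \<open>Z t\<close> is the sum of
  \<open>r\<^sup>-\<^sup>\<delta>\<^sup>-\<^sup>i\<^sup>t\<close> over the \<open>r \<in> S\<close> with \<open>r \<le> K\<close>, and let \<open>W K\<close> be its mean value, the sum of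
  \<open>r powr (- 2 \<delta>)\<close> over the same \<open>r\<close>. By orthogonality the mean of \<open>n\<^sup>-\<^sup>i\<^sup>t \<bar>Z t\<bar>\<^sup>2\<close> collects
  the pairs \<open>r, n r\<close> in \<open>S\<close>: it is \<open>0\<close> for \<open>n \<notin> S\<close> and \<open>n\<^sup>-\<^sup>\<delta> W (K / n)\<close> for \<open>n \<in> S\<close>. Averaging the
  polynomial at \<open>s - \<delta> + it\<close> against the kernel therefore selects the terms with \<open>n \<in> S\<close> and
  moves them back to \<open>s\<close>, up to the factors \<open>W (K / n)\<close>. After division by \<open>W K\<close> these factors
  tend to \<open>1\<close> as \<open>K\<close> grows, because the sums \<open>W K\<close> converge, while the normalized average never exceeds \<open>M\<close>.
\<close>

lemma coeff_on_contraction: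
  assumes S: "multiplicative_set S"
    and summ: "\<And>\<sigma>. \<sigma> > 0 \<Longrightarrow> summable (\<lambda>n. if n \<in> S then real n powr (- \<sigma>) else 0)"
    and bd: "\<And>s. s \<in> half_plane \<theta> \<Longrightarrow> norm (dirichlet_psum a N s) \<le> M"
    and s: "s \<in> half_plane \<theta>"
  shows "norm (dirichlet_psum (coeff_on S a) N s) \<le> M"
proof -
  define \<delta> where "\<delta> = (Re s - \<theta>) / 2"
  have \<delta>: "\<delta> > 0" "s - of_real \<delta> + \<i> * of_real t \<in> half_plane \<theta>" for t
    using s by (auto simp: \<delta>_def half_plane_def field_simps)
  define R where "R K = {1..K} \<inter> S" for K
  define W where "W K = (\<Sum>r\<in>R K. real r powr (- (2 * \<delta>)))" for K
  define Z where "Z K t = (\<Sum>r\<in>R K. of_nat r powr (- of_real \<delta>) * of_nat r powr (- (\<i> * complex_of_real t)))" for K t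
  define P where "P t = dirichlet_psum a N (s - of_real \<delta> + \<i> * of_real t)" for t
  have R: "finite (R K)" "\<And>r. r \<in> R K \<Longrightarrow> r > 0" for K by (auto simp: R_def)
  have cnjp: "cnj (of_nat r powr z) = of_nat r powr cnj z" if "r > 0" for r :: nat and z
    using that by (simp add: of_nat_powr_eq_exp exp_cnj)
  have contZ: "continuous_on UNIV (Z K)" for K
    unfolding Z_def using R by (intro continuous_intros) auto
  have contP: "continuous_on UNIV P" unfolding P_def by (intro continuous_intros)
  have cnjZ: "cnj (Z K t) = (\<Sum>r\<in>R K. of_nat r powr (- of_real \<delta>) * of_nat r powr (\<i> * of_real t))" for K t
    unfolding Z_def using R by (auto simp: cnjp intro!: sum.cong)
  \<comment> \<open>the mean of \<open>n\<^sup>-\<^sup>i\<^sup>t\<close> against the kernel, a count of pairs \<open>r\<close>, \<open>n * r\<close> in \<open>R K\<close>\<close>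
  have ker: "has_mean (\<lambda>t. of_nat n powr (- (\<i> * of_real t)) * (Z K t * cnj (Z K t)))
               (if n \<in> S then of_nat n powr (- of_real \<delta>) * of_real (W (K div n)) else 0)"
    if n: "n > 0" for n K
  proof -
    have 1: "has_mean (\<lambda>t. \<Sum>r\<in>R K. \<Sum>q\<in>R K. (of_nat r powr (- of_real \<delta>) * of_nat q powr (- of_real \<delta>)) *
            (of_nat (n * r) powr (- (\<i> * of_real t)) * of_nat q powr (\<i> * of_real t)))
          (\<Sum>r\<in>R K. \<Sum>q\<in>R K. (of_nat r powr (- of_real \<delta>) * of_nat q powr (- of_real \<delta>)) * (if n * r = q then 1 else 0 :: complex))"
      using n R
      by (intro has_mean_sum has_mean_mult_left has_mean_powr_orthogonal continuous_intros) auto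
    have 2: "(\<lambda>t. \<Sum>r\<in>R K. \<Sum>q\<in>R K. (of_nat r powr (- of_real \<delta>) * of_nat q powr (- of_real \<delta>)) *
            (of_nat (n * r) powr (- (\<i> * of_real t)) * of_nat q powr (\<i> * of_real t))) =
          (\<lambda>t. of_nat n powr (- (\<i> * of_real t)) * (Z K t * cnj (Z K t)))"
    proof (rule ext)
      fix t
      have "of_nat n powr (- (\<i> * of_real t)) * (Z K t * cnj (Z K t)) =
        (\<Sum>r\<in>R K. \<Sum>q\<in>R K. of_nat n powr (- (\<i> * of_real t)) * ((of_nat r powr (- of_real \<delta>) * of_nat r powr (- (\<i> * of_real t))) *
          (of_nat q powr (- of_real \<delta>) * of_nat q powr (\<i> * of_real t))))"
        unfolding cnjZ by (simp only: Z_def sum_product) (simp only: sum_distrib_left)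
      also have "\<dots> = (\<Sum>r\<in>R K. \<Sum>q\<in>R K. (of_nat r powr (- of_real \<delta>) * of_nat q powr (- of_real \<delta>)) *
            (of_nat (n * r) powr (- (\<i> * of_real t)) * of_nat q powr (\<i> * of_real t)))"
        using R n by (intro sum.cong refl) (simp only: of_nat_powr_mult mult_ac)
      finally show "(\<Sum>r\<in>R K. \<Sum>q\<in>R K. (of_nat r powr (- of_real \<delta>) * of_nat q powr (- of_real \<delta>)) *
            (of_nat (n * r) powr (- (\<i> * of_real t)) * of_nat q powr (\<i> * of_real t))) = of_nat n powr (- (\<i> * of_real t)) * (Z K t * cnj (Z K t))" ..
    qed
    have "(\<Sum>r\<in>R K. \<Sum>q\<in>R K. (of_nat r powr (- of_real \<delta>) * of_nat q powr (- of_real \<delta>)) * (if n * r = q then 1 else 0 :: complex))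
      = (\<Sum>r\<in>R K. if n * r \<in> R K then of_nat r powr (- of_real \<delta>) * of_nat (n * r) powr (- of_real \<delta>) else 0)"
      using R by (intro sum.cong refl) (simp add: if_distrib[of "\<lambda>x. _ * x"] cong: if_cong)
    also have "\<dots> = (\<Sum>r\<in>{r\<in>R K. n * r \<in> R K}. of_nat r powr (- of_real \<delta>) * of_nat (n * r) powr (- of_real \<delta>))"
      using R by (simp add: sum.inter_filter del: of_nat_mult)
    also have "\<dots> = (if n \<in> S then of_nat n powr (- of_real \<delta>) * of_real (W (K div n)) else 0)"
    proof (cases "n \<in> S")
      case True
      have "{r\<in>R K. n * r \<in> R K} = R (K div n)"
      proof (rule set_eqI)
        fix r
        have "r \<le> K div n \<longleftrightarrow> n * r \<le> K"
          using n by (simp add: less_eq_div_iff_mult_less_eq mult.commute)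
        moreover have "n * r \<in> S \<longleftrightarrow> r \<in> S" if "r > 0"
          using S True n that by (simp add: multiplicative_set_def)
        moreover have "r \<le> K" if "n * r \<le> K" using that n by (auto intro: le_trans[of r "n * r"])
        ultimately show "r \<in> {r \<in> R K. n * r \<in> R K} \<longleftrightarrow> r \<in> R (K div n)"
          using n unfolding R_def by (cases "r = 0") (auto simp: Suc_le_eq)
      qed
      moreover have "of_nat r powr (- of_real \<delta>) * of_nat (n * r) powr (- of_real \<delta>) =
          (of_nat n powr (- of_real \<delta>) * of_real (real r powr (- (2 * \<delta>))) :: complex)" if "r > 0" for r
      proof -
        have "of_nat r powr (- of_real \<delta>) * of_nat r powr (- of_real \<delta>) = complex_of_real (real r powr (- (2 * \<delta>)))"
          using that by (simp add: of_nat_powr_eq_exp powr_def exp_add[symmetric] exp_of_real[symmetric] mult.assoc)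
        then show ?thesis using that n by (simp only: of_nat_powr_mult mult_ac)
      qed
      ultimately show ?thesis using True R
        by (simp add: W_def sum_distrib_left of_real_sum del: of_nat_mult)
    next
      case False
      then have "{r\<in>R K. n * r \<in> R K} = {}"
        using S n unfolding R_def multiplicative_set_def by auto
      then show ?thesis using False by (simp only: sum.empty if_False)
    qed
    finally show ?thesis using 1 unfolding 2 by simp
  qed
  have fin: "norm (\<Sum>n\<in>{1..N} \<inter> S. a n * of_nat n powr (- s) * of_real (W (K div n))) \<le> M * W K" for K
  proof -
    have mn: "has_mean (\<lambda>t. P t * (Z K t * cnj (Z K t)))
       (\<Sum>n=1..N. (a n * of_nat n powr (- (s - of_real \<delta>))) *
           (if n \<in> S then of_nat n powr (- of_real \<delta>) * of_real (W (K div n)) else 0))"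
    proof -
      have "P t * (Z K t * cnj (Z K t)) = (\<Sum>n=1..N. (a n * of_nat n powr (- (s - of_real \<delta>))) *
          (of_nat n powr (- (\<i> * of_real t)) * (Z K t * cnj (Z K t))))" for t
        unfolding P_def dirichlet_psum_vertical sum_distrib_right by (simp only: mult_ac)
      then show ?thesis
        by (simp only:) (intro has_mean_sum has_mean_mult_left ker continuous_intros contZ, auto)
    qed
    have mz: "has_mean (\<lambda>t. M * Re (Z K t * cnj (Z K t))) (M * W K)"
    proof -
      have "has_mean (\<lambda>t. Z K t * cnj (Z K t)) (of_real (W K))"
        using ker[of 1 K] S by (simp add: multiplicative_set_def)
      from has_mean_linear[OF this, of "\<lambda>z. M * Re z"] show ?thesis
        by (simp add: contZ continuous_intros bounded_linear_mult_right[THEN bounded_linear_compose, OF bounded_linear_Re])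
    qed
    have eq: "(\<Sum>n=1..N. (a n * of_nat n powr (- (s - of_real \<delta>))) *
           (if n \<in> S then of_nat n powr (- of_real \<delta>) * of_real (W (K div n)) else 0)) =
        (\<Sum>n\<in>{1..N} \<inter> S. a n * of_nat n powr (- s) * of_real (W (K div n)))"
      unfolding sum.inter_restrict[OF finite_atLeastAtMost]
    proof (intro sum.cong refl)
      fix n assume "n \<in> {1..N}"
      have "of_nat n powr (- (s - of_real \<delta>)) * of_nat n powr (- of_real \<delta>) = (of_nat n powr (- s) :: complex)"
        by (simp add: powr_add[symmetric])
      then show "(a n * of_nat n powr (- (s - of_real \<delta>))) *
           (if n \<in> S then of_nat n powr (- of_real \<delta>) * of_real (W (K div n)) else 0) =
           (if n \<in> S then a n * of_nat n powr (- s) * of_real (W (K div n)) else 0)"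
        by (simp add: mult.assoc[symmetric])
    qed
    show ?thesis unfolding eq[symmetric]
    proof (rule has_mean_norm_le[OF mn mz])
      show "norm (P t * (Z K t * cnj (Z K t))) \<le> M * Re (Z K t * cnj (Z K t))" for t
        using bd[OF \<delta>(2)[of t]]
        unfolding complex_norm_square[symmetric] by (simp add: norm_mult P_def norm_power mult_right_mono)
    qed (auto intro!: continuous_intros contP contZ)
  qed
  define w where "w = (\<Sum>n. if n \<in> S then real n powr (- (2 * \<delta>)) else 0)"
  have Wlim: "W \<longlonglongrightarrow> w"
  proof -
    have "summable (\<lambda>n. if n \<in> S then real n powr (- (2 * \<delta>)) else 0)" using summ[of "2*\<delta>"] \<delta>(1) by simp
    then have "(\<lambda>K. \<Sum>n\<le>K. if n \<in> S then real n powr (- (2 * \<delta>)) else 0) \<longlonglongrightarrow> w"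
      unfolding w_def by (rule summable_LIMSEQ')
    moreover have "(\<Sum>n\<le>K. if n \<in> S then real n powr (- (2 * \<delta>)) else 0) = W K" for K
    proof -
      have "R K = {..K} \<inter> S" using S by (auto simp: R_def multiplicative_set_def Suc_le_eq intro: Nat.gr0I)
      then show ?thesis by (simp add: W_def sum.inter_restrict)
    qed
    ultimately show ?thesis by simp
  qed
  have "w \<ge> 1"
  proof -
    have "W K \<ge> 1" if "K \<ge> 1" for K
    proof -
      have "1 \<in> R K" using that S by (auto simp: R_def multiplicative_set_def)
      then have "real 1 powr (- (2 * \<delta>)) \<le> W K" unfolding W_def by (intro member_le_sum) (auto simp: R_def)
      then show ?thesis by simp
    qed
    then show ?thesis using Wlim by (intro LIMSEQ_le_const) auto
  qed
  have divlim: "(\<lambda>K. W (K div n)) \<longlonglongrightarrow> w" if "n > 0" for n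
  proof (rule filterlim_compose[OF Wlim])
    show "filterlim (\<lambda>K. K div n) sequentially sequentially"
      unfolding filterlim_at_top
    proof
      fix Z
      show "\<forall>\<^sub>F K in sequentially. Z \<le> K div n"
        using eventually_ge_at_top[of "Z * n"]
        by eventually_elim (use that in \<open>simp add: less_eq_div_iff_mult_less_eq\<close>)
    qed
  qed
  have "norm (\<Sum>n\<in>{1..N} \<inter> S. a n * of_nat n powr (- s) * of_real w) \<le> M * w"
  proof (rule tendsto_le[OF _ tendsto_mult_left[OF Wlim] tendsto_norm])
    show "(\<lambda>K. \<Sum>n\<in>{1..N} \<inter> S. a n * of_nat n powr (- s) * of_real (W (K div n)))
       \<longlonglongrightarrow> (\<Sum>n\<in>{1..N} \<inter> S. a n * of_nat n powr (- s) * of_real w)"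
      by (intro tendsto_intros divlim) auto
  qed (use fin in auto)
  then have "norm (dirichlet_psum (coeff_on S a) N s) * w \<le> M * w"
    using \<open>w \<ge> 1\<close> by (simp add: dirichlet_psum_coeff_on sum_distrib_right[symmetric] norm_mult)
  then show ?thesis using \<open>w \<ge> 1\<close> by simp
qed

text \<open>
  Series over these index sets converge absolutely on the whole right half-plane as soon as their
  coefficients are bounded, and \<open>coeff_on_contraction\<close> applies to them.
\<close>

definition thin_set :: "nat set \<Rightarrow> bool" where
  "thin_set S \<longleftrightarrow> multiplicative_set S \<and>
     (\<forall>\<sigma>>0. summable (\<lambda>n. if n \<in> S then real n powr (- \<sigma>) else 0))"

definition smooth_numbers :: "nat \<Rightarrow> nat set" where
  "smooth_numbers d = {n. n > 0 \<and> (\<forall>p. prime p \<longrightarrow> p dvd n \<longrightarrow> p \<le> d)}"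

lemma multiplicative_set_smooth_numbers: "multiplicative_set (smooth_numbers d)"
  by (auto simp: multiplicative_set_def smooth_numbers_def prime_dvd_mult_iff)

lemma smooth_numbers_self: "n > 0 \<Longrightarrow> n \<le> d \<Longrightarrow> n \<in> smooth_numbers d"
  by (auto simp: smooth_numbers_def dest: dvd_imp_le)

text \<open>
  Induction on the largest admissible prime \<open>p\<close>. The multiples of \<open>p\<close> up to \<open>K\<close> contribute
  at most \<open>p powr (- \<sigma>)\<close> times the whole sum \<open>T K\<close>, the others at most the bound \<open>B\<close> for the
  smaller primes, and \<open>T K \<le> B + p powr (- \<sigma>) * T K\<close> bounds \<open>T K\<close>.
\<close>

lemma smooth_numbers_sum_bounded:
  assumes "\<sigma> > 0"
  shows "\<exists>B. \<forall>K. (\<Sum>n\<in>{1..K} \<inter> smooth_numbers d. real n powr (- \<sigma>)) \<le> B"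
proof (induction d)
  case 0
  have "{1..K} \<inter> smooth_numbers 0 \<subseteq> {1}" for K
  proof
    fix n assume "n \<in> {1..K} \<inter> smooth_numbers 0"
    then have "\<not> (\<exists>p. prime p \<and> p dvd n)" by (auto simp: smooth_numbers_def prime_gt_0_nat)
    then show "n \<in> {1}" using prime_factor_nat[of n] by auto
  qed
  then have "(\<Sum>n\<in>{1..K} \<inter> smooth_numbers 0. real n powr (- \<sigma>)) \<le> (\<Sum>n\<in>{1::nat}. real n powr (- \<sigma>))" for K
    by (intro sum_mono2) auto
  then show ?case by blast
next
  case (Suc d)
  then obtain B where B: "\<And>K. (\<Sum>n\<in>{1..K} \<inter> smooth_numbers d. real n powr (- \<sigma>)) \<le> B" by blast
  show ?case
  proof (cases "prime (Suc d)")
    case False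
    then have "smooth_numbers (Suc d) = smooth_numbers d"
      by (auto simp: smooth_numbers_def) (metis le_SucE le_SucI)+
    then show ?thesis using Suc by simp
  next
    case True
    define p where "p = Suc d"
    define S where "S = smooth_numbers p"
    have p: "prime p" "p > 1" using True prime_gt_1_nat by (auto simp: p_def)
    define T where "T K = (\<Sum>n\<in>{1..K} \<inter> S. real n powr (- \<sigma>))" for K
    have step: "T K \<le> B + real p powr (- \<sigma>) * T K" for K
    proof -
      have eq: "{1..K} \<inter> S = ({1..K} \<inter> S) \<inter> {n. \<not> p dvd n} \<union> ({1..K} \<inter> S) \<inter> {n. p dvd n}" by auto
      have "T K = (\<Sum>n\<in>({1..K} \<inter> S) \<inter> {n. \<not> p dvd n}. real n powr (- \<sigma>)) +
          (\<Sum>n\<in>({1..K} \<inter> S) \<inter> {n. p dvd n}. real n powr (- \<sigma>))"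
        unfolding T_def by (subst eq, subst sum.union_disjoint) auto
      also have "(\<Sum>n\<in>({1..K} \<inter> S) \<inter> {n. \<not> p dvd n}. real n powr (- \<sigma>))
           \<le> (\<Sum>n\<in>{1..K} \<inter> smooth_numbers d. real n powr (- \<sigma>))"
      proof (rule sum_mono2)
        show "({1..K} \<inter> S) \<inter> {n. \<not> p dvd n} \<subseteq> {1..K} \<inter> smooth_numbers d"
          by (auto simp: S_def smooth_numbers_def p_def) (metis le_SucE)
      qed auto
      also have "\<dots> \<le> B" by (rule B)
      also have "(\<Sum>n\<in>({1..K} \<inter> S) \<inter> {n. p dvd n}. real n powr (- \<sigma>))
           \<le> (\<Sum>n\<in>(\<lambda>m. p * m) ` ({1..K} \<inter> S). real n powr (- \<sigma>))"
      proof (rule sum_mono2)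
        show "({1..K} \<inter> S) \<inter> {n. p dvd n} \<subseteq> (\<lambda>m. p * m) ` ({1..K} \<inter> S)"
        proof
          fix n assume n: "n \<in> ({1..K} \<inter> S) \<inter> {n. p dvd n}"
          then obtain m where m: "n = p * m" by (auto elim: dvdE)
          then have "m > 0" using n by (intro Nat.gr0I) auto
          moreover have "m \<le> n" using m p by simp
          then have "m \<le> K" using n by (auto intro: le_trans)
          ultimately have "m \<in> {1..K} \<inter> S"
            using n m p multiplicative_set_smooth_numbers[of p] by (simp add: multiplicative_set_def S_def)
          then show "n \<in> (\<lambda>m. p * m) ` ({1..K} \<inter> S)" using m by blast
        qed
      qed auto
      also have "\<dots> = (\<Sum>m\<in>{1..K} \<inter> S. real p powr (- \<sigma>) * real m powr (- \<sigma>))"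
        using p by (subst sum.reindex) (auto simp: inj_on_def powr_mult)
      finally show ?thesis by (simp add: T_def sum_distrib_left)
    qed
    have q: "real p powr (- \<sigma>) < 1" using p assms by (simp add: powr_less_one)
    have "T K \<le> B / (1 - real p powr (- \<sigma>))" for K
      using step[of K] q by (simp add: field_simps)
    then show ?thesis unfolding T_def S_def p_def by blast
  qed
qed

lemma thin_set_smooth_numbers: "thin_set (smooth_numbers d)"
  unfolding thin_set_def
proof (intro conjI allI impI multiplicative_set_smooth_numbers)
  fix \<sigma> :: real assume "\<sigma> > 0"
  then obtain B where B: "\<And>K. (\<Sum>n\<in>{1..K} \<inter> smooth_numbers d. real n powr (- \<sigma>)) \<le> B"
    using smooth_numbers_sum_bounded by blast
  show "summable (\<lambda>n. if n \<in> smooth_numbers d then real n powr (- \<sigma>) else 0)"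
  proof (rule bounded_imp_summable)
    fix K
    have "(\<Sum>n\<le>K. if n \<in> smooth_numbers d then real n powr (- \<sigma>) else 0) =
        (\<Sum>n\<in>{..K} \<inter> smooth_numbers d. real n powr (- \<sigma>))"
      by (rule sum.inter_restrict[symmetric]) simp
    also have "{..K} \<inter> smooth_numbers d = {1..K} \<inter> smooth_numbers d"
      by (auto simp: smooth_numbers_def)
    also have "(\<Sum>n\<in>{1..K} \<inter> smooth_numbers d. real n powr (- \<sigma>)) \<le> B" by (rule B)
    finally show "(\<Sum>n\<le>K. if n \<in> smooth_numbers d then real n powr (- \<sigma>) else 0) \<le> B" .
  qed simp
qed

section \<open>Uniform convergence of Dirichlet series\<close>

lemma dirichlet_psum_eq_lessThan: "dirichlet_psum a N s = (\<Sum>n<N. a (Suc n) * of_nat (Suc n) powr (- s))"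
  unfolding dirichlet_psum_def by (simp only: sum.atLeast1_atMost_eq One_nat_def)

lemma uniform_limit_dirichlet:
  assumes "uniformly_convergent_on A (dirichlet_psum a)"
  shows "uniform_limit A (dirichlet_psum a) (dirichlet a) sequentially"
proof -
  obtain h where h: "uniform_limit A (dirichlet_psum a) h sequentially"
    using assms by (auto simp: uniformly_convergent_on_def)
  have "dirichlet a s = h s" if "s \<in> A" for s
  proof -
    have "(\<lambda>N. dirichlet_psum a N s) \<longlonglongrightarrow> h s" using tendsto_uniform_limitI[OF h that] .
    then show ?thesis
      unfolding dirichlet_psum_eq_lessThan dirichlet_def by (intro sums_unique[symmetric]) (simp add: sums_def)
  qed
  then show ?thesis using h by (simp cong: uniform_limit_cong')
qed

lemma half_plane_mono: "\<theta> \<le> \<theta>' \<Longrightarrow> half_plane \<theta>' \<subseteq> half_plane \<theta>"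
  by (auto simp: half_plane_def)

lemma uniformly_convergent_on_dirichlet_psum:
  assumes "summable (\<lambda>n. norm (a n) * real n powr (- \<theta>))"
  shows "uniformly_convergent_on (half_plane \<theta>) (dirichlet_psum a)"
proof -
  have "summable (\<lambda>n. norm (a (Suc n)) * real (Suc n) powr (- \<theta>))"
    using assms by (subst summable_Suc_iff)
  then have lim: "uniform_limit (half_plane \<theta>) (\<lambda>N s. \<Sum>n<N. a (Suc n) * of_nat (Suc n) powr (- s))
     (\<lambda>s. \<Sum>n. a (Suc n) * of_nat (Suc n) powr (- s)) sequentially"
  proof (rule Weierstrass_m_test[rotated])
    fix n s assume s: "s \<in> half_plane \<theta>"
    have "real (Suc n) powr (- Re s) \<le> real (Suc n) powr (- \<theta>)"
      using s by (intro powr_mono) (auto simp: half_plane_def)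
    then show "norm (a (Suc n) * of_nat (Suc n) powr (- s)) \<le> norm (a (Suc n)) * real (Suc n) powr (- \<theta>)"
      by (simp add: norm_mult norm_of_nat_powr mult_left_mono del: of_nat_Suc)
  qed
  have eq: "dirichlet_psum a = (\<lambda>N s. \<Sum>n<N. a (Suc n) * of_nat (Suc n) powr (- s))"
    by (intro ext dirichlet_psum_eq_lessThan)
  show ?thesis unfolding eq using lim by (rule uniformly_convergentI)
qed

lemma abscissa_uniform_le_0_iff:
  "abscissa_uniform a \<le> 0 \<longleftrightarrow> (\<forall>\<theta>>0. uniformly_convergent_on (half_plane \<theta>) (dirichlet_psum a))"
proof
  assume l: "abscissa_uniform a \<le> 0"
  show "\<forall>\<theta>>0. uniformly_convergent_on (half_plane \<theta>) (dirichlet_psum a)"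
  proof (intro allI impI)
    fix \<theta> :: real assume "\<theta> > 0"
    then have "(0::ereal) < ereal \<theta>" by simp
    then have "Inf (ereal ` {\<theta>. uniformly_convergent_on (half_plane \<theta>) (dirichlet_psum a)}) < ereal \<theta>"
      by (rule order.strict_trans1[OF l[unfolded abscissa_uniform_def]])
    then obtain \<theta>' where "\<theta>' < \<theta>" "uniformly_convergent_on (half_plane \<theta>') (dirichlet_psum a)"
      unfolding Inf_less_iff by auto
    then show "uniformly_convergent_on (half_plane \<theta>) (dirichlet_psum a)"
      using uniformly_convergent_on_subset[OF _ half_plane_mono[OF less_imp_le]] by blast
  qed
next
  assume r: "\<forall>\<theta>>0. uniformly_convergent_on (half_plane \<theta>) (dirichlet_psum a)"
  have le: "abscissa_uniform a \<le> 0 + ereal e" if "e > 0" for e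
    unfolding abscissa_uniform_def using r that by (auto intro: Inf_lower)
  then show "abscissa_uniform a \<le> 0" by (rule ereal_le_epsilon2) (use le in simp)
qed

lemma open_half_plane: "open (half_plane \<theta>)"
  unfolding half_plane_def by (rule open_halfspace_Re_gt)

lemma connected_half_plane: "connected (half_plane \<theta>)"
  unfolding half_plane_def by (intro convex_connected convex_halfspace_Re_gt)

lemma holomorphic_dirichlet:
  assumes "uniformly_convergent_on (half_plane \<theta>) (dirichlet_psum a)"
  shows "dirichlet a holomorphic_on half_plane \<theta>"
proof (rule holomorphic_uniform_sequence[OF open_half_plane holomorphic_dirichlet_psum])
  fix s assume "s \<in> half_plane \<theta>"
  then obtain e where "e > 0" "cball s e \<subseteq> half_plane \<theta>"
    using open_half_plane open_contains_cball by blast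
  then show "\<exists>d>0. cball s d \<subseteq> half_plane \<theta> \<and> uniform_limit (cball s d) (dirichlet_psum a) (dirichlet a) sequentially"
    using uniform_limit_on_subset[OF uniform_limit_dirichlet[OF assms]] by blast
qed

lemma holomorphic_dirichlet_0:
  assumes "abscissa_uniform a \<le> 0"
  shows "dirichlet a holomorphic_on half_plane 0"
proof -
  have "half_plane 0 = (\<Union>\<theta>\<in>{0<..}. half_plane \<theta>)"
    by (auto simp: half_plane_def) (meson dense greaterThan_iff)
  moreover have "dirichlet a holomorphic_on (\<Union>\<theta>\<in>{0<..}. half_plane \<theta>)"
    using assms by (intro holomorphic_on_UN_open open_half_plane holomorphic_dirichlet)
      (auto simp: abscissa_uniform_le_0_iff)
  ultimately show ?thesis by simp
qed

lemma dirichlet_bounded: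
  assumes "uniformly_convergent_on (half_plane \<theta>) (dirichlet_psum a)"
  obtains B where "\<And>s. s \<in> half_plane \<theta> \<Longrightarrow> norm (dirichlet a s) \<le> B"
proof -
  have "\<forall>\<^sub>F N in sequentially. \<forall>s\<in>half_plane \<theta>. dist (dirichlet_psum a N s) (dirichlet a s) < 1"
    using uniform_limitD[OF uniform_limit_dirichlet[OF assms], of 1] by simp
  then obtain N where N: "\<And>s. s\<in>half_plane \<theta> \<Longrightarrow> dist (dirichlet_psum a N s) (dirichlet a s) < 1"
    by (auto simp: eventually_sequentially)
  have "norm (dirichlet a s) \<le> (\<Sum>n=1..N. norm (a n) * real n powr (- \<theta>)) + 1" if "s \<in> half_plane \<theta>" for s
    using N[OF that] dirichlet_psum_bounded[OF that, of a N]
      norm_triangle_ineq2[of "dirichlet a s" "dirichlet_psum a N s"]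
    by (simp add: dist_norm norm_minus_commute)
  then show ?thesis using that by blast
qed

lemma coeff_on_coeff_on_commute: "coeff_on S (coeff_on S' a) = coeff_on S' (coeff_on S a)"
  by (auto simp: coeff_on_def)

lemma dirichlet_psum_tail:
  assumes "M \<le> N"
  shows "dirichlet_psum a N s - dirichlet_psum a M s = dirichlet_psum (coeff_on {M<..} a) N s"
proof -
  have "{1..N} = {1..M} \<union> {M<..N}" using assms by auto
  then have "dirichlet_psum a N s = dirichlet_psum a M s + (\<Sum>n\<in>{M<..N}. a n * of_nat n powr (- s))"
    unfolding dirichlet_psum_def by (simp only:) (rule sum.union_disjoint, auto)
  moreover have "{1..N} \<inter> {M<..} = {M<..N}" by auto
  ultimately show ?thesis by (simp add: dirichlet_psum_coeff_on)
qed

text \<open>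
  A block of consecutive terms is itself a Dirichlet polynomial, so the contraction property
  transfers the Cauchy criterion.
\<close>

lemma uniformly_convergent_on_coeff_on:
  assumes "thin_set S" "uniformly_convergent_on (half_plane \<theta>) (dirichlet_psum a)"
  shows "uniformly_convergent_on (half_plane \<theta>) (dirichlet_psum (coeff_on S a))"
proof -
  have "uniformly_Cauchy_on (half_plane \<theta>) (dirichlet_psum a)"
    using assms(2) uniformly_convergent_Cauchy by blast
  have "uniformly_Cauchy_on (half_plane \<theta>) (dirichlet_psum (coeff_on S a))"
  proof (rule uniformly_Cauchy_onI')
    fix e :: real assume "e > 0"
    then obtain M where M: "\<And>s m n. s \<in> half_plane \<theta> \<Longrightarrow> m \<ge> M \<Longrightarrow> n \<ge> M \<Longrightarrow>
        dist (dirichlet_psum a m s) (dirichlet_psum a n s) < e / 2"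
      using \<open>uniformly_Cauchy_on _ _\<close> unfolding uniformly_Cauchy_on_def by (metis half_gt_zero)
    have "dist (dirichlet_psum (coeff_on S a) m s) (dirichlet_psum (coeff_on S a) n s) < e"
      if s: "s \<in> half_plane \<theta>" and mn: "m \<ge> M" "n > m" for s m n
    proof -
      have "norm (dirichlet_psum (coeff_on S (coeff_on {m<..} a)) n s) \<le> e / 2"
      proof (rule coeff_on_contraction[OF _ _ _ s])
        fix w assume "w \<in> half_plane \<theta>"
        from M[OF this, of m n] show "norm (dirichlet_psum (coeff_on {m<..} a) n w) \<le> e / 2"
          using mn by (simp add: dirichlet_psum_tail[symmetric] dist_norm norm_minus_commute)
      qed (use assms(1) in \<open>auto simp: thin_set_def\<close>)
      then have "dist (dirichlet_psum (coeff_on S a) m s) (dirichlet_psum (coeff_on S a) n s) \<le> e / 2"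
        using mn by (simp add: coeff_on_coeff_on_commute[of S] dirichlet_psum_tail[symmetric] dist_norm norm_minus_commute)
      then show ?thesis using \<open>e > 0\<close> by simp
    qed
    then show "\<exists>M. \<forall>x\<in>half_plane \<theta>. \<forall>m\<ge>M. \<forall>n>m.
        dist (dirichlet_psum (coeff_on S a) m x) (dirichlet_psum (coeff_on S a) n x) < e" by blast
  qed
  then show ?thesis by (rule Cauchy_uniformly_convergent)
qed

section \<open>Uniform limits of Dirichlet polynomials\<close>

text \<open>
  The function \<open>h\<close> is a uniform limit of Dirichlet polynomials, and \<open>h'\<close> is its image under the
  continuous extension of the map that keeps the terms with index in \<open>S\<close>. As a relation, defined
  by common approximation, this extension needs no coefficients for \<open>h\<close>, and its algebraic
  properties are inherited from polynomials. For \<open>S\<close> the set of all positive indices and \<open>h' = h\<close>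
  it just says that \<open>h\<close> is a uniform limit of Dirichlet polynomials.
\<close>

definition dirichlet_limit :: "nat set \<Rightarrow> real \<Rightarrow> (complex \<Rightarrow> complex) \<Rightarrow> (complex \<Rightarrow> complex) \<Rightarrow> bool" where
  "dirichlet_limit S \<theta> h h' \<longleftrightarrow> (\<forall>e>0. \<exists>a N. \<forall>s\<in>half_plane \<theta>.
     norm (h s - dirichlet_psum a N s) \<le> e \<and> norm (h' s - dirichlet_psum (coeff_on S a) N s) \<le> e)"

lemma dirichlet_limitE:
  assumes "dirichlet_limit S \<theta> h h'" "e > 0"
  obtains a N where
    "\<And>s. s \<in> half_plane \<theta> \<Longrightarrow> norm (h s - dirichlet_psum a N s) \<le> e"
    "\<And>s. s \<in> half_plane \<theta> \<Longrightarrow> norm (h' s - dirichlet_psum (coeff_on S a) N s) \<le> e"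
  using assms unfolding dirichlet_limit_def by metis

lemma dirichlet_limit_bounded:
  assumes "dirichlet_limit S \<theta> h h'"
  obtains B where "B > 0" "\<And>s. s \<in> half_plane \<theta> \<Longrightarrow> norm (h s) \<le> B" "\<And>s. s \<in> half_plane \<theta> \<Longrightarrow> norm (h' s) \<le> B"
proof -
  obtain a N where a: "\<And>s. s \<in> half_plane \<theta> \<Longrightarrow> norm (h s - dirichlet_psum a N s) \<le> 1"
    "\<And>s. s \<in> half_plane \<theta> \<Longrightarrow> norm (h' s - dirichlet_psum (coeff_on S a) N s) \<le> 1"
    by (rule dirichlet_limitE[OF assms zero_less_one]) blast
  define B where "B = (\<Sum>n=1..N. norm (a n) * real n powr (- \<theta>)) + 1"
  have "(\<Sum>n=1..N. norm (coeff_on S a n) * real n powr (- \<theta>)) \<le> (\<Sum>n=1..N. norm (a n) * real n powr (- \<theta>))"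
    by (intro sum_mono mult_right_mono) (auto simp: coeff_on_def)
  then have "norm (h s) \<le> B \<and> norm (h' s) \<le> B" if "s \<in> half_plane \<theta>" for s
    using a[OF that] dirichlet_psum_bounded[OF that, of a N] dirichlet_psum_bounded[OF that, of "coeff_on S a" N]
      norm_triangle_ineq2[of "h s" "dirichlet_psum a N s"] norm_triangle_ineq2[of "h' s" "dirichlet_psum (coeff_on S a) N s"]
    unfolding B_def by linarith
  moreover have "B > 0" unfolding B_def by (intro add_nonneg_pos sum_nonneg) auto
  ultimately show ?thesis using that by blast
qed

lemma dirichlet_limit_uniform_approx:
  assumes "\<And>e. e > 0 \<Longrightarrow> \<exists>k k'. dirichlet_limit S \<theta> k k' \<and>
      (\<forall>s\<in>half_plane \<theta>. norm (h s - k s) \<le> e \<and> norm (h' s - k' s) \<le> e)"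
  shows "dirichlet_limit S \<theta> h h'"
  unfolding dirichlet_limit_def
proof (intro allI impI)
  fix e :: real assume "e > 0"
  then obtain k k' where k: "dirichlet_limit S \<theta> k k'"
    "\<And>s. s\<in>half_plane \<theta> \<Longrightarrow> norm (h s - k s) \<le> e / 2" "\<And>s. s\<in>half_plane \<theta> \<Longrightarrow> norm (h' s - k' s) \<le> e / 2"
    using assms[of "e / 2"] by auto
  obtain a N where a: "\<And>s. s \<in> half_plane \<theta> \<Longrightarrow> norm (k s - dirichlet_psum a N s) \<le> e / 2"
    "\<And>s. s \<in> half_plane \<theta> \<Longrightarrow> norm (k' s - dirichlet_psum (coeff_on S a) N s) \<le> e / 2"
    using dirichlet_limitE[OF k(1), of "e / 2"] \<open>e > 0\<close> by auto
  have "norm (h s - dirichlet_psum a N s) \<le> e \<and> norm (h' s - dirichlet_psum (coeff_on S a) N s) \<le> e"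
    if "s \<in> half_plane \<theta>" for s
    using norm_diff_triangle_le[OF k(2)[OF that] a(1)[OF that]]
      norm_diff_triangle_le[OF k(3)[OF that] a(2)[OF that]] by simp
  then show "\<exists>a N. \<forall>s\<in>half_plane \<theta>. norm (h s - dirichlet_psum a N s) \<le> e \<and>
      norm (h' s - dirichlet_psum (coeff_on S a) N s) \<le> e" by blast
qed

lemma dirichlet_limit_psum: "dirichlet_limit S \<theta> (dirichlet_psum a N) (dirichlet_psum (coeff_on S a) N)"
  unfolding dirichlet_limit_def by (intro allI impI exI[of _ a] exI[of _ N]) auto

lemma dirichlet_limit_dirichlet:
  assumes "uniformly_convergent_on (half_plane \<theta>) (dirichlet_psum a)"
    and "uniformly_convergent_on (half_plane \<theta>) (dirichlet_psum (coeff_on S a))"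
  shows "dirichlet_limit S \<theta> (dirichlet a) (dirichlet (coeff_on S a))"
  unfolding dirichlet_limit_def
proof (intro allI impI)
  fix e :: real assume "e > 0"
  then have "\<forall>\<^sub>F N in sequentially. \<forall>s\<in>half_plane \<theta>. dist (dirichlet_psum a N s) (dirichlet a s) < e"
    "\<forall>\<^sub>F N in sequentially. \<forall>s\<in>half_plane \<theta>. dist (dirichlet_psum (coeff_on S a) N s) (dirichlet (coeff_on S a) s) < e"
    using uniform_limitD[OF uniform_limit_dirichlet[OF assms(1)]] uniform_limitD[OF uniform_limit_dirichlet[OF assms(2)]]
    by blast+
  then have "\<forall>\<^sub>F N in sequentially. \<forall>s\<in>half_plane \<theta>. norm (dirichlet a s - dirichlet_psum a N s) \<le> e \<and>
      norm (dirichlet (coeff_on S a) s - dirichlet_psum (coeff_on S a) N s) \<le> e"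
    by eventually_elim (auto simp: dist_norm norm_minus_commute less_imp_le)
  then show "\<exists>b N. \<forall>s\<in>half_plane \<theta>. norm (dirichlet a s - dirichlet_psum b N s) \<le> e \<and>
      norm (dirichlet (coeff_on S a) s - dirichlet_psum (coeff_on S b) N s) \<le> e"
    by (auto simp: eventually_sequentially)
qed

lemma dirichlet_limit_const:
  assumes "multiplicative_set S"
  shows "dirichlet_limit S \<theta> (\<lambda>s. c) (\<lambda>s. c)"
proof -
  have "dirichlet_psum (\<lambda>n. c) 1 = (\<lambda>s. c)" "dirichlet_psum (coeff_on S (\<lambda>n. c)) 1 = (\<lambda>s. c)"
    using assms by (auto simp: dirichlet_psum_def coeff_on_def multiplicative_set_def fun_eq_iff)
  then show ?thesis using dirichlet_limit_psum[of S \<theta> "\<lambda>n. c" 1] by simp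
qed

lemma dirichlet_limit_add:
  assumes "dirichlet_limit S \<theta> h h'" "dirichlet_limit S \<theta> k k'"
  shows "dirichlet_limit S \<theta> (\<lambda>s. h s + k s) (\<lambda>s. h' s + k' s)"
  unfolding dirichlet_limit_def
proof (intro allI impI)
  fix e :: real assume e: "e > 0"
  obtain a N where a: "\<And>s. s \<in> half_plane \<theta> \<Longrightarrow> norm (h s - dirichlet_psum a N s) \<le> e / 2"
    "\<And>s. s \<in> half_plane \<theta> \<Longrightarrow> norm (h' s - dirichlet_psum (coeff_on S a) N s) \<le> e / 2"
    using dirichlet_limitE[OF assms(1), of "e / 2"] e by auto
  obtain b M where b: "\<And>s. s \<in> half_plane \<theta> \<Longrightarrow> norm (k s - dirichlet_psum b M s) \<le> e / 2"
    "\<And>s. s \<in> half_plane \<theta> \<Longrightarrow> norm (k' s - dirichlet_psum (coeff_on S b) M s) \<le> e / 2"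
    using dirichlet_limitE[OF assms(2), of "e / 2"] e by auto
  define c where "c n = (if n \<le> N then a n else 0) + (if n \<le> M then b n else 0)" for n
  have c: "dirichlet_psum c (max N M) s = dirichlet_psum a N s + dirichlet_psum b M s" for s
    unfolding c_def dirichlet_psum_add by (simp add: dirichlet_psum_extend[symmetric])
  have cS: "dirichlet_psum (coeff_on S c) (max N M) s = dirichlet_psum (coeff_on S a) N s + dirichlet_psum (coeff_on S b) M s" for s
  proof -
    have "coeff_on S c = (\<lambda>n. (if n \<le> N then coeff_on S a n else 0) + (if n \<le> M then coeff_on S b n else 0))"
      by (auto simp: fun_eq_iff coeff_on_def c_def)
    then show ?thesis by (simp only: dirichlet_psum_add) (simp add: dirichlet_psum_extend[symmetric])
  qed
  have "norm (h s + k s - dirichlet_psum c (max N M) s) \<le> e \<and>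
      norm (h' s + k' s - dirichlet_psum (coeff_on S c) (max N M) s) \<le> e" if "s \<in> half_plane \<theta>" for s
    using a[OF that] b[OF that] norm_diff_triangle_ineq[of "h s" "k s" "dirichlet_psum a N s" "dirichlet_psum b M s"]
      norm_diff_triangle_ineq[of "h' s" "k' s" "dirichlet_psum (coeff_on S a) N s" "dirichlet_psum (coeff_on S b) M s"]
    unfolding c cS by linarith
  then show "\<exists>c N. \<forall>s\<in>half_plane \<theta>. norm (h s + k s - dirichlet_psum c N s) \<le> e \<and>
      norm (h' s + k' s - dirichlet_psum (coeff_on S c) N s) \<le> e" by blast
qed

text \<open>
  The Dirichlet convolution of the first \<open>N\<close> terms of \<open>a\<close> and the first \<open>M\<close> terms of \<open>b\<close>.
\<close>

definition conv_coeff :: "(nat \<Rightarrow> complex) \<Rightarrow> nat \<Rightarrow> (nat \<Rightarrow> complex) \<Rightarrow> nat \<Rightarrow> nat \<Rightarrow> complex" where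
  "conv_coeff a N b M n = (\<Sum>(i, j)\<in>{x\<in>{1..N} \<times> {1..M}. fst x * snd x = n}. a i * b j)"

lemma dirichlet_psum_conv_coeff:
  "dirichlet_psum (conv_coeff a N b M) (N * M) s = dirichlet_psum a N s * dirichlet_psum b M s"
proof -
  let ?A = "{1..N} \<times> {1..M}" and ?f = "\<lambda>x :: nat \<times> nat. fst x * snd x"
  let ?g = "\<lambda>x. a (fst x) * b (snd x) * of_nat (?f x) powr (- s)"
  have sub: "?f ` ?A \<subseteq> {1..N * M}"
    by (auto simp: Suc_le_eq mult_le_mono)
  have "dirichlet_psum a N s * dirichlet_psum b M s = (\<Sum>(i, j)\<in>?A. (a i * of_nat i powr (- s)) * (b j * of_nat j powr (- s)))"
    unfolding dirichlet_psum_def sum_product by (rule sum.cartesian_product)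
  also have "\<dots> = (\<Sum>x\<in>?A. ?g x)"
  proof (intro sum.cong refl)
    fix x assume "x \<in> ?A"
    then show "(case x of (i, j) \<Rightarrow> (a i * of_nat i powr (- s)) * (b j * of_nat j powr (- s))) = ?g x"
      by (cases x) (simp add: of_nat_powr_mult del: of_nat_mult)
  qed
  also have "\<dots> = (\<Sum>n\<in>{1..N * M}. \<Sum>x\<in>{x\<in>?A. ?f x = n}. ?g x)"
    by (rule sum.group[symmetric, OF _ _ sub]) auto
  also have "\<dots> = dirichlet_psum (conv_coeff a N b M) (N * M) s"
    unfolding dirichlet_psum_def conv_coeff_def sum_distrib_right
    by (intro sum.cong refl) auto
  finally show ?thesis ..
qed

lemma coeff_on_conv_coeff:
  assumes "multiplicative_set S"
  shows "coeff_on S (conv_coeff a N b M) = conv_coeff (coeff_on S a) N (coeff_on S b) M"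
proof
  fix n
  show "coeff_on S (conv_coeff a N b M) n = conv_coeff (coeff_on S a) N (coeff_on S b) M n"
  proof (cases "n \<in> S")
    case True
    have "i \<in> S \<and> j \<in> S" if "i \<in> {1..N}" "j \<in> {1..M}" "i * j = n" for i j
      using assms that True by (auto simp: multiplicative_set_def Suc_le_eq)
    then show ?thesis using True
      by (auto simp: coeff_on_def conv_coeff_def intro!: sum.cong)
  next
    case False
    have "i \<notin> S \<or> j \<notin> S" if "i \<in> {1..N}" "j \<in> {1..M}" "i * j = n" for i j
      using assms that False by (auto simp: multiplicative_set_def Suc_le_eq)
    then have "conv_coeff (coeff_on S a) N (coeff_on S b) M n = 0"
      unfolding conv_coeff_def by (intro sum.neutral) (force simp: coeff_on_def)
    then show ?thesis using False by (simp add: coeff_on_def)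
  qed
qed

lemma norm_mult_diff_le:
  fixes x y u v :: "'a::real_normed_algebra"
  assumes "norm (x - u) \<le> e" "norm (y - v) \<le> e" "norm x \<le> B" "norm y \<le> B" "e \<le> 1" "B \<ge> 0"
  shows "norm (x * y - u * v) \<le> e * (2 * B + 1)"
proof -
  have e: "e \<ge> 0" using norm_ge_zero assms(1) by (rule order_trans)
  have "norm v \<le> B + 1" using assms norm_triangle_ineq2[of v y] by (simp add: norm_minus_commute)
  have "x * y - u * v = x * (y - v) + (x - u) * v" by (simp add: algebra_simps)
  also have "norm \<dots> \<le> norm x * norm (y - v) + norm (x - u) * norm v"
    by (intro norm_triangle_le add_mono norm_mult_ineq)
  also have "\<dots> \<le> B * e + e * (B + 1)"
    using assms e \<open>norm v \<le> B + 1\<close> by (intro add_mono mult_mono) auto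
  finally show ?thesis by (simp add: algebra_simps)
qed

lemma dirichlet_limit_mult:
  assumes S: "multiplicative_set S"
    and "dirichlet_limit S \<theta> h h'" "dirichlet_limit S \<theta> k k'"
  shows "dirichlet_limit S \<theta> (\<lambda>s. h s * k s) (\<lambda>s. h' s * k' s)"
  unfolding dirichlet_limit_def
proof (intro allI impI)
  fix e :: real assume e: "e > 0"
  obtain B1 where B1: "B1 > 0" "\<And>s. s \<in> half_plane \<theta> \<Longrightarrow> norm (h s) \<le> B1" "\<And>s. s \<in> half_plane \<theta> \<Longrightarrow> norm (h' s) \<le> B1"
    by (rule dirichlet_limit_bounded[OF assms(2)]) blast
  obtain B2 where B2: "B2 > 0" "\<And>s. s \<in> half_plane \<theta> \<Longrightarrow> norm (k s) \<le> B2" "\<And>s. s \<in> half_plane \<theta> \<Longrightarrow> norm (k' s) \<le> B2"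
    by (rule dirichlet_limit_bounded[OF assms(3)]) blast
  define B where "B = max B1 B2"
  define d where "d = min 1 (e / (2 * B + 1))"
  have B: "B > 0" "B1 \<le> B" "B2 \<le> B" using B1(1) by (auto simp: B_def)
  have B': "2 * B + 1 > 0" using B by simp
  have "d \<le> e / (2 * B + 1)" by (simp add: d_def)
  then have "d * (2 * B + 1) \<le> e" using B' by (subst (asm) pos_le_divide_eq)
  moreover have "d > 0" "d \<le> 1" using e B' by (simp_all add: d_def)
  ultimately have d: "d > 0" "d \<le> 1" "d * (2 * B + 1) \<le> e" by simp_all
  obtain a N where a: "\<And>s. s \<in> half_plane \<theta> \<Longrightarrow> norm (h s - dirichlet_psum a N s) \<le> d"
    "\<And>s. s \<in> half_plane \<theta> \<Longrightarrow> norm (h' s - dirichlet_psum (coeff_on S a) N s) \<le> d"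
    by (rule dirichlet_limitE[OF assms(2) d(1)]) blast
  obtain b M where b: "\<And>s. s \<in> half_plane \<theta> \<Longrightarrow> norm (k s - dirichlet_psum b M s) \<le> d"
    "\<And>s. s \<in> half_plane \<theta> \<Longrightarrow> norm (k' s - dirichlet_psum (coeff_on S b) M s) \<le> d"
    by (rule dirichlet_limitE[OF assms(3) d(1)]) blast
  have "norm (h s * k s - dirichlet_psum (conv_coeff a N b M) (N * M) s) \<le> e \<and>
      norm (h' s * k' s - dirichlet_psum (coeff_on S (conv_coeff a N b M)) (N * M) s) \<le> e" if "s \<in> half_plane \<theta>" for s
    unfolding coeff_on_conv_coeff[OF S] dirichlet_psum_conv_coeff
    using B B1(2,3)[OF that] B2(2,3)[OF that] d a[OF that] b[OF that]
    by (intro conjI order_trans[OF norm_mult_diff_le d(3)]) auto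
  then show "\<exists>c N. \<forall>s\<in>half_plane \<theta>. norm (h s * k s - dirichlet_psum c N s) \<le> e \<and>
      norm (h' s * k' s - dirichlet_psum (coeff_on S c) N s) \<le> e" by blast
qed

text \<open>
  Since \<open>h\<close> and \<open>h'\<close> are bounded, the Taylor polynomials of the exponential function converge
  uniformly along them.
\<close>

lemma dirichlet_limit_exp:
  assumes S: "multiplicative_set S" and h: "dirichlet_limit S \<theta> h h'"
  shows "dirichlet_limit S \<theta> (\<lambda>s. exp (h s)) (\<lambda>s. exp (h' s))"
proof (rule dirichlet_limit_uniform_approx)
  fix e :: real assume e: "e > 0"
  obtain B where B: "B > 0" "\<And>s. s \<in> half_plane \<theta> \<Longrightarrow> norm (h s) \<le> B" "\<And>s. s \<in> half_plane \<theta> \<Longrightarrow> norm (h' s) \<le> B"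
    by (rule dirichlet_limit_bounded[OF h]) blast
  have pow: "dirichlet_limit S \<theta> (\<lambda>s. h s ^ k) (\<lambda>s. h' s ^ k)" for k
  proof (induction k)
    case 0
    then show ?case using dirichlet_limit_const[OF S] by simp
  next
    case (Suc k)
    then show ?case using dirichlet_limit_mult[OF S h Suc] by simp
  qed
  have sums: "dirichlet_limit S \<theta> (\<lambda>s. \<Sum>k\<le>n. h s ^ k / fact k) (\<lambda>s. \<Sum>k\<le>n. h' s ^ k / fact k)" for n
  proof (induction n)
    case 0
    then show ?case using dirichlet_limit_const[OF S] by simp
  next
    case (Suc n)
    have "dirichlet_limit S \<theta> (\<lambda>s. h s ^ Suc n * (1 / fact (Suc n))) (\<lambda>s. h' s ^ Suc n * (1 / fact (Suc n)))"
      by (rule dirichlet_limit_mult[OF S pow dirichlet_limit_const[OF S]])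
    from dirichlet_limit_add[OF Suc this] show ?case by simp
  qed
  have "(\<lambda>n. B ^ n / fact n) \<longlonglongrightarrow> 0"
    using summable_LIMSEQ_zero[OF summable_exp[of B]] by (simp add: field_simps)
  then have "(\<lambda>n. (exp B * B) * (B ^ n / fact n)) \<longlonglongrightarrow> (exp B * B) * 0" by (intro tendsto_intros)
  then have "\<forall>\<^sub>F n in sequentially. (exp B * B) * (B ^ n / fact n) < e"
    using e by (intro order_tendstoD) auto
  then obtain n where n: "(exp B * B) * (B ^ n / fact n) < e" by (auto simp: eventually_sequentially)
  have est: "norm (exp z - (\<Sum>k\<le>n. z ^ k / fact k)) \<le> e" if "norm z \<le> B" for z :: complex
  proof -
    have "norm (exp z - (\<Sum>k\<le>n. z ^ k / fact k)) \<le> exp (norm z) * norm z ^ Suc n / fact n"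
      by (rule Taylor_exp_field)
    also have "\<dots> \<le> exp B * B ^ Suc n / fact n"
      using that B(1) by (intro divide_right_mono mult_mono power_mono) auto
    also have "\<dots> = (exp B * B) * (B ^ n / fact n)" by simp
    finally show ?thesis using n by linarith
  qed
  show "\<exists>k k'. dirichlet_limit S \<theta> k k' \<and>
      (\<forall>s\<in>half_plane \<theta>. norm (exp (h s) - k s) \<le> e \<and> norm (exp (h' s) - k' s) \<le> e)"
    using sums[of n] est B by blast
qed

lemma dirichlet_limit_contraction:
  assumes S: "thin_set S" and h: "dirichlet_limit S \<theta> h h'"
    and bd: "\<And>s. s \<in> half_plane \<theta> \<Longrightarrow> norm (h s) \<le> M" and s: "s \<in> half_plane \<theta>"
  shows "norm (h' s) \<le> M"
proof (rule field_le_epsilon)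
  fix e :: real assume "e > 0"
  then obtain a N where a: "\<And>s. s \<in> half_plane \<theta> \<Longrightarrow> norm (h s - dirichlet_psum a N s) \<le> e / 2"
    "\<And>s. s \<in> half_plane \<theta> \<Longrightarrow> norm (h' s - dirichlet_psum (coeff_on S a) N s) \<le> e / 2"
    using dirichlet_limitE[OF h, of "e / 2"] by auto
  have "norm (dirichlet_psum a N w) \<le> M + e / 2" if "w \<in> half_plane \<theta>" for w
    using a(1)[OF that] bd[OF that] norm_triangle_ineq2[of "dirichlet_psum a N w" "h w"]
    by (simp add: norm_minus_commute)
  then have "norm (dirichlet_psum (coeff_on S a) N s) \<le> M + e / 2"
    using S s by (intro coeff_on_contraction) (auto simp: thin_set_def)
  then show "norm (h' s) \<le> M + e"
    using a(2)[OF s] norm_triangle_ineq2[of "h' s" "dirichlet_psum (coeff_on S a) N s"] by simp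
qed

text \<open>
  The difference \<open>h - k\<close> vanishes, and the contraction property forces its image \<open>h' - k'\<close> to
  vanish as well.
\<close>

lemma dirichlet_limit_unique:
  assumes S: "thin_set S" and "dirichlet_limit S \<theta> h h'" "dirichlet_limit S \<theta> k k'"
    and eq: "\<And>s. s \<in> half_plane \<theta> \<Longrightarrow> h s = k s" and s: "s \<in> half_plane \<theta>"
  shows "h' s = k' s"
proof -
  have m: "multiplicative_set S" using S by (simp add: thin_set_def)
  have "dirichlet_limit S \<theta> (\<lambda>s. h s + (-1) * k s) (\<lambda>s. h' s + (-1) * k' s)"
    by (intro dirichlet_limit_add dirichlet_limit_mult dirichlet_limit_const m assms(2,3))
  then have "norm (h' s + (-1) * k' s) \<le> 0"
    by (rule dirichlet_limit_contraction[OF S _ _ s]) (simp add: eq)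
  then show ?thesis by simp
qed

section \<open>The truncated Perron kernel\<close>

text \<open>
  The exponential is integrated rather than estimated by its maximum: the bound has to stay finite
  when the segment grows without limit in the direction of decay.
\<close>

lemma contour_integral_horizontal_exp_over:
  assumes "a \<le> b" "L \<noteq> 0" "t \<noteq> 0"
  shows "norm (contour_integral (linepath (Complex a t) (Complex b t)) (\<lambda>w. exp (of_real L * w) / w))
           \<le> (exp (L * b) - exp (L * a)) / (L * \<bar>t\<bar>)"
proof -
  let ?f = "\<lambda>w. exp (of_real L * w) / w"
  let ?g = "\<lambda>x. exp (L * (a + x * (b - a))) * (b - a) / \<bar>t\<bar>"
  have lp: "linepath (Complex a t) (Complex b t) x = Complex (a + x * (b - a)) t" for x
    by (simp add: linepath_def complex_eq_iff algebra_simps)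
  have nz: "Complex u t \<noteq> 0" for u using assms(3) by (simp add: complex_eq_iff)
  have cont: "continuous_on {0..1} (\<lambda>x. Complex (a + x * (b - a)) t)"
    by (simp add: Complex_eq) (intro continuous_intros)
  have g: "(?g has_integral (exp (L * (a + 1 * (b - a))) / (L * \<bar>t\<bar>) - exp (L * (a + 0 * (b - a))) / (L * \<bar>t\<bar>))) {0..1}"
    using assms
    by (intro fundamental_theorem_of_calculus)
       (auto intro!: derivative_eq_intros simp: has_real_derivative_iff_has_vector_derivative[symmetric] field_simps)
  have eq: "contour_integral (linepath (Complex a t) (Complex b t)) ?f =
      integral {0..1} (\<lambda>x. ?f (Complex (a + x * (b - a)) t) * (Complex b t - Complex a t))"
    by (simp add: contour_integral_integral lp)
  have ba: "Complex b t - Complex a t = of_real (b - a)" by (simp add: complex_eq_iff)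
  have "norm (contour_integral (linepath (Complex a t) (Complex b t)) ?f) \<le> integral {0..1} ?g"
    unfolding eq
  proof (rule integral_norm_bound_integral)
    show "(\<lambda>x. ?f (Complex (a + x * (b - a)) t) * (Complex b t - Complex a t)) integrable_on {0..1}"
      using nz by (intro integrable_continuous_interval continuous_intros cont) auto
    show "?g integrable_on {0..1}" using g by blast
    fix x :: real
    have "\<bar>t\<bar> \<le> norm (Complex (a + x * (b - a)) t)" using abs_Im_le_cmod[of "Complex (a + x * (b - a)) t"] by simp
    then show "norm (?f (Complex (a + x * (b - a)) t) * (Complex b t - Complex a t)) \<le> ?g x"
      using assms(1,3) unfolding ba by (auto simp: norm_mult norm_divide simp del: of_real_diff intro!: frac_le mult_right_mono)
  qed
  also have "integral {0..1} ?g = (exp (L * b) - exp (L * a)) / (L * \<bar>t\<bar>)"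
    using integral_unique[OF g] by (simp add: diff_divide_distrib)
  finally show ?thesis .
qed

lemma rectpath_contour_integral_eq:
  assumes "(f has_contour_integral v) (rectpath (Complex a (-T)) (Complex b T))"
    and "continuous_on (path_image (rectpath (Complex a (-T)) (Complex b T))) f"
    and "a \<le> b" "T > 0"
  shows "v = contour_integral (linepath (Complex a (-T)) (Complex b (-T))) f
           + contour_integral (linepath (Complex b (-T)) (Complex b T)) f
           - contour_integral (linepath (Complex a T) (Complex b T)) f
           - contour_integral (linepath (Complex a (-T)) (Complex a T)) f"
proof -
  let ?A = "Complex a (-T)" and ?B = "Complex b (-T)" and ?C = "Complex b T" and ?D = "Complex a T"
  have rp: "rectpath ?A ?C = linepath ?A ?B +++ linepath ?B ?C +++ linepath ?C ?D +++ linepath ?D ?A"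
    by (simp add: rectpath_def Let_def)
  have im: "path_image (rectpath ?A ?C) = closed_segment ?A ?B \<union> closed_segment ?B ?C
      \<union> closed_segment ?C ?D \<union> closed_segment ?D ?A"
    unfolding rp by (simp add: path_image_join Un_assoc)
  have ci: "f contour_integrable_on linepath ?A ?B" "f contour_integrable_on linepath ?B ?C"
     "f contour_integrable_on linepath ?C ?D" "f contour_integrable_on linepath ?D ?A"
    using assms(2) unfolding im by (auto intro!: contour_integrable_continuous_linepath elim: continuous_on_subset)
  have "v = contour_integral (rectpath ?A ?C) f" using assms(1) by (simp add: contour_integral_unique)
  also have "\<dots> = contour_integral (linepath ?A ?B) f + contour_integral (linepath ?B ?C) f
      + contour_integral (linepath ?C ?D) f + contour_integral (linepath ?D ?A) f"
    unfolding rp using ci by (simp add: contour_integrable_join)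
  also have "contour_integral (linepath ?C ?D) f = - contour_integral (linepath ?D ?C) f"
    using contour_integral_reversepath[of "linepath ?D ?C" f] by simp
  also have "contour_integral (linepath ?D ?A) f = - contour_integral (linepath ?A ?D) f"
    using contour_integral_reversepath[of "linepath ?A ?D" f] by simp
  finally show ?thesis by simp
qed

lemma contour_integral_vertical_exp_over:
  assumes "r \<noteq> 0" "T > 0"
  shows "norm (contour_integral (linepath (Complex r (-T)) (Complex r T)) (\<lambda>w. exp (of_real L * w) / w))
           \<le> exp (L * r) / \<bar>r\<bar> * (2 * T)"
proof -
  have seg: "Re w = r" if "w \<in> closed_segment (Complex r (-T)) (Complex r T)" for w
    using that by (simp add: closed_segment_same_Re)
  have "norm (contour_integral (linepath (Complex r (-T)) (Complex r T)) (\<lambda>w. exp (of_real L * w) / w))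
      \<le> exp (L * r) / \<bar>r\<bar> * norm (Complex r T - Complex r (-T))"
  proof (rule contour_integral_bound_linepath)
    show "(\<lambda>w. exp (of_real L * w) / w) contour_integrable_on linepath (Complex r (-T)) (Complex r T)"
      using assms by (intro contour_integrable_continuous_linepath continuous_intros) (auto dest: seg)
    fix w assume w: "w \<in> closed_segment (Complex r (-T)) (Complex r T)"
    show "norm (exp (of_real L * w) / w) \<le> exp (L * r) / \<bar>r\<bar>"
      using seg[OF w] abs_Re_le_cmod[of w] assms by (auto simp: norm_divide intro!: frac_le)
  qed auto
  also have "norm (Complex r T - Complex r (-T)) = 2 * T"
    using assms by (simp add: cmod_def real_sqrt_mult)
  finally show ?thesis .
qed

text \<open>
  For \<open>L < 0\<close> the vertical segment is closed up to a rectangle on the right, which avoids the pole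
  at \<open>0\<close>; for \<open>L > 0\<close> on the left, where the pole contributes \<open>2 \<pi> \<i>\<close>. The horizontal sides give
  the error term and the opposite vertical side disappears in the limit.
\<close>

lemma perron_kernel:
  assumes "L \<noteq> 0" "c > 0" "T > 0"
  shows "norm (contour_integral (linepath (Complex c (-T)) (Complex c T)) (\<lambda>w. exp (of_real L * w) / w)
            - (if L > 0 then 2 * of_real pi * \<i> else 0)) \<le> 2 * exp (L * c) / (T * \<bar>L\<bar>)"
proof -
  let ?f = "\<lambda>w. exp (of_real L * w) / w"
  let ?V = "\<lambda>r. contour_integral (linepath (Complex r (-T)) (Complex r T)) ?f"
  let ?v = "if L > 0 then 2 * of_real pi * \<i> else 0 :: complex"
  \<comment> \<open>push the line of integration far to the side where the exponential decays\<close>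
  define \<rho> where "\<rho> = (if L > 0 then -1 else 1 :: real)"
  have \<rho>: "L * \<rho> = - \<bar>L\<bar>" "\<bar>\<rho>\<bar> = 1" using assms by (auto simp: \<rho>_def)
  have est: "norm (?V c - ?v) \<le> 2 * exp (L * c) / (T * \<bar>L\<bar>) + exp (- \<bar>L\<bar> * R) / R * (2 * T)" if R: "R > c" for R
  proof (cases "L > 0")
    case True
    let ?p = "rectpath (Complex (-R) (-T)) (Complex c T)"
    have z: "0 \<in> box (Complex (-R) (-T)) (Complex c T)" using assms R by (simp add: in_box_complex_iff)
    then have nz: "0 \<notin> path_image ?p"
      using assms R by (subst path_image_rectpath_cbox_minus_box) auto
    have "((\<lambda>w. exp (of_real L * w) / (w - 0)) has_contour_integral
        (2 * pi * \<i> * winding_number ?p 0 * exp (of_real L * 0))) ?p"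
      using nz by (intro Cauchy_integral_formula_convex_simple[of UNIV]) (auto intro!: holomorphic_intros)
    then have "(?f has_contour_integral ?v) ?p"
      using winding_number_rectpath[OF z] True by simp
    moreover have "continuous_on (path_image ?p) ?f" using nz by (auto intro!: continuous_intros)
    ultimately have "?v = contour_integral (linepath (Complex (-R) (-T)) (Complex c (-T))) ?f + ?V c
        - contour_integral (linepath (Complex (-R) T) (Complex c T)) ?f - ?V (-R)"
      using assms R by (intro rectpath_contour_integral_eq) auto
    then have "?V c - ?v = contour_integral (linepath (Complex (-R) T) (Complex c T)) ?f + ?V (-R)
        - contour_integral (linepath (Complex (-R) (-T)) (Complex c (-T))) ?f" by (simp add: algebra_simps)
    also have "norm \<dots> \<le> (exp (L * c) - exp (L * - R)) / (L * \<bar>T\<bar>) + exp (L * - R) / \<bar>-R\<bar> * (2 * T)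
        + (exp (L * c) - exp (L * - R)) / (L * \<bar>-T\<bar>)"
      using assms R
      by (intro order_trans[OF norm_triangle_ineq4] add_mono order_trans[OF norm_triangle_ineq]
          contour_integral_horizontal_exp_over contour_integral_vertical_exp_over) auto
    also have "\<dots> \<le> exp (L * c) / (L * T) + exp (- L * R) / R * (2 * T) + exp (L * c) / (L * T)"
      using assms R True by (intro add_mono) (auto intro!: divide_right_mono)
    finally show ?thesis using True by (simp add: mult.commute)
  next
    case False
    let ?p = "rectpath (Complex c (-T)) (Complex R T)"
    have im: "path_image ?p \<subseteq> {w. Re w > 0}"
      using path_image_rectpath_subset_cbox[of "Complex c (-T)" "Complex R T"] assms R
      by (auto simp: in_cbox_complex_iff)
    have "(?f has_contour_integral 0) ?p"
      using im by (intro Cauchy_theorem_convex_simple[of _ "{w. Re w > 0}"])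
         (auto intro!: holomorphic_intros convex_halfspace_Re_gt)
    moreover have "continuous_on (path_image ?p) ?f" using im by (auto intro!: continuous_intros)
    ultimately have "0 = contour_integral (linepath (Complex c (-T)) (Complex R (-T))) ?f + ?V R
        - contour_integral (linepath (Complex c T) (Complex R T)) ?f - ?V c"
      using assms R by (intro rectpath_contour_integral_eq) auto
    then have "?V c - ?v = contour_integral (linepath (Complex c (-T)) (Complex R (-T))) ?f + ?V R
        - contour_integral (linepath (Complex c T) (Complex R T)) ?f" using False by (simp add: algebra_simps)
    also have "norm \<dots> \<le> (exp (L * R) - exp (L * c)) / (L * \<bar>-T\<bar>) + exp (L * R) / \<bar>R\<bar> * (2 * T)
        + (exp (L * R) - exp (L * c)) / (L * \<bar>T\<bar>)"
      using assms R
      by (intro order_trans[OF norm_triangle_ineq4] add_mono order_trans[OF norm_triangle_ineq]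
          contour_integral_horizontal_exp_over contour_integral_vertical_exp_over) auto
    also have "\<dots> \<le> exp (L * c) / (\<bar>L\<bar> * T) + exp (L * R) / R * (2 * T) + exp (L * c) / (\<bar>L\<bar> * T)"
    proof -
      have "(exp (L * R) - exp (L * c)) / (L * T) = (exp (L * c) - exp (L * R)) / (\<bar>L\<bar> * T)"
        using False assms by (simp add: field_simps)
      also have "\<dots> \<le> exp (L * c) / (\<bar>L\<bar> * T)" using assms by (intro divide_right_mono) auto
      finally show ?thesis using assms R by (intro add_mono) auto
    qed
    finally show ?thesis using False assms by (simp add: mult.commute)
  qed
  have "((\<lambda>R. exp (- \<bar>L\<bar> * R) / R * (2 * T)) \<longlongrightarrow> 0) at_top"
  proof (rule Lim_null_comparison)
    show "\<forall>\<^sub>F R in at_top. norm (exp (- \<bar>L\<bar> * R) / R * (2 * T)) \<le> (2 * T) * (1 / R)"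
      using eventually_gt_at_top[of 0]
      by eventually_elim (use assms in \<open>auto intro!: divide_right_mono simp: abs_mult\<close>)
    show "((\<lambda>R. (2 * T) * (1 / R)) \<longlongrightarrow> 0) at_top"
      by (intro tendsto_mult_right_zero tendsto_divide_0[OF tendsto_const] filterlim_at_top_imp_at_infinity filterlim_ident)
  qed
  then have lim: "((\<lambda>R. 2 * exp (L * c) / (T * \<bar>L\<bar>) + exp (- \<bar>L\<bar> * R) / R * (2 * T)) \<longlongrightarrow> 2 * exp (L * c) / (T * \<bar>L\<bar>) + 0) at_top"
    by (intro tendsto_intros)
  have "norm (?V c - ?v) \<le> 2 * exp (L * c) / (T * \<bar>L\<bar>) + 0"
    by (rule tendsto_lowerbound[OF lim])
       (use eventually_gt_at_top[of c] in eventually_elim, use est in auto)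
  then show ?thesis by simp
qed

section \<open>Bohr's inequality for partial sums\<close>

text \<open>
  Cutting the sum at the half-integer \<open>N + 1/2\<close> keeps the error term of \<open>perron_kernel\<close> under
  control for every integer \<open>n\<close>.
\<close>

lemma ln_half_integer_gap:
  assumes "n > 0" "N > 0"
  shows "1 / (3 * (real N + 1/2)) \<le> \<bar>ln (real N + 1/2) - ln (real n)\<bar>"
proof -
  let ?x = "real N + 1/2"
  show ?thesis
  proof (cases "n \<le> N")
    case True
    have "ln (real n) - ln ?x \<le> (real n - ?x) / ?x" using assms by (intro ln_diff_le) auto
    also have "\<dots> \<le> - (1/2) / ?x" using True by (intro divide_right_mono) auto
    finally have "1 / (2 * ?x) \<le> ln ?x - ln (real n)" by (simp add: field_simps)
    moreover have "1 / (3 * ?x) \<le> 1 / (2 * ?x)" using assms by (intro divide_left_mono) auto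
    ultimately show ?thesis by (meson abs_ge_self order_trans)
  next
    case False
    have "ln ?x - ln (real N + 1) \<le> (?x - (real N + 1)) / (real N + 1)" using assms by (intro ln_diff_le) auto
    also have "\<dots> \<le> - 1 / (3 * ?x)" using assms by (simp add: field_simps)
    finally have "1 / (3 * ?x) \<le> ln (real N + 1) - ln ?x" by simp
    moreover have "ln (real N + 1) \<le> ln (real n)" using False assms by simp
    ultimately show ?thesis by linarith
  qed
qed

lemma integral_inverse_norm_vertical:
  assumes "\<eta> > 0" "T > 0"
  shows "((\<lambda>v. 1 / norm (Complex \<eta> v)) has_integral 2 * arsinh (T / \<eta>)) {-T..T}"
proof -
  have "((\<lambda>v. 1 / norm (Complex \<eta> v)) has_integral (arsinh (T / \<eta>) - arsinh (- T / \<eta>))) {-T..T}"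
  proof (rule fundamental_theorem_of_calculus)
    fix v
    have "sqrt ((v / \<eta>)\<^sup>2 + 1) = norm (Complex \<eta> v) / \<eta>"
    proof -
      have "(v / \<eta>)\<^sup>2 + 1 = (\<eta>\<^sup>2 + v\<^sup>2) / \<eta>\<^sup>2" using assms by (simp add: field_simps)
      then show ?thesis using assms by (simp add: cmod_def real_sqrt_divide)
    qed
    moreover have "norm (Complex \<eta> v) > 0" using assms by (simp add: complex_eq_iff)
    moreover have "((\<lambda>v. arsinh (v / \<eta>)) has_real_derivative (1 / sqrt ((v / \<eta>)\<^sup>2 + 1)) * (1 / \<eta>)) (at v within {-T..T})"
      by (rule DERIV_chain'[OF _ arsinh_real_has_field_derivative]) (intro DERIV_cdivide DERIV_ident)
    ultimately have "((\<lambda>v. arsinh (v / \<eta>)) has_real_derivative 1 / norm (Complex \<eta> v)) (at v within {-T..T})"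
      using assms by simp
    then show "((\<lambda>v. arsinh (v / \<eta>)) has_vector_derivative 1 / norm (Complex \<eta> v)) (at v within {-T..T})"
      by (simp add: has_real_derivative_iff_has_vector_derivative)
  qed (use assms in auto)
  then show ?thesis by (simp add: arsinh_minus_real)
qed

text \<open>
  The integral of \<open>1 / \<bar>w\<bar>\<close> over a segment of height \<open>x\<^sup>3\<close> grows logarithmically in \<open>x\<close>, hence
  more slowly than any power.
\<close>

lemma arsinh_cube_bound:
  fixes x \<eta> :: real
  assumes "\<eta> > 0" "x \<ge> 1"
  shows "arsinh (x ^ 3 / \<eta>) \<le> (3 / \<eta>) * (2 / \<eta> + 1) powr (\<eta> / 3) * x powr \<eta>"
proof -
  let ?z = "x ^ 3 / \<eta>"
  have z: "?z \<ge> 0" using assms by simp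
  have "sqrt (?z\<^sup>2 + 1) \<le> ?z + 1"
    using z by (intro real_le_lsqrt) (auto simp: power2_eq_square algebra_simps)
  then have "?z + sqrt (?z\<^sup>2 + 1) \<le> 2 * ?z + 1" by simp
  also have "\<dots> \<le> (2 / \<eta> + 1) * x ^ 3"
    using assms one_le_power[of x 3] by (simp add: field_simps)
  finally have le: "?z + sqrt (?z\<^sup>2 + 1) \<le> (2 / \<eta> + 1) * x ^ 3" .
  have pos: "?z + sqrt (?z\<^sup>2 + 1) > 0"
    using z by (intro add_nonneg_pos) (auto intro: add_nonneg_pos)
  have "arsinh ?z = ln (?z + sqrt (?z\<^sup>2 + 1))" by (simp add: arsinh_real_def)
  also have "\<dots> \<le> ln ((2 / \<eta> + 1) * x ^ 3)" using le pos by simp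
  also have "\<dots> \<le> ((2 / \<eta> + 1) * x ^ 3) powr (\<eta> / 3) / (\<eta> / 3)"
  proof (rule ln_powr_bound)
    show "1 \<le> (2 / \<eta> + 1) * x ^ 3" using assms by (intro mult_ge1_I) auto
  qed (use assms in auto)
  also have "((2 / \<eta> + 1) * x ^ 3) powr (\<eta> / 3) = (2 / \<eta> + 1) powr (\<eta> / 3) * x powr \<eta>"
  proof -
    have "x ^ 3 = x powr 3" using assms powr_realpow[of x 3] by simp
    then have "(x ^ 3) powr (\<eta> / 3) = x powr \<eta>" by (simp add: powr_powr)
    then show ?thesis using assms by (simp add: powr_mult)
  qed
  finally show ?thesis by (simp add: mult_ac)
qed

text \<open>
  Perron's formula with abscissa \<open>2\<close> and height \<open>T = x\<^sup>3\<close>, applied to the polynomial at \<open>s + w\<close>,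
  yields the partial sum up to an error bounded by a constant times \<open>M\<close> times the sum of the \<open>1 / n\<^sup>2\<close>: the third
  power of \<open>x\<close> compensates \<open>x\<^sup>2\<close> from the kernel and \<open>x\<close> from the gap of the logarithms. Moving
  the segment to the abscissa \<open>\<eta>\<close> replaces \<open>x\<^sup>2\<close> by \<open>x\<^sup>\<eta>\<close> there, and the polynomial is bounded by
  \<open>M\<close> all along the way.
\<close>

lemma bohr_partial_sum_bound_half_integer:
  fixes \<eta> :: real
  assumes "0 < \<eta>" "\<eta> < 2" and N: "0 < N" "N \<le> K"
    and bd: "\<And>s. s \<in> half_plane 0 \<Longrightarrow> norm (dirichlet_psum a K s) \<le> M" and s: "s \<in> half_plane 0"
  defines "x \<equiv> real N + 1/2"
  shows "norm (dirichlet_psum a N s) \<le>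
    (4 + 6 * (\<Sum>n. 1 / real n ^ 2) + 2 * ((3 / \<eta>) * (2 / \<eta> + 1) powr (\<eta> / 3))) * M * x powr (2 * \<eta>)"
proof -
  define T where "T = x ^ 3"
  define L where "L n = ln x - ln (real n)" for n :: nat
  have x: "x \<ge> 1" "x > 0" using N by (auto simp: x_def)
  have T: "T > 0" "T \<ge> 1" using x by (auto simp: T_def)
  have M: "M \<ge> 0" using bd[OF s] norm_ge_zero order_trans by blast
  have sw: "s + w \<in> half_plane 0" if "Re w > 0" for w using s that by (auto simp: half_plane_def)
  let ?\<Phi> = "\<lambda>w. dirichlet_psum a K (s + w) * exp (w * of_real (ln x))"
  let ?F = "\<lambda>w. ?\<Phi> w / w"
  let ?V = "\<lambda>r. contour_integral (linepath (Complex r (-T)) (Complex r T)) ?F"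
  let ?H = "\<lambda>t. contour_integral (linepath (Complex \<eta> t) (Complex 2 t)) ?F"
  have hol: "?F holomorphic_on {w. Re w > 0}"
    by (intro holomorphic_intros holomorphic_on_compose[OF _ holomorphic_dirichlet_psum, unfolded o_def]) auto
  have seg: "closed_segment u v \<subseteq> {w. Re w > 0}" if "Re u > 0" "Re v > 0" for u v
    using that by (intro closed_segment_subset convex_halfspace_Re_gt) auto
  have ci: "?F contour_integrable_on linepath u v" if "Re u > 0" "Re v > 0" for u v
    by (rule contour_integrable_continuous_linepath)
       (rule continuous_on_subset[OF holomorphic_on_imp_continuous_on[OF hol] seg[OF that]])
  have nF: "norm (?F w) \<le> M * exp (Re w * ln x) / norm w" if "Re w > 0" for w
    using bd[OF sw[OF that]] that by (simp add: norm_mult norm_divide divide_right_mono mult_right_mono)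
  \<comment> \<open>the contour is moved from the line of absolute convergence towards the imaginary axis\<close>
  have shift: "?V 2 = ?V \<eta> + ?H T - ?H (-T)"
  proof -
    let ?p = "rectpath (Complex \<eta> (-T)) (Complex 2 T)"
    have im: "path_image ?p \<subseteq> {w. Re w > 0}"
      using path_image_rectpath_subset_cbox[of "Complex \<eta> (-T)" "Complex 2 T"] assms(1,2) T
      by (auto simp: in_cbox_complex_iff)
    have "(?F has_contour_integral 0) ?p"
      using im by (intro Cauchy_theorem_convex_simple[OF hol]) (auto intro!: convex_halfspace_Re_gt)
    moreover have "continuous_on (path_image ?p) ?F"
      by (rule continuous_on_subset[OF holomorphic_on_imp_continuous_on[OF hol] im])
    ultimately have "0 = ?H (-T) + ?V 2 - ?H T - ?V \<eta>"
      using assms(1,2) T by (intro rectpath_contour_integral_eq) auto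
    then show ?thesis by (simp add: algebra_simps)
  qed
  have hor: "norm (?H t) \<le> 2 * M" if "\<bar>t\<bar> = T" for t
  proof -
    have "norm (?H t) \<le> M * x ^ 2 / T * norm (Complex 2 t - Complex \<eta> t)"
    proof (rule contour_integral_bound_linepath[OF ci])
      fix w assume "w \<in> closed_segment (Complex \<eta> t) (Complex 2 t)"
      then have w: "Im w = t" "\<eta> \<le> Re w" "Re w \<le> 2"
        using assms(1,2) by (auto simp: closed_segment_same_Im closed_segment_eq_real_ivl)
      have "norm (?F w) \<le> M * exp (Re w * ln x) / norm w" using w assms(1) by (intro nF) auto
      also have "\<dots> \<le> M * x ^ 2 / T"
      proof (intro frac_le mult_left_mono M)
        have "exp (Re w * ln x) \<le> exp (2 * ln x)" using w x by (simp add: mult_right_mono)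
        then show "exp (Re w * ln x) \<le> x ^ 2" using x by (simp add: exp_double)
        show "T \<le> norm w" using abs_Im_le_cmod[of w] w that by simp
      qed (use M x T in auto)
      finally show "norm (?F w) \<le> M * x ^ 2 / T" .
    qed (use assms(1) M x T in auto)
    also have "Complex 2 t - Complex \<eta> t = of_real (2 - \<eta>)" by (simp add: complex_eq_iff)
    also have "M * x ^ 2 / T * norm (of_real (2 - \<eta>) :: complex) \<le> M * 1 * 2"
    proof (intro mult_mono)
      show "M * x ^ 2 / T \<le> M * 1"
        using M x power_increasing[of 2 3 x] T by (simp add: T_def divide_le_eq mult_left_mono)
    qed (use M assms(1,2) in \<open>auto simp del: of_real_diff\<close>)
    finally show ?thesis by simp
  qed
  have left: "norm (?V \<eta>) \<le> M * x powr \<eta> * (2 * arsinh (T / \<eta>))"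
  proof -
    have "norm (?V \<eta>) = norm (integral {-T..T} (\<lambda>v. ?F (Complex \<eta> v)))"
      using T by (subst contour_integral_linepath_same_Re[of _ \<eta> _ "-T" T]) (auto simp: norm_mult)
    also have "\<dots> \<le> integral {-T..T} (\<lambda>v. M * x powr \<eta> * (1 / norm (Complex \<eta> v)))"
    proof (rule integral_norm_bound_integral)
      show "(\<lambda>v. ?F (Complex \<eta> v)) integrable_on {-T..T}"
      proof (rule integrable_continuous_interval, rule continuous_on_compose2[OF holomorphic_on_imp_continuous_on[OF hol]])
        show "continuous_on {-T..T} (Complex \<eta>)" by (simp add: Complex_eq) (intro continuous_intros)
      qed (use assms(1) in auto)
      show "(\<lambda>v. M * x powr \<eta> * (1 / norm (Complex \<eta> v))) integrable_on {-T..T}"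
        using integral_inverse_norm_vertical[OF assms(1) T(1)] by (intro integrable_on_mult_right) blast
      fix v
      show "norm (?F (Complex \<eta> v)) \<le> M * x powr \<eta> * (1 / norm (Complex \<eta> v))"
        using nF[of "Complex \<eta> v"] assms(1) x by (simp add: powr_def)
    qed
    also have "\<dots> = M * x powr \<eta> * (2 * arsinh (T / \<eta>))"
      using integral_unique[OF has_integral_mult_right[OF integral_inverse_norm_vertical[OF assms(1) T(1)]]] by blast
    finally show ?thesis .
  qed
  \<comment> \<open>on the line of absolute convergence the integral is evaluated term by term\<close>
  define P where "P n = contour_integral (linepath (Complex 2 (-T)) (Complex 2 T)) (\<lambda>w. exp (of_real (L n) * w) / w)" for n
  define J where "J n = (if L n > 0 then 2 * of_real pi * \<i> else 0 :: complex)" for n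
  have L: "L n \<noteq> 0" "1 / (3 * x) \<le> \<bar>L n\<bar>" "L n > 0 \<longleftrightarrow> n \<le> N" if "n > 0" for n
  proof -
    show g: "1 / (3 * x) \<le> \<bar>L n\<bar>" using ln_half_integer_gap[OF that N(1)] by (simp add: x_def L_def)
    then show "L n \<noteq> 0" using x by auto
    show "L n > 0 \<longleftrightarrow> n \<le> N" using that x unfolding L_def by (auto simp: x_def)
  qed
  have V2: "?V 2 = (\<Sum>n=1..K. a n * of_nat n powr (- s) * P n)"
  proof -
    have Feq: "?F w = (\<Sum>n=1..K. a n * of_nat n powr (- s) * (exp (of_real (L n) * w) / w))" for w
    proof -
      have "of_nat n powr (- (s + w)) * exp (w * of_real (ln x)) = of_nat n powr (- s) * exp (of_real (L n) * w)"
        if "n > 0" for n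
        using that by (simp add: of_nat_powr_eq_exp exp_add[symmetric] L_def algebra_simps)
      then show ?thesis
        unfolding dirichlet_psum_def sum_distrib_right sum_divide_distrib
        by (intro sum.cong refl) (simp add: mult.assoc)
    qed
    have ci2: "(\<lambda>w. exp (of_real (L n) * w) / w) contour_integrable_on linepath (Complex 2 (-T)) (Complex 2 T)" for n
      using seg[of "Complex 2 (-T)" "Complex 2 T"]
      by (intro contour_integrable_continuous_linepath continuous_intros) auto
    define c E where "c n = a n * of_nat n powr (- s)" and "E n = (\<lambda>w :: complex. exp (of_real (L n) * w) / w)" for n
    let ?\<gamma> = "linepath (Complex 2 (-T)) (Complex 2 T)"
    have ciE: "E n contour_integrable_on ?\<gamma>" for n unfolding E_def by (rule ci2)
    have "?V 2 = contour_integral ?\<gamma> (\<lambda>w. \<Sum>n=1..K. c n * E n w)"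
      unfolding Feq c_def E_def ..
    also have "\<dots> = (\<Sum>n=1..K. contour_integral ?\<gamma> (\<lambda>w. c n * E n w))"
      by (rule contour_integral_sum) (auto intro!: contour_integrable_lmul ciE)
    also have "\<dots> = (\<Sum>n=1..K. c n * contour_integral ?\<gamma> (E n))"
      by (intro sum.cong refl contour_integral_lmul ciE)
    finally show ?thesis unfolding c_def E_def P_def .
  qed
  have err: "norm (a n * of_nat n powr (- s) * (P n - J n)) \<le> 6 * M * (1 / real n ^ 2)" if n: "n \<in> {1..K}" for n
  proof -
    have n0: "n > 0" using n by auto
    have c: "norm (a n) * real n powr (- Re s) \<le> M"
      by (rule dirichlet_coeff_bound[OF bd n]) (use s in \<open>auto simp: half_plane_def\<close>)
    have "norm (P n - J n) \<le> 2 * exp (L n * 2) / (T * \<bar>L n\<bar>)"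
      unfolding P_def J_def by (rule perron_kernel) (use L[OF n0] T in auto)
    also have "exp (L n * 2) = exp (2 * ln x) / exp (2 * ln (real n))"
      by (simp add: L_def exp_diff[symmetric] algebra_simps)
    also have "\<dots> = x ^ 2 / real n ^ 2"
      using n0 x by (simp add: exp_double)
    also have "2 * (x ^ 2 / real n ^ 2) / (T * \<bar>L n\<bar>) \<le> 2 * (x ^ 2 / real n ^ 2) / (T * (1 / (3 * x)))"
      using L[OF n0] T x by (intro divide_left_mono mult_left_mono mult_pos_pos) auto
    also have "\<dots> = 6 * (1 / real n ^ 2)"
      using x n0 by (simp add: T_def field_simps power2_eq_square power3_eq_cube)
    finally have "norm (P n - J n) \<le> 6 * (1 / real n ^ 2)" .
    then have "(norm (a n) * real n powr (- Re s)) * norm (P n - J n) \<le> M * (6 * (1 / real n ^ 2))"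
      using c M by (intro mult_mono) auto
    then show ?thesis using n0 by (simp add: norm_mult norm_of_nat_powr mult_ac)
  qed
  have main: "(\<Sum>n=1..K. a n * of_nat n powr (- s) * J n) = 2 * of_real pi * \<i> * dirichlet_psum a N s"
  proof -
    have "(\<Sum>n=1..K. a n * of_nat n powr (- s) * J n) = (\<Sum>n=1..N. a n * of_nat n powr (- s) * (2 * of_real pi * \<i>))"
      using N L(3) by (intro sum.mono_neutral_cong_right) (auto simp: J_def)
    then show ?thesis by (simp add: dirichlet_psum_def sum_distrib_left mult_ac)
  qed
  define Z where "Z = (\<Sum>n. 1 / real n ^ 2)"
  have summ: "summable (\<lambda>n. 1 / real n ^ 2)" using inverse_power_summable[of 2, where 'a=real] by (simp add: field_simps)
  have "norm (?V 2 - 2 * of_real pi * \<i> * dirichlet_psum a N s) \<le> 6 * M * Z"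
  proof -
    have "?V 2 - 2 * of_real pi * \<i> * dirichlet_psum a N s = (\<Sum>n=1..K. a n * of_nat n powr (- s) * (P n - J n))"
      unfolding V2 main[symmetric] by (simp add: sum_subtractf algebra_simps)
    also have "norm \<dots> \<le> (\<Sum>n=1..K. 6 * M * (1 / real n ^ 2))" by (rule sum_norm_le) (rule err)
    also have "\<dots> = 6 * M * (\<Sum>n=1..K. 1 / real n ^ 2)" by (rule sum_distrib_left[symmetric])
    also have "\<dots> \<le> 6 * M * Z" unfolding Z_def
      using M by (intro mult_left_mono sum_le_suminf summ) auto
    finally show ?thesis .
  qed
  then have "norm (2 * of_real pi * \<i> * dirichlet_psum a N s) \<le> norm (?V 2) + 6 * M * Z"
    using norm_triangle_ineq2[of "2 * of_real pi * \<i> * dirichlet_psum a N s" "?V 2"] by (simp add: norm_minus_commute)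
  also have "norm (?V 2) \<le> norm (?V \<eta>) + norm (?H T) + norm (?H (-T))"
    unfolding shift by (intro order_trans[OF norm_triangle_ineq4] add_mono norm_triangle_ineq) auto
  also have "\<dots> \<le> M * x powr \<eta> * (2 * ((3 / \<eta>) * (2 / \<eta> + 1) powr (\<eta> / 3) * x powr \<eta>)) + 2 * M + 2 * M"
    using T M arsinh_cube_bound[OF assms(1) x(1)] unfolding T_def[symmetric]
    by (intro add_mono hor order_trans[OF left] mult_left_mono) auto
  finally have "2 * pi * norm (dirichlet_psum a N s) \<le>
     M * x powr \<eta> * (2 * ((3 / \<eta>) * (2 / \<eta> + 1) powr (\<eta> / 3) * x powr \<eta>)) + (4 + 6 * Z) * M"
    by (simp add: norm_mult algebra_simps)
  also have "M * x powr \<eta> * (2 * ((3 / \<eta>) * (2 / \<eta> + 1) powr (\<eta> / 3) * x powr \<eta>)) =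
      2 * ((3 / \<eta>) * (2 / \<eta> + 1) powr (\<eta> / 3)) * M * (x powr \<eta> * x powr \<eta>)" by (simp only: mult_ac)
  also have "x powr \<eta> * x powr \<eta> = x powr (2 * \<eta>)" by (simp add: powr_add[symmetric])
  also have "(4 + 6 * Z) * M \<le> (4 + 6 * Z) * M * x powr (2 * \<eta>)"
  proof -
    have "Z \<ge> 0" unfolding Z_def by (intro suminf_nonneg summ) auto
    then show ?thesis using M x assms(1) mult_left_mono[of 1 "x powr (2 * \<eta>)" "(4 + 6 * Z) * M"]
      by (simp add: ge_one_powr_ge_zero)
  qed
  finally have "2 * pi * norm (dirichlet_psum a N s) \<le>
     (4 + 6 * Z + 2 * ((3 / \<eta>) * (2 / \<eta> + 1) powr (\<eta> / 3))) * M * x powr (2 * \<eta>)"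
    by (simp add: algebra_simps)
  moreover have "1 * norm (dirichlet_psum a N s) \<le> 2 * pi * norm (dirichlet_psum a N s)"
    using pi_gt3 by (intro mult_right_mono) auto
  ultimately show ?thesis unfolding Z_def by linarith
qed

lemma bohr_partial_sum_bound:
  fixes \<eta> :: real
  assumes "\<eta> > 0"
  obtains C where "C \<ge> 0"
    "\<And>a N K M s. \<lbrakk>0 < N; N \<le> K; \<And>w. w \<in> half_plane 0 \<Longrightarrow> norm (dirichlet_psum a K w) \<le> M; s \<in> half_plane 0\<rbrakk>
        \<Longrightarrow> norm (dirichlet_psum a N s) \<le> C * M * real N powr \<eta>"
proof -
  \<comment> \<open>the estimate at half-integers loses \<open>2 * \<delta>\<close> and needs \<open>\<delta>\<close> left of the abscissa \<open>2\<close>\<close>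
  define \<delta> where "\<delta> = min (\<eta> / 2) 1"
  have \<delta>: "0 < \<delta>" "\<delta> < 2" "2 * \<delta> \<le> \<eta>" using assms by (auto simp: \<delta>_def)
  define D where "D = 4 + 6 * (\<Sum>n. 1 / real n ^ 2) + 2 * ((3 / \<delta>) * (2 / \<delta> + 1) powr (\<delta> / 3))"
  have summ: "summable (\<lambda>n. 1 / real n ^ 2)" using inverse_power_summable[of 2, where 'a=real] by (simp add: field_simps)
  have "D \<ge> 0" unfolding D_def using \<delta>(1)
    by (intro add_nonneg_nonneg mult_nonneg_nonneg suminf_nonneg summ) auto
  show ?thesis
  proof (rule that[of "D * 2 powr \<eta>"])
    fix a N K M s
    assume N: "0 < N" "N \<le> K" and bd: "\<And>w. w \<in> half_plane 0 \<Longrightarrow> norm (dirichlet_psum a K w) \<le> M"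
      and s: "s \<in> half_plane 0"
    have M: "M \<ge> 0" using bd[OF s] norm_ge_zero order_trans by blast
    have "norm (dirichlet_psum a N s) \<le> D * M * (real N + 1/2) powr (2 * \<delta>)"
      unfolding D_def by (rule bohr_partial_sum_bound_half_integer[OF \<delta>(1,2) N bd s])
    also have "\<dots> \<le> D * M * (2 powr \<eta> * real N powr \<eta>)"
    proof (rule mult_left_mono)
      have "(real N + 1/2) powr (2 * \<delta>) \<le> (real N + 1/2) powr \<eta>"
        using N \<delta> by (intro powr_mono) auto
      also have "\<dots> \<le> (2 * real N) powr \<eta>"
        using N assms by (intro powr_mono2) auto
      also have "\<dots> = 2 powr \<eta> * real N powr \<eta>" by (simp add: powr_mult)
      finally show "(real N + 1/2) powr (2 * \<delta>) \<le> 2 powr \<eta> * real N powr \<eta>" .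
    qed (use \<open>D \<ge> 0\<close> M in auto)
    finally show "norm (dirichlet_psum a N s) \<le> (D * 2 powr \<eta>) * M * real N powr \<eta>" by (simp add: mult_ac)
  qed (use \<open>D \<ge> 0\<close> in auto)
qed

lemma dirichlet_psum_Suc: "dirichlet_psum a (Suc N) s = dirichlet_psum a N s + a (Suc N) * of_nat (Suc N) powr (- s)"
  by (simp add: dirichlet_psum_def)

text \<open>
  Of the shift by \<open>2 \<eta>\<close>, one half cancels the growth of the partial sums and the other half makes
  the summed series decay.
\<close>

lemma abel_summation_bound:
  fixes \<eta> B :: real
  assumes \<eta>: "\<eta> > 0" and B: "B \<ge> 0"
    and bd: "\<And>n. n > 0 \<Longrightarrow> norm (dirichlet_psum a n s) \<le> B * real n powr \<eta>"
    and mN: "m \<le> N"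
  shows "norm (dirichlet_psum a N (s + of_real (2 * \<eta>)) - dirichlet_psum a m (s + of_real (2 * \<eta>)))
           \<le> 4 * B * real (Suc m) powr (- \<eta>)"
proof -
  define S where "S n = dirichlet_psum a n s" for n
  define u where "u n = real n powr (- (2 * \<eta>))" for n
  define v where "v n = real n powr (- \<eta>)" for n
  have S0: "S 0 = 0" by (simp add: S_def dirichlet_psum_def)
  have uv: "u n = v n * v n" for n by (simp add: u_def v_def powr_add[symmetric])
  have v: "v (Suc n) \<le> v n" if "n > 0" for n using that \<eta> unfolding v_def by (intro powr_mono2') auto
  have v0: "v n \<ge> 0" for n by (simp add: v_def)
  have vB: "norm (S n) * v n \<le> B" if "n > 0" for n
  proof -
    have "norm (S n) * v n \<le> (B * real n powr \<eta>) * v n"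
      using bd[OF that] v0 by (intro mult_right_mono) (auto simp: S_def)
    also have "\<dots> = B" using that by (simp add: v_def powr_minus)
    finally show ?thesis .
  qed
  have vB': "norm (S n) * v (Suc n) \<le> B" for n
  proof (cases "n = 0")
    case True
    then show ?thesis using S0 B by simp
  next
    case False
    then have "norm (S n) * v (Suc n) \<le> norm (S n) * v n" by (intro mult_left_mono v) auto
    then show ?thesis using vB[of n] False by simp
  qed
  have shifted: "a n * of_nat n powr (- (s + of_real (2 * \<eta>))) = a n * of_nat n powr (- s) * of_real (u n)" if "n > 0" for n
    using that by (simp add: of_nat_powr_eq_exp u_def powr_def exp_add[symmetric] exp_of_real[symmetric] algebra_simps)
  have abel: "dirichlet_psum a N (s + of_real (2 * \<eta>)) - dirichlet_psum a m (s + of_real (2 * \<eta>)) =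
      S N * of_real (u (Suc N)) - S m * of_real (u (Suc m)) + (\<Sum>n=Suc m..N. S n * of_real (u n - u (Suc n)))"
    using mN
  proof (induction N rule: dec_induct)
    case base
    show ?case by simp
  next
    case (step n)
    have "a (Suc n) * of_nat (Suc n) powr (- s) = S (Suc n) - S n"
      unfolding S_def dirichlet_psum_Suc by simp
    then have "dirichlet_psum a (Suc n) (s + of_real (2 * \<eta>)) - dirichlet_psum a m (s + of_real (2 * \<eta>)) =
        (dirichlet_psum a n (s + of_real (2 * \<eta>)) - dirichlet_psum a m (s + of_real (2 * \<eta>))) +
          (S (Suc n) - S n) * of_real (u (Suc n))"
      by (simp only: dirichlet_psum_Suc shifted[OF zero_less_Suc]) (simp only: algebra_simps)
    then show ?case unfolding step.IH using step.hyps by (simp add: algebra_simps)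
  qed
  have tel: "(\<Sum>n=Suc m..N. v n - v (Suc n)) = v (Suc m) - v (Suc N)"
    using mN sum_Suc_diff[of "Suc m" N "\<lambda>n. - v n"] by simp
  have sumb: "norm (\<Sum>n=Suc m..N. S n * of_real (u n - u (Suc n))) \<le> (\<Sum>n=Suc m..N. 2 * B * (v n - v (Suc n)))"
  proof (rule sum_norm_le)
    fix n assume "n \<in> {Suc m..N}"
    then have n: "n > 0" by auto
    \<comment> \<open>\<open>u\<close> is the square of \<open>v\<close>, and one factor \<open>v n\<close> pays for the growth of the partial sum\<close>
    have "u n - u (Suc n) = (v n - v (Suc n)) * (v n + v (Suc n))" by (simp add: uv algebra_simps)
    moreover have "\<bar>(v n - v (Suc n)) * (v n + v (Suc n))\<bar> = (v n - v (Suc n)) * (v n + v (Suc n))"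
      using v[OF n] v0[of n] v0[of "Suc n"] by (intro abs_of_nonneg mult_nonneg_nonneg) auto
    ultimately have "norm (S n * of_real (u n - u (Suc n))) = norm (S n) * ((v n - v (Suc n)) * (v n + v (Suc n)))"
      by (simp only: norm_mult norm_of_real)
    also have "\<dots> = (v n - v (Suc n)) * (norm (S n) * v n + norm (S n) * v (Suc n))"
      by (simp add: algebra_simps)
    also have "\<dots> \<le> (v n - v (Suc n)) * (B + B)"
      using v[OF n] vB[OF n] vB'[of n] by (intro mult_left_mono add_mono) auto
    finally show "norm (S n * of_real (u n - u (Suc n))) \<le> 2 * B * (v n - v (Suc n))" by (simp add: mult_ac)
  qed
  have ends: "norm (S n * of_real (u (Suc n))) \<le> B * v (Suc n)" for n
    using vB'[of n] v0[of "Suc n"] mult_right_mono[of "norm (S n) * v (Suc n)" B "v (Suc n)"]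
    by (simp add: norm_mult uv mult.assoc)
  have "norm (dirichlet_psum a N (s + of_real (2 * \<eta>)) - dirichlet_psum a m (s + of_real (2 * \<eta>)))
     \<le> B * v (Suc N) + B * v (Suc m) + 2 * B * (v (Suc m) - v (Suc N))"
    unfolding abel
    using sumb unfolding sum_distrib_left[symmetric] tel
    by (intro order_trans[OF norm_triangle_ineq] add_mono order_trans[OF norm_triangle_ineq4] ends)
  also have "\<dots> \<le> 4 * B * v (Suc m)"
    using mult_nonneg_nonneg[OF B v0[of "Suc N"]] mult_nonneg_nonneg[OF B v0[of "Suc m"]] by (simp add: algebra_simps)
  finally show ?thesis by (simp add: v_def)
qed

lemma uniformly_convergent_on_partial_sums_bounded:
  fixes \<eta> B :: real
  assumes \<eta>: "\<eta> > 0"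
    and bd: "\<And>n s. s \<in> half_plane \<theta> \<Longrightarrow> norm (dirichlet_psum a n s) \<le> B"
  shows "uniformly_convergent_on (half_plane (\<theta> + \<eta>)) (dirichlet_psum a)"
proof -
  have "of_real (\<theta> + 1) \<in> half_plane \<theta>" by (simp add: half_plane_def)
  from bd[OF this, of 0] have B: "B \<ge> 0" by (simp add: dirichlet_psum_def)
  have est: "norm (dirichlet_psum a N s - dirichlet_psum a m s) \<le> 4 * B * real (Suc m) powr (- (\<eta> / 2))"
    if "s \<in> half_plane (\<theta> + \<eta>)" "m \<le> N" for s m N
  proof -
    have s: "s - of_real \<eta> \<in> half_plane \<theta>" using that by (simp add: half_plane_def)
    have "norm (dirichlet_psum a n (s - of_real \<eta>)) \<le> B * real n powr (\<eta> / 2)" if "n > 0" for n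
    proof -
      have "B * 1 \<le> B * real n powr (\<eta> / 2)"
        using that \<eta> B by (intro mult_left_mono ge_one_powr_ge_zero) auto
      then show ?thesis using bd[OF s, of n] by simp
    qed
    from abel_summation_bound[OF _ B this that(2)] \<eta> show ?thesis by simp
  qed
  have "(\<lambda>m. 4 * B * real (Suc m) powr (- (\<eta> / 2))) \<longlonglongrightarrow> 4 * B * 0"
    using \<eta> by (intro tendsto_mult tendsto_const tendsto_neg_powr filterlim_compose[OF filterlim_real_sequentially filterlim_Suc]) auto
  then have lim: "(\<lambda>m. 4 * B * real (Suc m) powr (- (\<eta> / 2))) \<longlonglongrightarrow> 0" by simp
  have "uniformly_Cauchy_on (half_plane (\<theta> + \<eta>)) (dirichlet_psum a)"
  proof (rule uniformly_Cauchy_onI')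
    fix e :: real assume "e > 0"
    then obtain M where M: "\<And>m. m \<ge> M \<Longrightarrow> 4 * B * real (Suc m) powr (- (\<eta> / 2)) < e"
      using order_tendstoD(2)[OF lim] by (auto simp: eventually_sequentially)
    have "dist (dirichlet_psum a m s) (dirichlet_psum a n s) < e"
      if "s \<in> half_plane (\<theta> + \<eta>)" "m \<ge> M" "n > m" for s m n
      using est[OF that(1), of m n] M[OF that(2)] that(3) by (simp add: dist_norm norm_minus_commute)
    then show "\<exists>M. \<forall>x\<in>half_plane (\<theta> + \<eta>). \<forall>m\<ge>M. \<forall>n>m. dist (dirichlet_psum a m x) (dirichlet_psum a n x) < e"
      by blast
  qed
  then show ?thesis by (rule Cauchy_uniformly_convergent)
qed

text \<open>
  Partial summation removes the factor \<open>N powr \<eta>\<close> from \<open>bohr_partial_sum_bound\<close>, and a translation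
  by \<open>\<theta>\<close> moves the estimate from \<open>half_plane 0\<close> to \<open>half_plane \<theta>\<close>. The constant depends on
  \<open>\<epsilon>\<close> alone.
\<close>

lemma bohr_inequality:
  fixes \<epsilon> :: real
  assumes "\<epsilon> > 0"
  obtains C where "C \<ge> 0"
    "\<And>a N K M \<theta> s. \<lbrakk>N \<le> K; \<And>w. w \<in> half_plane \<theta> \<Longrightarrow> norm (dirichlet_psum a K w) \<le> M; s \<in> half_plane (\<theta> + \<epsilon>)\<rbrakk>
        \<Longrightarrow> norm (dirichlet_psum a N s) \<le> C * M"
proof -
  obtain C where C: "C \<ge> 0" and
    bohr: "\<And>a N K M s. \<lbrakk>0 < N; N \<le> K; \<And>w. w \<in> half_plane 0 \<Longrightarrow> norm (dirichlet_psum a K w) \<le> M; s \<in> half_plane 0\<rbrakk>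
        \<Longrightarrow> norm (dirichlet_psum a N s) \<le> C * M * real N powr (\<epsilon> / 2)"
    using bohr_partial_sum_bound[of "\<epsilon> / 2"] assms by (metis half_gt_zero)
  show ?thesis
  proof (rule that[of "4 * C"])
    fix a N K M \<theta> s
    assume NK: "N \<le> K" and bd: "\<And>w. w \<in> half_plane \<theta> \<Longrightarrow> norm (dirichlet_psum a K w) \<le> M"
      and s: "s \<in> half_plane (\<theta> + \<epsilon>)"
    have s': "s - of_real \<epsilon> - of_real \<theta> \<in> half_plane 0" "s \<in> half_plane \<theta>"
      using s assms by (auto simp: half_plane_def)
    have M: "M \<ge> 0" using bd[OF s'(2)] norm_ge_zero order_trans by blast
    \<comment> \<open>truncating at \<open>N\<close> makes every partial sum of \<open>b\<close> one of length at most \<open>N \<le> K\<close>\<close>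
    define b where "b n = (if n \<le> N then a n * of_nat n powr (- of_real \<theta>) else 0)" for n
    have bN: "dirichlet_psum b (min n N) w = dirichlet_psum a (min n N) (w + of_real \<theta>)" for n w
    proof -
      have "dirichlet_psum b (min n N) w = dirichlet_psum (\<lambda>n. a n * of_nat n powr (- of_real \<theta>)) (min n N) w"
        by (rule dirichlet_psum_cong) (auto simp: b_def)
      then show ?thesis by (simp add: dirichlet_psum_shift)
    qed
    have bmin: "dirichlet_psum b n w = dirichlet_psum b (min n N) w" for n w
    proof (cases "n \<le> N")
      case False
      then have "dirichlet_psum b N w = dirichlet_psum (\<lambda>k. if k \<le> N then b k else 0) n w"
        by (intro dirichlet_psum_extend) auto
      also have "(\<lambda>k. if k \<le> N then b k else 0) = b" by (auto simp: b_def)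
      finally show ?thesis using False by simp
    qed simp
    have "norm (dirichlet_psum b n (s - of_real \<epsilon> - of_real \<theta>)) \<le> (C * M) * real n powr (\<epsilon> / 2)" if n: "n > 0" for n
    proof (cases "min n N = 0")
      case True
      then show ?thesis using C M by (subst bmin) (simp add: dirichlet_psum_def)
    next
      case False
      have "norm (dirichlet_psum (\<lambda>n. a n * of_nat n powr (- of_real \<theta>)) (min n N) (s - of_real \<epsilon> - of_real \<theta>))
           \<le> C * M * real (min n N) powr (\<epsilon> / 2)"
      proof (rule bohr[OF _ _ _ s'(1)])
        show "norm (dirichlet_psum (\<lambda>n. a n * of_nat n powr (- of_real \<theta>)) K w) \<le> M" if "w \<in> half_plane 0" for w
          unfolding dirichlet_psum_shift by (rule bd) (use that in \<open>simp add: half_plane_def\<close>)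
      qed (use False NK in auto)
      also have "\<dots> \<le> C * M * real n powr (\<epsilon> / 2)"
        using C M assms by (intro mult_left_mono powr_mono2) auto
      finally show ?thesis by (subst bmin) (simp only: bN dirichlet_psum_shift)
    qed
    from abel_summation_bound[OF _ _ this, of 0 N] C M assms
    have "norm (dirichlet_psum b N (s - of_real \<epsilon> - of_real \<theta> + of_real \<epsilon>)) \<le> 4 * (C * M)"
      by (simp add: dirichlet_psum_def)
    moreover have "dirichlet_psum b N (s - of_real \<epsilon> - of_real \<theta> + of_real \<epsilon>) = dirichlet_psum a N s"
      using bN[of N "s - of_real \<epsilon> - of_real \<theta> + of_real \<epsilon>"] by simp
    ultimately show "norm (dirichlet_psum a N s) \<le> 4 * C * M" by simp
  qed (use C in auto)
qed

section \<open>Bohr's theorem and uniqueness of coefficients\<close>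

text \<open>
  The coefficients of approximating polynomials converge, which defines \<open>c\<close>. By Bohr's inequality the
  partial sums of the approximants converge uniformly to those of \<open>c\<close>, and uniformly in the length
  of the partial sums, so the limits may be interchanged.
\<close>

lemma dirichlet_limit_imp_dirichlet_series:
  assumes h: "dirichlet_limit S \<theta> h h'" and "\<epsilon> > 0"
  obtains c where "uniform_limit (half_plane (\<theta> + \<epsilon>)) (dirichlet_psum c) h sequentially"
proof -
  obtain C where C: "C \<ge> 0" and
    bohr: "\<And>a N K M \<theta> s. \<lbrakk>N \<le> K; \<And>w. w \<in> half_plane \<theta> \<Longrightarrow> norm (dirichlet_psum a K w) \<le> M; s \<in> half_plane (\<theta> + \<epsilon>)\<rbrakk>
        \<Longrightarrow> norm (dirichlet_psum a N s) \<le> C * M"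
    using bohr_inequality[OF assms(2)] by metis
  let ?e = "\<lambda>k::nat. 1 / real (Suc k)"
  have "\<forall>k. \<exists>a N. \<forall>s\<in>half_plane \<theta>. norm (h s - dirichlet_psum a N s) \<le> ?e k"
    using h unfolding dirichlet_limit_def by (metis of_nat_0_less_iff zero_less_Suc zero_less_divide_1_iff)
  then obtain a N where aN: "\<And>k s. s \<in> half_plane \<theta> \<Longrightarrow> norm (h s - dirichlet_psum (a k) (N k) s) \<le> ?e k"
    by metis
  define q where "q k n = (if n \<le> N k then a k n else 0)" for k n
  have qpsum: "dirichlet_psum (q k) K s = dirichlet_psum (a k) (N k) s" if "N k \<le> K" for k K s
    unfolding q_def[abs_def] by (rule dirichlet_psum_extend[OF that, symmetric])
  have hq: "norm (h s - dirichlet_psum (q k) K s) \<le> ?e k" if "s \<in> half_plane \<theta>" "N k \<le> K" for s k K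
    using aN[OF that(1), of k] qpsum[OF that(2)] by simp
  have qq: "norm (dirichlet_psum (\<lambda>n. q j n - q k n) K s) \<le> ?e j + ?e k"
    if "s \<in> half_plane \<theta>" "N j \<le> K" "N k \<le> K" for s j k K
    using norm_triangle_ineq4[of "h s - dirichlet_psum (q k) K s" "h s - dirichlet_psum (q j) K s"]
      hq[OF that(1,2)] hq[OF that(1,3)] by (simp add: dirichlet_psum_diff)
  have qcoeff: "norm (q j n - q k n) * real n powr (- (\<theta> + 1)) \<le> ?e j + ?e k" if "n > 0" for j k n
  proof -
    have "norm (q j n - q k n) * real n powr (- Re (of_real (\<theta> + 1))) \<le> ?e j + ?e k"
    proof (rule dirichlet_coeff_bound[where N = "max n (max (N j) (N k))" and a = "\<lambda>n. q j n - q k n"])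
      show "norm (dirichlet_psum (\<lambda>n. q j n - q k n) (max n (max (N j) (N k)))
          (of_real (\<theta> + 1) + \<i> * of_real t)) \<le> ?e j + ?e k" for t
        by (rule qq) (auto simp: half_plane_def)
    qed (use that in auto)
    then show ?thesis by simp
  qed
  have "\<exists>c. (\<lambda>k. q k n) \<longlonglongrightarrow> c" if n: "n > 0" for n
  proof -
    have pos: "real n powr (\<theta> + 1) > 0" using n by simp
    have "Cauchy (\<lambda>k. q k n)"
    proof (rule metric_CauchyI)
      fix e :: real assume "e > 0"
      define D where "D = e / real n powr (\<theta> + 1)"
      have "D / 2 > 0" using pos \<open>e > 0\<close> by (simp add: D_def)
      then obtain m where m: "?e m < D / 2" by (rule nat_approx_posE)
      have "dist (q j n) (q k n) < e" if "j \<ge> m" "k \<ge> m" for j k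
      proof -
        have "?e j \<le> ?e m" "?e k \<le> ?e m" using that by (auto simp: frac_le)
        then have "norm (q j n - q k n) * real n powr (- (\<theta> + 1)) < D"
          using qcoeff[OF n, of j k] m by linarith
        then have "norm (q j n - q k n) / real n powr (\<theta> + 1) < e / real n powr (\<theta> + 1)"
          by (simp only: powr_minus D_def divide_inverse)
        then show ?thesis using pos by (simp only: dist_norm divide_less_cancel)
      qed
      then show "\<exists>M. \<forall>i\<ge>M. \<forall>j\<ge>M. dist (q i n) (q j n) < e" by blast
    qed
    then show ?thesis using Cauchy_convergent_iff convergent_def by blast
  qed
  then obtain c where c: "\<And>n. n > 0 \<Longrightarrow> (\<lambda>k. q k n) \<longlonglongrightarrow> c n" by metis
  have est: "norm (h s - dirichlet_psum c K s) \<le> (C + 1) * ?e k" if s: "s \<in> half_plane (\<theta> + \<epsilon>)" and K: "N k \<le> K" for s k K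
  proof -
    have s': "s \<in> half_plane \<theta>" using s assms(2) by (simp add: half_plane_def)
    have lim1: "(\<lambda>j. dirichlet_psum (\<lambda>n. q j n - q k n) K s) \<longlonglongrightarrow> dirichlet_psum (\<lambda>n. c n - q k n) K s"
      unfolding dirichlet_psum_def by (intro tendsto_intros c) auto
    have lim2: "(\<lambda>j. C * (?e j + ?e k)) \<longlonglongrightarrow> C * (0 + ?e k)"
      by (intro tendsto_intros LIMSEQ_inverse_real_of_nat[unfolded inverse_eq_divide])
    have "norm (dirichlet_psum (\<lambda>n. c n - q k n) K s) \<le> C * (0 + ?e k)"
    proof (rule tendsto_le[OF _ lim2 tendsto_norm[OF lim1]])
      have "norm (dirichlet_psum (\<lambda>n. q j n - q k n) K s) \<le> C * (?e j + ?e k)" for j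
      proof (rule bohr[where K = "max K (N j)" and \<theta> = \<theta>])
        show "norm (dirichlet_psum (\<lambda>n. q j n - q k n) (max K (N j)) w) \<le> ?e j + ?e k"
          if "w \<in> half_plane \<theta>" for w by (rule qq[OF that]) (use K in auto)
      qed (use s in auto)
      then show "\<forall>\<^sub>F j in sequentially. norm (dirichlet_psum (\<lambda>n. q j n - q k n) K s) \<le> C * (?e j + ?e k)" by simp
    qed simp
    moreover have "norm (h s - dirichlet_psum c K s) \<le>
        norm (h s - dirichlet_psum (q k) K s) + norm (dirichlet_psum (\<lambda>n. c n - q k n) K s)"
    proof -
      have eq: "h s - dirichlet_psum c K s = (h s - dirichlet_psum (q k) K s) - dirichlet_psum (\<lambda>n. c n - q k n) K s"
        by (simp add: dirichlet_psum_diff)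
      show ?thesis unfolding eq by (rule norm_triangle_ineq4)
    qed
    ultimately have "norm (h s - dirichlet_psum c K s) \<le> ?e k + C * ?e k"
      using hq[OF s' K] unfolding add_0 by linarith
    then show ?thesis by (simp only: distrib_right mult_1 add.commute)
  qed
  have "uniform_limit (half_plane (\<theta> + \<epsilon>)) (dirichlet_psum c) h sequentially"
  proof (rule uniform_limitI)
    fix e :: real assume "e > 0"
    then obtain k where "?e k < e / (C + 1)" using nat_approx_posE[of "e / (C + 1)"] C by auto
    then have k: "(C + 1) * ?e k < e" using C by (simp add: field_simps)
    have "dist (dirichlet_psum c K s) (h s) < e" if "K \<ge> N k" "s \<in> half_plane (\<theta> + \<epsilon>)" for K s
      using est[OF that(2,1)] k by (simp add: dist_norm norm_minus_commute)
    then show "\<forall>\<^sub>F n in sequentially. \<forall>x\<in>half_plane (\<theta> + \<epsilon>). dist (dirichlet_psum c n x) (h x) < e"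
      unfolding eventually_sequentially by blast
  qed
  then show ?thesis by (rule that)
qed

lemma has_mean_dirichlet:
  assumes conv: "uniformly_convergent_on (half_plane \<theta>) (dirichlet_psum a)" and s: "s \<in> half_plane \<theta>" and k: "k > 0"
  shows "has_mean (\<lambda>t. dirichlet a (s + \<i> * of_real t) * of_nat k powr (\<i> * of_real t)) (a k * of_nat k powr (- s))"
proof (rule has_mean_uniform_approx)
  have st: "s + \<i> * of_real t \<in> half_plane \<theta>" for t using s by (simp add: half_plane_def)
  have "continuous_on UNIV (\<lambda>t. dirichlet a (s + \<i> * of_real t))"
    by (rule continuous_on_compose2[OF holomorphic_on_imp_continuous_on[OF holomorphic_dirichlet[OF conv]]])
       (auto intro!: continuous_intros st)
  then show "continuous_on UNIV (\<lambda>t. dirichlet a (s + \<i> * of_real t) * of_nat k powr (\<i> * of_real t))"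
    using k by (intro continuous_intros) auto
  fix e :: real assume "e > 0"
  then have "\<forall>\<^sub>F N in sequentially. \<forall>s\<in>half_plane \<theta>. dist (dirichlet_psum a N s) (dirichlet a s) < e"
    using uniform_limitD[OF uniform_limit_dirichlet[OF conv]] by blast
  then obtain N0 where "\<And>N s. N \<ge> N0 \<Longrightarrow> s\<in>half_plane \<theta> \<Longrightarrow> dist (dirichlet_psum a N s) (dirichlet a s) < e"
    unfolding eventually_sequentially by blast
  then obtain N where N: "N \<ge> k" "\<And>s. s\<in>half_plane \<theta> \<Longrightarrow> dist (dirichlet_psum a N s) (dirichlet a s) < e"
    using max.cobounded1 max.cobounded2 by blast
  have "norm (dirichlet a (s + \<i> * of_real t) * of_nat k powr (\<i> * of_real t) -
      dirichlet_psum a N (s + \<i> * of_real t) * of_nat k powr (\<i> * of_real t)) \<le> e" for t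
    using N(2)[OF st[of t]] k
    by (simp add: left_diff_distrib[symmetric] norm_mult norm_of_nat_powr dist_norm norm_minus_commute)
  then show "\<exists>h. has_mean h (a k * of_nat k powr (- s)) \<and> continuous_on UNIV h \<and>
      (\<forall>t. norm (dirichlet a (s + \<i> * of_real t) * of_nat k powr (\<i> * of_real t) - h t) \<le> e)"
    using has_mean_dirichlet_coeff[OF k, of a N s] N(1) k
    by (intro exI[of _ "\<lambda>t. dirichlet_psum a N (s + \<i> * of_real t) * of_nat k powr (\<i> * of_real t)"])
       (auto intro!: continuous_intros)
qed

lemma dirichlet_coeff_unique:
  assumes "uniformly_convergent_on (half_plane \<theta>) (dirichlet_psum a)" "uniformly_convergent_on (half_plane \<theta>) (dirichlet_psum b)"
    and "\<And>s. s \<in> half_plane \<theta> \<Longrightarrow> dirichlet a s = dirichlet b s" and "k > 0"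
  shows "a k = b k"
proof -
  define s where "s = complex_of_real (\<theta> + 1)"
  have s: "s \<in> half_plane \<theta>" "s + \<i> * of_real t \<in> half_plane \<theta>" for t by (auto simp: s_def half_plane_def)
  have "a k * of_nat k powr (- s) = b k * of_nat k powr (- s)"
    using has_mean_unique[OF has_mean_dirichlet[OF assms(1) s(1) assms(4)]] has_mean_dirichlet[OF assms(2) s(1) assms(4)]
      assms(3)[OF s(2)] by simp
  then show ?thesis using assms(4) by simp
qed

text \<open>
  The coefficients found on the different half-planes coincide, because they are mean values of \<open>h\<close>.
\<close>

lemma dirichlet_series_of_limits:
  assumes "\<And>\<theta>. \<theta> > 0 \<Longrightarrow> dirichlet_limit S \<theta> h h"
  obtains c where "abscissa_uniform c \<le> 0" "\<And>s. s \<in> half_plane 0 \<Longrightarrow> dirichlet c s = h s"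
proof -
  have ex: "\<exists>c. uniform_limit (half_plane \<theta>) (dirichlet_psum c) h sequentially" if "\<theta> > 0" for \<theta>
    using dirichlet_limit_imp_dirichlet_series[OF assms[of "\<theta> / 2"], of "\<theta> / 2"] that by auto
  have eq: "dirichlet c s = h s" if "uniform_limit (half_plane \<theta>) (dirichlet_psum c) h sequentially" "s \<in> half_plane \<theta>" for c \<theta> s
  proof -
    have "uniform_limit (half_plane \<theta>) (dirichlet_psum c) (dirichlet c) sequentially"
      using that(1) by (intro uniform_limit_dirichlet uniformly_convergentI)
    then show ?thesis
      using that tendsto_uniform_limitI by (metis LIMSEQ_unique)
  qed
  obtain c where c: "uniform_limit (half_plane 1) (dirichlet_psum c) h sequentially" using ex[of 1] by auto
  have all: "uniform_limit (half_plane \<theta>) (dirichlet_psum c) h sequentially" if \<theta>: "\<theta> > 0" for \<theta>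
  proof -
    obtain d where d: "uniform_limit (half_plane \<theta>) (dirichlet_psum d) h sequentially" using ex[OF \<theta>] by blast
    define \<theta>' where "\<theta>' = max 1 \<theta>"
    have sub: "half_plane \<theta>' \<subseteq> half_plane 1" "half_plane \<theta>' \<subseteq> half_plane \<theta>"
      by (auto simp: \<theta>'_def half_plane_def)
    have "c k = d k" if "k > 0" for k
    proof (rule dirichlet_coeff_unique[OF _ _ _ that])
      show "uniformly_convergent_on (half_plane \<theta>') (dirichlet_psum c)"
        using uniform_limit_on_subset[OF c sub(1)] by (rule uniformly_convergentI)
      show "uniformly_convergent_on (half_plane \<theta>') (dirichlet_psum d)"
        using uniform_limit_on_subset[OF d sub(2)] by (rule uniformly_convergentI)
      show "dirichlet c s = dirichlet d s" if "s \<in> half_plane \<theta>'" for s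
      proof -
        have "s \<in> half_plane 1" "s \<in> half_plane \<theta>" using that sub by blast+
        then show ?thesis using eq[OF c] eq[OF d] by simp
      qed
    qed
    then have "dirichlet_psum c = dirichlet_psum d"
      by (intro ext dirichlet_psum_cong) auto
    then show ?thesis using d by simp
  qed
  show ?thesis
  proof (rule that[of c])
    show "abscissa_uniform c \<le> 0"
      unfolding abscissa_uniform_le_0_iff using all uniformly_convergentI by blast
    fix s assume "s \<in> half_plane 0"
    then obtain \<theta> where "\<theta> > 0" "s \<in> half_plane \<theta>" using dense[of 0 "Re s"] by (auto simp: half_plane_def)
    then show "dirichlet c s = h s" using eq[OF all] by blast
  qed
qed

section \<open>The Borel-Caratheodory inequality\<close>

text \<open>
  With \<open>c = 3 + \<i> Im s\<close> and \<open>\<phi>\<close> the function \<open>g - g c\<close> on the disc about \<open>c\<close> that touches the line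
  \<open>Re = \<epsilon>\<close>, rescaled to the unit disc, \<open>Re \<phi> < D\<close> says that \<open>\<phi> / (2 D - \<phi>)\<close> maps the unit disc
  into itself, and the Schwarz lemma applies. For \<open>Re s \<le> 2\<close> the point \<open>s\<close> has distance at least \<open>\<epsilon>\<close> to the
  boundary of the disc.
\<close>

lemma borel_caratheodory_half_plane:
  assumes hol: "g holomorphic_on half_plane 0" and \<epsilon>: "0 < \<epsilon>" "\<epsilon> < 1"
    and re: "\<And>s. s \<in> half_plane \<epsilon> \<Longrightarrow> Re (g s) \<le> A"
    and far: "\<And>s. s \<in> half_plane 2 \<Longrightarrow> norm (g s) \<le> B"
    and A: "A \<ge> 0" and s: "s \<in> half_plane (2 * \<epsilon>)"
  shows "norm (g s) \<le> B + 6 * (A + B + 1) / \<epsilon>"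
proof -
  have "norm (g 3) \<le> B" by (rule far) (simp add: half_plane_def)
  then have B: "B \<ge> 0" using norm_ge_zero order_trans by blast
  \<comment> \<open>the summand \<open>1\<close> makes the inequality \<open>Re \<phi> < D\<close> strict\<close>
  define D where "D = A + B + 1"
  have D: "D > 0" using A B by (simp add: D_def)
  show ?thesis
  proof (cases "Re s > 2")
    case True
    then have "norm (g s) \<le> B" by (intro far) (simp add: half_plane_def)
    moreover have "6 * (A + B + 1) / \<epsilon> \<ge> 0" using A B \<epsilon> by simp
    ultimately show ?thesis by linarith
  next
    case False
    define c where "c = Complex 3 (Im s)"
    define R where "R = 3 - \<epsilon>"
    define \<xi> where "\<xi> = (s - c) / of_real R"
    define \<phi> where "\<phi> z = g (c + of_real R * z) - g c" for z
    define F where "F z = \<phi> z / (of_real (2 * D) - \<phi> z)" for z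
    have R: "R > 0" using \<epsilon> by (simp add: R_def)
    have c: "c \<in> half_plane 2" by (simp add: c_def half_plane_def)
    have inside: "c + of_real R * z \<in> half_plane \<epsilon>" if "norm z < 1" for z
    proof -
      have "\<bar>Re z\<bar> < 1" using that abs_Re_le_cmod[of z] by simp
      then have "R * (-1) < R * Re z" using R by (intro mult_strict_left_mono) auto
      then show ?thesis by (simp add: half_plane_def c_def R_def)
    qed
    have Re\<phi>: "Re (\<phi> z) < D" if "norm z < 1" for z
      using re[OF inside[OF that]] far[OF c] abs_Re_le_cmod[of "g c"] by (simp add: \<phi>_def D_def)
    have lt: "norm (\<phi> z) < norm (of_real (2 * D) - \<phi> z)" if "norm z < 1" for z
    proof -
      have "(norm (\<phi> z))\<^sup>2 < (norm (of_real (2 * D) - \<phi> z))\<^sup>2"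
        using mult_strict_left_mono[OF Re\<phi>[OF that] D]
        unfolding cmod_power2 by (simp add: power2_eq_square algebra_simps)
      then show ?thesis by (rule power_less_imp_less_base) simp
    qed
    have "\<phi> holomorphic_on ball 0 1"
    proof -
      have "(g \<circ> (\<lambda>z. c + of_real R * z)) holomorphic_on ball 0 1"
        using inside half_plane_mono[of 0 \<epsilon>] \<epsilon>
        by (intro holomorphic_on_compose_gen[OF _ hol] holomorphic_intros) auto
      then show ?thesis unfolding \<phi>_def[abs_def] o_def by (intro holomorphic_intros)
    qed
    then have holF: "F holomorphic_on ball 0 1"
      unfolding F_def[abs_def] using lt by (intro holomorphic_intros) force+
    have F0: "F 0 = 0" by (simp add: F_def \<phi>_def)
    have Flt: "norm (F z) < 1" if "norm z < 1" for z
    proof -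
      have "norm (of_real (2 * D) - \<phi> z) > 0" using lt[OF that] norm_ge_zero[of "\<phi> z"] by linarith
      then show ?thesis using lt[OF that] by (simp add: F_def norm_divide del: of_real_mult)
    qed
    have nx: "norm \<xi> = (3 - Re s) / R"
    proof -
      have "s - c = of_real (Re s - 3)" by (simp add: c_def complex_eq_iff)
      then have "norm (s - c) = \<bar>Re s - 3\<bar>" by (simp only: norm_of_real)
      then show ?thesis using False R by (simp add: \<xi>_def norm_divide)
    qed
    have "(3 - Re s) / R < (3 - 2 * \<epsilon>) / R" using s R by (intro divide_strict_right_mono) (simp_all add: half_plane_def)
    also have "\<dots> = 1 - \<epsilon> / R" using R by (simp add: R_def field_simps)
    also have "1 - \<epsilon> / R \<le> 1 - \<epsilon> / 3"
    proof -
      have "\<epsilon> / 3 \<le> \<epsilon> / R" using \<epsilon> R by (intro divide_left_mono) (auto simp: R_def)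
      then show ?thesis by simp
    qed
    finally have x: "norm \<xi> < 1 - \<epsilon> / 3" using nx by simp
    then have x1: "norm \<xi> < 1" using \<epsilon> by simp
    have sc: "c + of_real R * \<xi> = s" using R by (simp add: \<xi>_def)
    have "norm (F \<xi>) \<le> norm \<xi>" by (rule Schwarz_Lemma(1)[OF holF F0 Flt x1])
    moreover have "of_real (2 * D) - \<phi> \<xi> \<noteq> 0" using lt[OF x1] by auto
    then have "\<phi> \<xi> = F \<xi> * (of_real (2 * D) - \<phi> \<xi>)" by (simp add: F_def del: of_real_mult)
    then have "norm (\<phi> \<xi>) = norm (F \<xi>) * norm (of_real (2 * D) - \<phi> \<xi>)" by (metis norm_mult)
    ultimately have "norm (\<phi> \<xi>) \<le> norm \<xi> * norm (of_real (2 * D) - \<phi> \<xi>)"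
      by (simp add: mult_right_mono del: of_real_mult)
    also have "\<dots> \<le> norm \<xi> * (2 * D + norm (\<phi> \<xi>))"
      using D norm_triangle_ineq4[of "of_real (2 * D)" "\<phi> \<xi>"] by (intro mult_left_mono) auto
    also have "\<dots> \<le> (1 - \<epsilon> / 3) * (2 * D + norm (\<phi> \<xi>))"
      using x D by (intro mult_right_mono) auto
    finally have "(\<epsilon> / 3) * norm (\<phi> \<xi>) \<le> (1 - \<epsilon> / 3) * (2 * D)" by (simp add: algebra_simps)
    also have "\<dots> \<le> 1 * (2 * D)" using \<epsilon> D by (intro mult_right_mono) auto
    finally have "norm (\<phi> \<xi>) \<le> 6 * D / \<epsilon>" using \<epsilon> by (simp add: field_simps)
    moreover have "g s = \<phi> \<xi> + g c" by (simp add: \<phi>_def sc)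
    ultimately show ?thesis
      using norm_triangle_ineq[of "\<phi> \<xi>" "g c"] far[OF c] by (simp add: D_def)
  qed
qed

section \<open>Coefficients of series in the Hardy space\<close>

lemma dirichlet_eq_psum:
  assumes "\<And>n. n > N \<Longrightarrow> p n = 0"
  shows "dirichlet p s = dirichlet_psum p N s"
proof -
  have "dirichlet p s = (\<Sum>n<N. p (Suc n) * of_nat (Suc n) powr (- s))"
    unfolding dirichlet_def using assms by (intro suminf_finite) auto
  then show ?thesis by (simp add: dirichlet_psum_eq_lessThan)
qed

text \<open>
  The coefficient is the mean of \<open>p(it) k\<^sup>i\<^sup>t\<close>, and \<open>\<bar>p(it)\<bar>\<close> has a mean value, so the
  \<open>Lim\<close> in the definition of the norm is an actual limit.
\<close>

lemma coeff_le_H1_norm: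
  assumes p: "dirichlet_polynomial p" and k: "k > 0"
  shows "norm (p k) \<le> H1_norm p"
proof -
  have "finite (insert k {n. p n \<noteq> 0})" using p by (simp add: dirichlet_polynomial_def)
  then obtain N where N: "\<forall>n\<in>insert k {n. p n \<noteq> 0}. n \<le> N" using finite_nat_set_iff_bounded_le by blast
  have eq: "dirichlet p s = dirichlet_psum p N s" for s using N by (intro dirichlet_eq_psum) force
  let ?h = "\<lambda>t. dirichlet_psum p N (Complex 0 t)"
  have vert: "Complex 0 t = 0 + \<i> * of_real t" for t by (simp add: Complex_eq)
  have kN: "k \<le> N" using N by simp
  obtain m where m: "has_mean (\<lambda>t. norm (?h t)) m"
    using continuous_of_trig_poly_has_mean[OF trig_poly_dirichlet_psum, of norm p N 0]
    by (auto intro: continuous_intros)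
  then have H: "H1_norm p = m" unfolding H1_norm_def eq by (rule mean_value_eq)
  have "norm (p k * of_nat k powr (- 0)) \<le> m"
  proof (rule has_mean_norm_le[OF _ m])
    show "has_mean (\<lambda>t. ?h t * of_nat k powr (\<i> * of_real t)) (p k * of_nat k powr (- 0))"
      using has_mean_dirichlet_coeff[OF k, of p N 0] unfolding vert by (simp only: kN if_True)
    show "norm (?h t * of_nat k powr (\<i> * of_real t)) \<le> norm (?h t)" for t
      using k by (simp add: norm_mult norm_of_nat_powr)
  qed (intro continuous_intros k trig_poly_continuous[OF trig_poly_dirichlet_psum])+
  then show ?thesis using k H by simp
qed

text \<open>
  From some index \<open>K\<close> on, the coefficients of the polynomials differ by at most \<open>1\<close> from those of the
  \<open>K\<close>-th one, uniformly in the position.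
\<close>

lemma Hardy1_coeff_bounded:
  assumes "b \<in> Hardy1"
  obtains C where "C \<ge> 0" "\<And>n. n > 0 \<Longrightarrow> norm (b n) \<le> C"
proof -
  obtain p where p: "\<And>k. dirichlet_polynomial (p k)"
    and cauchy: "\<And>\<epsilon>. \<epsilon> > 0 \<Longrightarrow> \<exists>K. \<forall>j\<ge>K. \<forall>k\<ge>K. H1_norm (\<lambda>n. p j n - p k n) < \<epsilon>"
    and lim: "\<And>n. n \<ge> 1 \<Longrightarrow> (\<lambda>k. p k n) \<longlonglongrightarrow> b n"
    using assms unfolding Hardy1_def by blast
  obtain K where K: "\<And>j k. j \<ge> K \<Longrightarrow> k \<ge> K \<Longrightarrow> H1_norm (\<lambda>n. p j n - p k n) < 1"
    using cauchy[of 1] by auto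
  have "norm (b n) \<le> H1_norm (p K) + 1" if n: "n > 0" for n
  proof (rule tendsto_upperbound[OF tendsto_norm[OF lim]])
    have "norm (p j n) \<le> H1_norm (p K) + 1" if "j \<ge> K" for j
    proof -
      have "{n. p j n - p K n \<noteq> 0} \<subseteq> {n. p j n \<noteq> 0} \<union> {n. p K n \<noteq> 0}" by auto
      then have "dirichlet_polynomial (\<lambda>n. p j n - p K n)"
        using p[of j] p[of K] unfolding dirichlet_polynomial_def by (meson finite_UnI finite_subset)
      then have "norm (p j n - p K n) \<le> 1" using coeff_le_H1_norm[OF _ n] K[OF that, of K] by fastforce
      then show ?thesis using coeff_le_H1_norm[OF p[of K] n] norm_triangle_ineq2[of "p j n" "p K n"] by linarith
    qed
    then show "\<forall>\<^sub>F j in sequentially. norm (p j n) \<le> H1_norm (p K) + 1"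
      unfolding eventually_sequentially by blast
  qed (use n in auto)
  moreover have "H1_norm (p K) + 1 \<ge> 0"
    using coeff_le_H1_norm[OF p[of K], of 1] norm_ge_zero[of "p K 1"] by linarith
  ultimately show ?thesis using that by blast
qed

section \<open>Continuation of the logarithm\<close>

lemma dirichlet_identity:
  assumes "g holomorphic_on half_plane 0" "h holomorphic_on half_plane 0"
    and "\<And>s. s \<in> half_plane \<theta> \<Longrightarrow> g s = h s" and "s \<in> half_plane 0"
  shows "g s = h s"
proof -
  define \<theta>' where "\<theta>' = max \<theta> 0"
  have sub: "half_plane \<theta>' \<subseteq> half_plane \<theta>" "half_plane \<theta>' \<subseteq> half_plane 0" by (auto simp: \<theta>'_def half_plane_def)
  have ne: "of_real (\<theta>' + 1) \<in> half_plane \<theta>'" by (simp add: half_plane_def)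
  show ?thesis
  proof (rule analytic_continuation_open[OF open_half_plane open_half_plane _ connected_half_plane sub(2) assms(1,2) _ assms(4)])
    show "half_plane \<theta>' \<noteq> {}" using ne by blast
    show "g z = h z" if "z \<in> half_plane \<theta>'" for z using that sub(1) assms(3) by blast
  qed
qed

lemma summable_bounded_coeff:
  assumes C: "\<And>n. n > 0 \<Longrightarrow> norm (b n) \<le> C"
    and "summable (\<lambda>n. if n \<in> S then real n powr (- \<theta>) else 0)"
  shows "summable (\<lambda>n. norm (coeff_on S b n) * real n powr (- \<theta>))"
proof (rule summable_comparison_test')
  show "summable (\<lambda>n. C * (if n \<in> S then real n powr (- \<theta>) else 0))" by (rule summable_mult[OF assms(2)])
  show "norm (norm (coeff_on S b n) * real n powr (- \<theta>)) \<le> C * (if n \<in> S then real n powr (- \<theta>) else 0)"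
    if "n \<ge> 1" for n
    using C[of n] that by (auto simp: coeff_on_def mult_right_mono)
qed

text \<open>
  The passage to finitely many primes makes the logarithm available on all of \<open>half_plane 0\<close>, and
  everything else in the proof serves to obtain bounds that do not depend on the number of primes.
\<close>

theorem logarithm_abscissa_uniform_le_0:
  assumes a: "abscissa_uniform a \<le> 0"
    and C: "\<And>n. n > 0 \<Longrightarrow> norm (b n) \<le> C"
    and exp: "\<And>s. s \<in> half_plane \<theta> \<Longrightarrow> dirichlet a s = exp (dirichlet b s)"
  shows "abscissa_uniform b \<le> 0"
proof -
  \<comment> \<open>to the right of \<open>2\<close> a series with bounded coefficients converges absolutely\<close>
  define \<theta>' where "\<theta>' = max 2 \<theta>"
  have \<theta>': "\<theta>' \<ge> 2" "half_plane \<theta>' \<subseteq> half_plane \<theta>" by (auto simp: \<theta>'_def half_plane_def)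
  have aconv: "uniformly_convergent_on (half_plane \<theta>) (dirichlet_psum a)" if "\<theta> > 0" for \<theta>
    using a that unfolding abscissa_uniform_le_0_iff by blast
  have bconv: "uniformly_convergent_on (half_plane \<theta>) (dirichlet_psum b)" if "\<theta> \<ge> 2" for \<theta>
  proof -
    have "summable (\<lambda>n. real n powr (- 2))" by (subst summable_real_powr_iff) simp
    then have "summable (\<lambda>n. norm (coeff_on UNIV b n) * real n powr (- 2))"
      by (intro summable_bounded_coeff[OF C]) auto
    then have "uniformly_convergent_on (half_plane 2) (dirichlet_psum (coeff_on UNIV b))"
      by (rule uniformly_convergent_on_dirichlet_psum)
    then show ?thesis
      using uniformly_convergent_on_subset half_plane_mono[OF that] by (simp add: coeff_on_def[abs_def]) blast
  qed
  obtain B where B: "\<And>s. s \<in> half_plane 2 \<Longrightarrow> norm (dirichlet b s) \<le> B"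
    using dirichlet_bounded[OF bconv[of 2]] by auto
  \<comment> \<open>the parts of both series that involve only finitely many primes\<close>
  let ?S = smooth_numbers
  let ?a = "\<lambda>d. coeff_on (?S d) a" and ?b = "\<lambda>d. coeff_on (?S d) b"
  have thin: "thin_set (?S d)" "multiplicative_set (?S d)" for d
    using thin_set_smooth_numbers[of d] by (auto simp: thin_set_def)
  have bdconv: "uniformly_convergent_on (half_plane \<theta>) (dirichlet_psum (?b d))" if "\<theta> > 0" for \<theta> d
    using thin[of d] that unfolding thin_set_def
    by (intro uniformly_convergent_on_dirichlet_psum summable_bounded_coeff[OF C]) auto
  have adconv: "uniformly_convergent_on (half_plane \<theta>) (dirichlet_psum (?a d))" if "\<theta> > 0" for \<theta> d
    by (rule uniformly_convergent_on_coeff_on[OF thin(1) aconv[OF that]])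
  have sigma: "abscissa_uniform (?a d) \<le> 0" "abscissa_uniform (?b d) \<le> 0" for d
    unfolding abscissa_uniform_le_0_iff using adconv bdconv by blast+
  have blim: "dirichlet_limit (?S d) \<theta> (dirichlet b) (dirichlet (?b d))" if "\<theta> \<ge> 2" for d \<theta>
    by (rule dirichlet_limit_dirichlet) (use bconv bdconv that in auto)
  have alim: "dirichlet_limit (?S d) \<theta> (dirichlet a) (dirichlet (?a d))" if "\<theta> > 0" for d \<theta>
    by (rule dirichlet_limit_dirichlet[OF aconv[OF that] adconv[OF that]])
  have expd: "dirichlet (?a d) s = exp (dirichlet (?b d) s)" if "s \<in> half_plane 0" for d s
  proof (rule dirichlet_identity[OF _ _ _ that])
    show "dirichlet (?a d) holomorphic_on half_plane 0" by (rule holomorphic_dirichlet_0[OF sigma(1)])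
    show "(\<lambda>s. exp (dirichlet (?b d) s)) holomorphic_on half_plane 0"
      by (intro holomorphic_intros holomorphic_dirichlet_0[OF sigma(2)])
    show "dirichlet (?a d) s = exp (dirichlet (?b d) s)" if "s \<in> half_plane \<theta>'" for s
      by (rule dirichlet_limit_unique[OF thin(1) alim dirichlet_limit_exp[OF thin(2) blim] _ that])
         (use exp \<theta>' in auto)
  qed
  have bbd: "\<exists>K. \<forall>N. \<forall>s\<in>half_plane (3 * \<epsilon>). norm (dirichlet_psum b N s) \<le> K" if \<epsilon>: "0 < \<epsilon>" "\<epsilon> < 1" for \<epsilon>
  proof -
    obtain M where M: "\<And>s. s \<in> half_plane \<epsilon> \<Longrightarrow> norm (dirichlet a s) \<le> M"
      using dirichlet_bounded[OF aconv[OF \<epsilon>(1)]] by auto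
    define A where "A = max (ln M) 0"
    have A: "A \<ge> 0" by (simp add: A_def)
    define K where "K = B + 6 * (A + B + 1) / \<epsilon>"
    have reb: "Re (dirichlet (?b d) s) \<le> A" if s: "s \<in> half_plane \<epsilon>" for d s
    proof -
      have "norm (dirichlet (?a d) s) \<le> M"
        by (rule dirichlet_limit_contraction[OF thin(1) alim[OF \<epsilon>(1)] M s])
      then have "exp (Re (dirichlet (?b d) s)) \<le> M"
        using expd[of s d] s \<epsilon> by (simp add: half_plane_def)
      then have "Re (dirichlet (?b d) s) \<le> ln M" by (metis exp_gt_zero ln_exp ln_mono order_less_le_trans)
      then show ?thesis by (simp add: A_def)
    qed
    have Kb: "norm (dirichlet (?b d) s) \<le> K" if "s \<in> half_plane (2 * \<epsilon>)" for d s
      unfolding K_def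
    proof (rule borel_caratheodory_half_plane[OF holomorphic_dirichlet_0[OF sigma(2)] \<epsilon> reb _ _ that])
      show "norm (dirichlet (?b d) s) \<le> B" if "s \<in> half_plane 2" for s
        by (rule dirichlet_limit_contraction[OF thin(1) blim[OF order_refl] B that])
    qed (use A in auto)
    obtain D where bohr: "\<And>a N K M \<theta> s. \<lbrakk>N \<le> K; \<And>w. w \<in> half_plane \<theta> \<Longrightarrow> norm (dirichlet_psum a K w) \<le> M;
        s \<in> half_plane (\<theta> + \<epsilon>)\<rbrakk> \<Longrightarrow> norm (dirichlet_psum a N s) \<le> D * M"
      using bohr_inequality[OF \<epsilon>(1)] by metis
    have "norm (dirichlet_psum b N s) \<le> D * (K + 1)" if s: "s \<in> half_plane (3 * \<epsilon>)" for N s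
    proof -
      have "\<forall>\<^sub>F n in sequentially. \<forall>s\<in>half_plane (2 * \<epsilon>). dist (dirichlet_psum (?b N) n s) (dirichlet (?b N) s) < 1"
        using uniform_limitD[OF uniform_limit_dirichlet[OF bdconv[of "2 * \<epsilon>" N]], of 1] \<epsilon> by auto
      then obtain n0 where n0: "\<And>n s. n \<ge> n0 \<Longrightarrow> s\<in>half_plane (2 * \<epsilon>) \<Longrightarrow> dist (dirichlet_psum (?b N) n s) (dirichlet (?b N) s) < 1"
        unfolding eventually_sequentially by blast
      have "norm (dirichlet_psum (?b N) N s) \<le> D * (K + 1)"
      proof (rule bohr[where K = "max N n0" and \<theta> = "2 * \<epsilon>"])
        show "norm (dirichlet_psum (?b N) (max N n0) w) \<le> K + 1" if "w \<in> half_plane (2 * \<epsilon>)" for w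
          using n0[OF _ that, of "max N n0"] Kb[OF that, of N]
            norm_triangle_ineq2[of "dirichlet_psum (?b N) (max N n0) w" "dirichlet (?b N) w"]
          by (simp add: dist_norm)
      qed (use s in auto)
      moreover have "dirichlet_psum (?b N) N s = dirichlet_psum b N s"
        by (rule dirichlet_psum_cong) (auto simp: coeff_on_def smooth_numbers_self)
      ultimately show ?thesis by simp
    qed
    then show ?thesis by blast
  qed
  show ?thesis
    unfolding abscissa_uniform_le_0_iff
  proof (intro allI impI)
    fix \<theta> :: real assume "\<theta> > 0"
    define \<epsilon> where "\<epsilon> = min (\<theta> / 4) (1 / 2)"
    have \<epsilon>: "0 < \<epsilon>" "\<epsilon> < 1" "3 * \<epsilon> + \<epsilon> \<le> \<theta>" using \<open>\<theta> > 0\<close> by (auto simp: \<epsilon>_def)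
    obtain K where "\<And>N s. s\<in>half_plane (3 * \<epsilon>) \<Longrightarrow> norm (dirichlet_psum b N s) \<le> K"
      using bbd[OF \<epsilon>(1,2)] by blast
    from uniformly_convergent_on_partial_sums_bounded[OF \<epsilon>(1) this]
    have "uniformly_convergent_on (half_plane (3 * \<epsilon> + \<epsilon>)) (dirichlet_psum b)" by blast
    then show "uniformly_convergent_on (half_plane \<theta>) (dirichlet_psum b)"
      by (rule uniformly_convergent_on_subset) (rule half_plane_mono[OF \<epsilon>(3)])
  qed
qed

section \<open>The inverse and its mean values\<close>

lemma dirichlet_series_of_exp:
  assumes b: "abscissa_uniform b \<le> 0"
  obtains c where "abscissa_uniform c \<le> 0" "\<And>s. s \<in> half_plane 0 \<Longrightarrow> dirichlet c s = exp (- dirichlet b s)"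
proof (rule dirichlet_series_of_limits[where S = "{0<..}" and h = "\<lambda>s. exp (- dirichlet b s)"])
  fix \<theta> :: real assume "\<theta> > 0"
  have S: "multiplicative_set {0<..}" by (auto simp: multiplicative_set_def)
  have conv: "uniformly_convergent_on (half_plane \<theta>) (dirichlet_psum b)"
    using b \<open>\<theta> > 0\<close> unfolding abscissa_uniform_le_0_iff by blast
  have "dirichlet_psum (coeff_on {0<..} b) = dirichlet_psum b"
    by (intro ext dirichlet_psum_cong) (auto simp: coeff_on_def)
  moreover have "dirichlet (coeff_on {0<..} b) = dirichlet b"
    by (simp add: dirichlet_def coeff_on_def fun_eq_iff)
  ultimately have "dirichlet_limit {0<..} \<theta> (dirichlet b) (dirichlet b)"
    using dirichlet_limit_dirichlet[OF conv, of "{0<..}"] conv by simp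
  from dirichlet_limit_exp[OF S dirichlet_limit_mult[OF S dirichlet_limit_const[OF S, of _ "-1"] this]]
  show "dirichlet_limit {0<..} \<theta> (\<lambda>s. exp (- dirichlet b s)) (\<lambda>s. exp (- dirichlet b s))" by simp
qed (rule that)

lemma has_mean_Re_dirichlet:
  assumes b: "abscissa_uniform b \<le> 0" and "\<sigma> > 0"
  shows "has_mean (\<lambda>t. Re (dirichlet b (Complex \<sigma> t))) (Re (b 1))"
    and "continuous_on UNIV (\<lambda>t. dirichlet b (Complex \<sigma> t))"
proof -
  have conv: "uniformly_convergent_on (half_plane (\<sigma> / 2)) (dirichlet_psum b)"
    using b \<open>\<sigma> > 0\<close> unfolding abscissa_uniform_le_0_iff by simp
  have s: "of_real \<sigma> \<in> half_plane (\<sigma> / 2)" "Complex \<sigma> t \<in> half_plane (\<sigma> / 2)" for t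
    using \<open>\<sigma> > 0\<close> by (auto simp: half_plane_def)
  have m: "has_mean (\<lambda>t. dirichlet b (Complex \<sigma> t)) (b 1)"
    using has_mean_dirichlet[OF conv s(1) zero_less_one] by (simp add: Complex_eq)
  show c: "continuous_on UNIV (\<lambda>t. dirichlet b (Complex \<sigma> t))"
    by (rule continuous_on_compose2[OF holomorphic_on_imp_continuous_on[OF holomorphic_dirichlet[OF conv]]])
       (use s in \<open>auto simp: Complex_eq intro!: continuous_intros\<close>)
  show "has_mean (\<lambda>t. Re (dirichlet b (Complex \<sigma> t))) (Re (b 1))"
    by (rule has_mean_linear[OF m c bounded_linear_Re])
qed

lemma has_mean_exists_lipschitz_dirichlet:
  fixes \<phi> :: "complex \<Rightarrow> real"
  assumes b: "abscissa_uniform b \<le> 0" and "\<sigma> > 0"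
    and \<phi>: "\<And>z w. \<bar>\<phi> z - \<phi> w\<bar> \<le> norm (z - w)"
  shows "\<exists>m. has_mean (\<lambda>t. \<phi> (dirichlet b (Complex \<sigma> t))) m"
    and "continuous_on UNIV \<phi>"
proof -
  have "1-lipschitz_on UNIV \<phi>" using \<phi> by (intro lipschitz_onI) (auto simp: dist_norm)
  then show cont: "continuous_on UNIV \<phi>" by (rule lipschitz_on_continuous_on)
  have conv: "uniformly_convergent_on (half_plane (\<sigma> / 2)) (dirichlet_psum b)"
    using b \<open>\<sigma> > 0\<close> unfolding abscissa_uniform_le_0_iff by simp
  have s: "Complex \<sigma> t \<in> half_plane (\<sigma> / 2)" for t
    using \<open>\<sigma> > 0\<close> by (auto simp: half_plane_def)
  show "\<exists>m. has_mean (\<lambda>t. \<phi> (dirichlet b (Complex \<sigma> t))) m"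
  proof (rule has_mean_exists_uniform_approx)
    show "continuous_on UNIV (\<lambda>t. \<phi> (dirichlet b (Complex \<sigma> t)))"
      by (rule continuous_on_compose2[OF cont has_mean_Re_dirichlet(2)[OF b \<open>\<sigma> > 0\<close>]]) auto
    fix e :: real assume "e > 0"
    then have "\<forall>\<^sub>F N in sequentially. \<forall>s\<in>half_plane (\<sigma> / 2). dist (dirichlet_psum b N s) (dirichlet b s) < e"
      using uniform_limitD[OF uniform_limit_dirichlet[OF conv]] by blast
    then obtain N where N: "\<And>s. s \<in> half_plane (\<sigma> / 2) \<Longrightarrow> dist (dirichlet_psum b N s) (dirichlet b s) < e"
      unfolding eventually_sequentially by blast
    have "norm (\<phi> (dirichlet b (Complex \<sigma> t)) - \<phi> (dirichlet_psum b N (Complex \<sigma> t))) \<le> e" for t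
      using \<phi>[of "dirichlet b (Complex \<sigma> t)" "dirichlet_psum b N (Complex \<sigma> t)"] N[OF s[of t]]
      by (simp add: dist_norm norm_minus_commute)
    moreover have "continuous_on UNIV (\<lambda>t. \<phi> (dirichlet_psum b N (Complex \<sigma> t)))"
      by (rule continuous_on_compose2[OF cont trig_poly_continuous[OF trig_poly_dirichlet_psum]]) auto
    ultimately show "\<exists>k m. has_mean k m \<and> continuous_on UNIV k \<and>
        (\<forall>t. norm (\<phi> (dirichlet b (Complex \<sigma> t)) - k t) \<le> e)"
      using continuous_of_trig_poly_has_mean[OF trig_poly_dirichlet_psum cont, of b N \<sigma>] by blast
  qed
qed

text \<open>
  With \<open>z = dirichlet b (\<sigma> + it)\<close>, the function \<open>log_plus\<close> of the modulus of \<open>exp z\<close> is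
  \<open>max (Re z) 0\<close>, and \<open>max (- Re z) 0 = max (Re z) 0 - Re z\<close>.
\<close>

lemma mean_log_plus_inverse:
  assumes b: "abscissa_uniform b \<le> 0" and "\<sigma> > 0"
  shows "mean_value (\<lambda>t. log_plus (norm (exp (- dirichlet b (Complex \<sigma> t))))) =
         mean_value (\<lambda>t. log_plus (norm (exp (dirichlet b (Complex \<sigma> t))))) - Re (b 1)"
proof -
  let ?g = "\<lambda>t. dirichlet b (Complex \<sigma> t)"
  have lip: "\<bar>max (Re z) 0 - max (Re w) 0\<bar> \<le> norm (z - w)" for z w
    using abs_Re_le_cmod[of "z - w"] by (auto simp: max_def)
  obtain m where m: "has_mean (\<lambda>t. max (Re (?g t)) 0) m"
    using has_mean_exists_lipschitz_dirichlet(1)[OF assms, of "\<lambda>z. max (Re z) 0"] lip by blast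
  have cont: "continuous_on UNIV ?g" by (rule has_mean_Re_dirichlet(2)[OF assms])
  have "has_mean (\<lambda>t. max (Re (?g t)) 0 + - Re (?g t)) (m + - Re (b 1))"
    by (intro has_mean_add m has_mean_linear[OF has_mean_Re_dirichlet(1)[OF assms]]
        bounded_linear_minus bounded_linear_ident continuous_intros cont)
  moreover have "max (Re z) 0 + - Re z = max (- Re z) 0" for z by (auto simp: max_def)
  ultimately have "has_mean (\<lambda>t. max (- Re (?g t)) 0) (m - Re (b 1))" by simp
  then show ?thesis using mean_value_eq m by (simp add: log_plus_def mean_value_eq)
qed

lemma exp_inverse_in_Nevanlinna:
  assumes f: "f \<in> Nevanlinna_u" and b: "abscissa_uniform b \<le> 0" and c: "abscissa_uniform c \<le> 0"
    and fb: "\<And>s. s \<in> half_plane 0 \<Longrightarrow> dirichlet f s = exp (dirichlet b s)"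
    and cb: "\<And>s. s \<in> half_plane 0 \<Longrightarrow> dirichlet c s = exp (- dirichlet b s)"
  shows "c \<in> Nevanlinna_u"
proof -
  let ?F = "\<lambda>\<sigma>. mean_value (\<lambda>t. log_plus (norm (dirichlet f (Complex \<sigma> t))))"
  let ?G = "\<lambda>\<sigma>. mean_value (\<lambda>t. log_plus (norm (dirichlet c (Complex \<sigma> t))))"
  have eq: "?G \<sigma> = ?F \<sigma> - Re (b 1)" if "\<sigma> > 0" for \<sigma>
    using mean_log_plus_inverse[OF b that] that by (simp add: fb cb half_plane_def)
  have "Limsup (at_right 0) (\<lambda>\<sigma>. ereal (?F \<sigma>)) < \<infinity>" using f by (simp add: Nevanlinna_u_def)
  then obtain r where r: "Limsup (at_right 0) (\<lambda>\<sigma>. ereal (?F \<sigma>)) < ereal r" using ereal_dense2 by blast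
  have "\<forall>\<^sub>F \<sigma> in at_right 0. ereal (?G \<sigma>) \<le> ereal (r - Re (b 1))"
    using Limsup_lessD[OF r] eventually_at_right_less[of 0]
  proof eventually_elim
    case (elim \<sigma>)
    then show ?case using eq[of \<sigma>] by simp
  qed
  then have "Limsup (at_right 0) (\<lambda>\<sigma>. ereal (?G \<sigma>)) \<le> ereal (r - Re (b 1))" by (rule Limsup_bounded)
  then have "Limsup (at_right 0) (\<lambda>\<sigma>. ereal (?G \<sigma>)) < \<infinity>" by (rule order.strict_trans1) simp
  then show ?thesis using c by (simp add: Nevanlinna_u_def)
qed

theorem theorem5p1:
  fixes f :: "nat \<Rightarrow> complex"
  assumes "f \<in> Nevanlinna_u"
    and "\<exists>g\<in>Hardy1. \<forall>s\<in>half_plane (1/2). dirichlet f s = exp (dirichlet g s)"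
  shows "invertible_Nevanlinna_u f"
proof -
  obtain g where g: "g \<in> Hardy1" "\<And>s. s \<in> half_plane (1/2) \<Longrightarrow> dirichlet f s = exp (dirichlet g s)"
    using assms(2) by blast
  obtain C where C: "\<And>n. n > 0 \<Longrightarrow> norm (g n) \<le> C" using Hardy1_coeff_bounded[OF g(1)] by blast
  have f: "abscissa_uniform f \<le> 0" using assms(1) by (simp add: Nevanlinna_u_def)
  have \<sigma>: "abscissa_uniform g \<le> 0" by (rule logarithm_abscissa_uniform_le_0[OF f C g(2)])
  have fg: "dirichlet f s = exp (dirichlet g s)" if "s \<in> half_plane 0" for s
    by (rule dirichlet_identity[OF holomorphic_dirichlet_0[OF f] _ g(2) that])
       (intro holomorphic_intros holomorphic_dirichlet_0[OF \<sigma>])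
  obtain c where c: "abscissa_uniform c \<le> 0" "\<And>s. s \<in> half_plane 0 \<Longrightarrow> dirichlet c s = exp (- dirichlet g s)"
    using dirichlet_series_of_exp[OF \<sigma>] by blast
  have "c \<in> Nevanlinna_u" by (rule exp_inverse_in_Nevanlinna[OF assms(1) \<sigma> c(1) fg c(2)])
  moreover have "dirichlet f s \<noteq> 0 \<and> dirichlet c s = 1 / dirichlet f s" if "s \<in> half_plane 0" for s
    using fg[OF that] c(2)[OF that] by (simp add: exp_minus inverse_eq_divide)
  ultimately show ?thesis unfolding invertible_Nevanlinna_u_def using assms(1) by blast
qed

end
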